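(* Let $\dim V=(n|m)$ and consider the algebra homomorphism $\Phi: S^\bullet(U\otimes W)\to(\mathfrak A^{p,q}_{k,l})^{\mathfrak{gl}(V)}$ defined by $u_r\otimes w_s\mapsto(v_r^*,v_s)$. The kernel of $\Phi$ (the ideal of relations between the scalar products) is generated by the polynomials $P_t(I,J)$, where $t$ is a fixed standard tableau of rectangular shape with $n+1$ rows of length $m+1$, and $I$, $J$ run over the $t$-semistandard sequences with entries in $R_U$ and $R_W$, respectively.
   Context: Notation as follows. $\mathfrak A^{p,q}_{k,l}=S^\bullet(U\otimes V\oplus V^*\otimes W)$, $\dim U=(k|l)$, $\dim W=(p|q)$, with homogeneous bases $u_r$ ($r\in R_U=\{1,\dots,k,\bar1,\dots,\bar l\}$), $w_s$ ($s\in R_W=\{1,\dots,p,\bar1,\dots,\bar q\}$), $e_i$ ($i\in R_V=\{1,\dots,n,\bar1,\dots,\bar m\}$), $e_i^*$ the left dual basis, barred indices odd. $x_{ri}=u_r\otimes e_i$, $x^*_{is}=e_i^*\otimes w_s$, $(v_r^*,v_s)=\sum_{i\in R_V}x_{ri}x^*_{is}$. Index order: unbarred indices precede barred ones, natural order within each type. Tableaux: $R_t,C_t$ row/column stabilizers, $\varepsilon$ sign character; a sequence $I$ is placed in $t$ by putting $i_\alpha$ in the cell containing $\alpha$; $I$ is $t$-semistandard if entries weakly increase along rows and down columns, unbarred entries strictly increase down columns, barred entries strictly increase along rows. $c(I,\sigma)=\pm1$ is defined by $x_{\sigma^{-1}I}=c(I,\sigma)x_I$ in the free supercommutative algebra on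 generators $x_i$ of parity $p(i)$ ($\mathfrak S_N$ permutes positions of sequences). With $z_{rs}=u_r\otimes w_s$, $Z(I,J)=(-1)^{\sum_{\alpha>\beta}p(i_\alpha)p(j_\beta)}\prod_\alpha z_{i_\alpha j_\alpha}$ and $P_t(I,J)=\sum_{\sigma\in R_t,\tau\in C_t}\varepsilon(\tau)c(I,(\sigma\tau)^{-1})Z(\sigma\tau I,J)$. *)

theory Defs
  imports Complex_Main "HOL-Library.Product_Lexorder" "HOL-Combinatorics.Permutations" "HOL-Library.Function_Algebras"
begin

text \<open>An index is a pair (b, i): b = False means the unbarred (even) index i,
  b = True the barred (odd) index \<open>bar i\<close>.  The lexicographic order on
  bool \<times> nat (False < True) is exactly the paper's order: unbarred indices precede
  barred ones, natural order within each type.\<close>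

type_synonym ix = "bool \<times> nat"

definition par_ix :: "ix \<Rightarrow> bool" where "par_ix x = fst x"

definition Rset :: "nat \<Rightarrow> nat \<Rightarrow> ix set" where
  "Rset a b = {(False, i) | i. 1 \<le> i \<and> i \<le> a} \<union> {(True, i) | i. 1 \<le> i \<and> i \<le> b}"

text \<open>Generators are the elements of a linearly ordered type 'v with a parity
  function par (True = odd).  A monomial is an exponent function with finite support,
  odd exponents at most 1; it stands for the product of its generators in increasing
  order.  An element is a finitely supported coefficient function on monomials.\<close>

type_synonym 'v mono = "'v \<Rightarrow> nat"
type_synonym 'v spoly = "'v mono \<Rightarrow> complex"

definition valid_mono :: "('v \<Rightarrow> bool) \<Rightarrow> 'v mono \<Rightarrow> bool" where
  "valid_mono par m \<longleftrightarrow> finite {v. m v \<noteq> 0} \<and> (\<forall>v. par v \<longrightarrow> m v \<le> 1)"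

definition spolys :: "('v \<Rightarrow> bool) \<Rightarrow> 'v spoly set" where
  "spolys par = {f. finite {m. f m \<noteq> 0} \<and> (\<forall>m. f m \<noteq> 0 \<longrightarrow> valid_mono par m)}"

definition spolys_on :: "('v \<Rightarrow> bool) \<Rightarrow> 'v set \<Rightarrow> 'v spoly set" where
  "spolys_on par X = {f \<in> spolys par. \<forall>m. f m \<noteq> 0 \<longrightarrow> {v. m v \<noteq> 0} \<subseteq> X}"

text \<open>Sign with x^m1 * x^m2 = sign * x^(m1+m2) (ordered monomials).\<close>
definition mono_sign :: "('v::linorder \<Rightarrow> bool) \<Rightarrow> 'v mono \<Rightarrow> 'v mono \<Rightarrow> complex" where
  "mono_sign par m1 m2 =
     (-1) ^ card {(a, b). par a \<and> par b \<and> m1 a \<noteq> 0 \<and> m2 b \<noteq> 0 \<and> b < a}"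

definition smult :: "('v::linorder \<Rightarrow> bool) \<Rightarrow> 'v spoly \<Rightarrow> 'v spoly \<Rightarrow> 'v spoly" where
  "smult par f g = (\<lambda>m. if valid_mono par m
       then (\<Sum>m1 \<in> {m1. m1 \<le> m}. mono_sign par m1 (m - m1) * f m1 * g (m - m1))
       else 0)"

definition sone :: "'v spoly" where
  "sone = (\<lambda>m. if m = (\<lambda>_. 0) then 1 else 0)"

definition svar :: "'v \<Rightarrow> 'v spoly" where
  "svar v = (\<lambda>m. if m = (\<lambda>u. if u = v then 1 else 0) then 1 else 0)"

definition spow :: "('v::linorder \<Rightarrow> bool) \<Rightarrow> 'v spoly \<Rightarrow> nat \<Rightarrow> 'v spoly" where
  "spow par f k = (smult par f ^^ k) sone"

definition mono_eval :: "('w::linorder \<Rightarrow> bool) \<Rightarrow> ('v::linorder \<Rightarrow> 'w spoly) \<Rightarrow> 'v mono \<Rightarrow> 'w spoly" where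
  "mono_eval parw img m =
     foldr (\<lambda>v acc. smult parw (spow parw (img v) (m v)) acc)
           (sorted_list_of_set {v. m v \<noteq> 0}) sone"

definition seval :: "('w::linorder \<Rightarrow> bool) \<Rightarrow> ('v::linorder \<Rightarrow> 'w spoly) \<Rightarrow> 'v spoly \<Rightarrow> 'w spoly" where
  "seval parw img f = (\<lambda>x. \<Sum>m \<in> {m. f m \<noteq> 0}. f m * mono_eval parw img m x)"

inductive_set sideal :: "('v::linorder \<Rightarrow> bool) \<Rightarrow> 'v spoly set \<Rightarrow> 'v spoly set \<Rightarrow> 'v spoly set"
  for par C G where
  zero: "0 \<in> sideal par C G"
| gen: "g \<in> G \<Longrightarrow> g \<in> sideal par C G"
| add: "a \<in> sideal par C G \<Longrightarrow> b \<in> sideal par C G \<Longrightarrow> a + b \<in> sideal par C G"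
| mult_left: "a \<in> sideal par C G \<Longrightarrow> r \<in> C \<Longrightarrow> smult par r a \<in> sideal par C G"
| mult_right: "a \<in> sideal par C G \<Longrightarrow> r \<in> C \<Longrightarrow> smult par a r \<in> sideal par C G"

text \<open>Generators of S(U\<otimes>W): z_rs = (r, s), parity p(r)+p(s).\<close>
type_synonym zvar = "ix \<times> ix"

definition par_Z :: "zvar \<Rightarrow> bool" where
  "par_Z z = (par_ix (fst z) \<noteq> par_ix (snd z))"

text \<open>Generators of A: (False, r, i) is x_ri = u_r \<otimes> e_i, (True, i, s) is
  x*_is = e*_i \<otimes> w_s; parity is the sum of the parities of the indices.\<close>
type_synonym avar = "bool \<times> ix \<times> ix"

definition par_A :: "avar \<Rightarrow> bool" where
  "par_A x = (par_ix (fst (snd x)) \<noteq> par_ix (snd (snd x)))"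

definition scal :: "nat \<Rightarrow> nat \<Rightarrow> zvar \<Rightarrow> avar spoly" where
  "scal n m z = (\<Sum>i \<in> Rset n m. smult par_A (svar (False, fst z, i)) (svar (True, i, snd z)))"

definition Phi :: "nat \<Rightarrow> nat \<Rightarrow> zvar spoly \<Rightarrow> avar spoly" where
  "Phi n m f = seval par_A (scal n m) f"

text \<open>Kernel of Phi on S(U\<otimes>W), dim U = (k|l), dim W = (p|q).\<close>
definition ker_Phi :: "nat \<Rightarrow> nat \<Rightarrow> nat \<Rightarrow> nat \<Rightarrow> nat \<Rightarrow> nat \<Rightarrow> zvar spoly set" where
  "ker_Phi k l p q n m = {f \<in> spolys_on par_Z (Rset k l \<times> Rset p q). Phi n m f = 0}"

text \<open>Rectangular shape with n+1 rows of length m+1; cells (a, b) with a the row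
  and b the column, both counted from 0; a tableau t fills the cells bijectively
  with 1..N, N = (n+1)(m+1).\<close>

definition cells :: "nat \<Rightarrow> nat \<Rightarrow> (nat \<times> nat) set" where
  "cells n m = {0..n} \<times> {0..m}"

definition Nbox :: "nat \<Rightarrow> nat \<Rightarrow> nat" where
  "Nbox n m = (n + 1) * (m + 1)"

definition standard_tableau :: "nat \<Rightarrow> nat \<Rightarrow> (nat \<times> nat \<Rightarrow> nat) \<Rightarrow> bool" where
  "standard_tableau n m t \<longleftrightarrow>
     bij_betw t (cells n m) {1..Nbox n m} \<and>
     (\<forall>a b. a \<le> n \<and> b < m \<longrightarrow> t (a, b) < t (a, b + 1)) \<and>
     (\<forall>a b. a < n \<and> b \<le> m \<longrightarrow> t (a, b) < t (a + 1, b))"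

definition row_stab :: "nat \<Rightarrow> nat \<Rightarrow> (nat \<times> nat \<Rightarrow> nat) \<Rightarrow> (nat \<Rightarrow> nat) set" where
  "row_stab n m t = {\<sigma>. \<sigma> permutes {1..Nbox n m} \<and>
      (\<forall>c \<in> cells n m. \<exists>b \<le> m. \<sigma> (t c) = t (fst c, b))}"

definition col_stab :: "nat \<Rightarrow> nat \<Rightarrow> (nat \<times> nat \<Rightarrow> nat) \<Rightarrow> (nat \<Rightarrow> nat) set" where
  "col_stab n m t = {\<sigma>. \<sigma> permutes {1..Nbox n m} \<and>
      (\<forall>c \<in> cells n m. \<exists>a \<le> n. \<sigma> (t c) = t (a, snd c))}"

text \<open>Sequences are functions on positions 1..N; the symmetric group acts on positions:
  (\<sigma> I)_\<sigma>(\<alpha>) = i_\<alpha>.\<close>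
definition act :: "(nat \<Rightarrow> nat) \<Rightarrow> (nat \<Rightarrow> ix) \<Rightarrow> nat \<Rightarrow> ix" where
  "act \<sigma> I = I \<circ> inv \<sigma>"

text \<open>c(I, \<sigma>): x_{\<sigma>^{-1} I} = c(I,\<sigma>) x_I in the free supercommutative algebra, where
  (\<sigma>^{-1} I)_\<alpha> = i_\<sigma>(\<alpha>); written out as the Koszul sign of the reordering.\<close>
definition csign :: "nat \<Rightarrow> (nat \<Rightarrow> ix) \<Rightarrow> (nat \<Rightarrow> nat) \<Rightarrow> complex" where
  "csign N I \<sigma> = (-1) ^ card {(\<alpha>, \<beta>). \<alpha> \<in> {1..N} \<and> \<beta> \<in> {1..N} \<and> \<alpha> < \<beta> \<and>
       \<sigma> \<beta> < \<sigma> \<alpha> \<and> par_ix (I (\<sigma> \<alpha>)) \<and> par_ix (I (\<sigma> \<beta>))}"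

definition Zmon :: "nat \<Rightarrow> (nat \<Rightarrow> ix) \<Rightarrow> (nat \<Rightarrow> ix) \<Rightarrow> zvar spoly" where
  "Zmon N I J = (\<lambda>x. (-1) ^ card {(\<alpha>, \<beta>). \<alpha> \<in> {1..N} \<and> \<beta> \<in> {1..N} \<and> \<beta> < \<alpha> \<and>
                        par_ix (I \<alpha>) \<and> par_ix (J \<beta>)} *
       foldr (\<lambda>\<alpha> acc. smult par_Z (svar (I \<alpha>, J \<alpha>)) acc) [1..<N + 1] sone x)"

definition Pt :: "nat \<Rightarrow> nat \<Rightarrow> (nat \<times> nat \<Rightarrow> nat) \<Rightarrow> (nat \<Rightarrow> ix) \<Rightarrow> (nat \<Rightarrow> ix) \<Rightarrow> zvar spoly" where
  "Pt n m t I J = (\<lambda>x. \<Sum>\<sigma> \<in> row_stab n m t. \<Sum>\<tau> \<in> col_stab n m t.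
      of_int (sign \<tau>) * csign (Nbox n m) I (inv (\<sigma> \<circ> \<tau>)) * Zmon (Nbox n m) (act (\<sigma> \<circ> \<tau>) I) J x)"

definition semistandard :: "nat \<Rightarrow> nat \<Rightarrow> (nat \<times> nat \<Rightarrow> nat) \<Rightarrow> ix set \<Rightarrow> (nat \<Rightarrow> ix) \<Rightarrow> bool" where
  "semistandard n m t R I \<longleftrightarrow>
     (\<forall>\<alpha> \<in> {1..Nbox n m}. I \<alpha> \<in> R) \<and>
     (\<forall>a b. a \<le> n \<and> b < m \<longrightarrow> I (t (a, b)) \<le> I (t (a, b + 1)) \<and>
              (I (t (a, b)) = I (t (a, b + 1)) \<longrightarrow> \<not> par_ix (I (t (a, b))))) \<and>
     (\<forall>a b. a < n \<and> b \<le> m \<longrightarrow> I (t (a, b)) \<le> I (t (a + 1, b)) \<and>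
              (I (t (a, b)) = I (t (a + 1, b)) \<longrightarrow> par_ix (I (t (a, b)))))"

end

theory Submission
  imports Defs "HOL-Library.FuncSet"
begin

text \<open>
  Write \<open>Z(I,J)\<close> for the signed monomials and let the symmetric group \<open>S\<^sub>N\<close> act on sequences with Koszul signs.
  Then \<open>\<Phi>(Z(I,J)) = \<Sum>\<^sub>K \<plusminus> X(I,K) X*(K,J)\<close>, and reading off matrix coefficients of \<open>V\<^bsup>\<otimes>N\<^esup>\<close> shows that the kernel
  in degree \<open>N\<close> is annihilated by the conjugation averages of \<open>h\<^sub>K y\<close>, where \<open>h\<^sub>K\<close> is the signed sum over the
  stabilizer of a sequence \<open>K\<close> with entries in \<open>R\<^sub>V\<close>. It therefore suffices to write the identity of the group
  algebra as a combination of the elements \<open>x h\<^sub>K y\<close> and \<open>x e\<^sub>t y\<close>, \<open>e\<^sub>t\<close> being the Young symmetrizer of the rectangle.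

  If this failed, a nonzero left ideal would be killed by the adjoints of all these elements. Choose in it a nonzero
  vector that is symmetric on \<open>n\<close> disjoint blocks, as large as possible, and then antisymmetric on \<open>m\<close> disjoint blocks
  of the rest, again as large as possible. If the blocks cover everything, some \<open>h\<^sub>K\<close> does not kill the vector.
  Otherwise maximality says that \<open>\<Sum>\<^sub>y (x y)\<close>, over the \<open>y\<close> in one of the blocks, acts on the vector by a sign whenever
  \<open>x\<close> lies outside this block and the earlier ones.
  Comparing these eigenvalues with the positivity of symmetrizers for the invariant inner product, one can
  enlarge column antisymmetrizers cell by cell without killing the vector, until the rectangle is filled.

  That \<open>P\<^sub>t(I,J)\<close> lies in the kernel, and that semistandard \<open>I\<close> and \<open>J\<close> suffice, both follow from straightening by
  Garnir relations: a rectangle with \<open>n + 1\<close> rows of length \<open>m + 1\<close> has no semistandard filling with entries in \<open>R\<^sub>V\<close>.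
\<close>

subsection \<open>Free supercommutative algebras\<close>

text \<open>The sizes of the rectangle come from counting blocks. A point left outside the
  \<open>n\<close> symmetric and \<open>m\<close> antisymmetric blocks can be joined with a suitable
  point of each antisymmetric block, and these \<open>m + 1\<close> points can be symmetrized
  without killing the vector. Maximality then forces each of the \<open>n\<close> symmetric blocks
  to have at least \<open>m + 1\<close> points, so \<open>n + 1\<close> rows of length
  \<open>m + 1\<close> are available. This takes the place of a classification of the irreducible
  modules of the symmetric group by shapes; the substitute for semisimplicity is the positive
  invariant inner product, which is why the group algebra is taken over the reals.

  Conjugation averages arise because a coefficient that is well defined on commuting letters must be
  summed over all orders of these letters. They lose nothing: the conjugates of the identity of the
  group algebra are all the identity, so its average still returns a nonzero multiple of
  \<open>Z(I,J)\<close>.\<close>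

definition scl :: "complex \<Rightarrow> ('a \<Rightarrow> complex) \<Rightarrow> 'a \<Rightarrow> complex" where
  "scl c f = (\<lambda>x. c * f x)"

lemma scl_apply [simp]: "scl c f x = c * f x"
  by (simp add: scl_def)

lemma scl_one [simp]: "scl 1 f = f" and scl_zero [simp]: "scl 0 f = 0"
  and scl_scl [simp]: "scl c (scl d f) = scl (c * d) f" and scl_0_right [simp]: "scl c 0 = 0"
  by (auto simp: fun_eq_iff)

lemma sum_fun_apply: "(\<Sum>i\<in>A. f i) x = (\<Sum>i\<in>A. f i x)"
  by (induction A rule: infinite_finite_induct) auto

lemma scl_sum: "scl c (\<Sum>i\<in>A. f i) = (\<Sum>i\<in>A. scl c (f i))"
  by (auto simp: fun_eq_iff sum_fun_apply sum_distrib_left)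

lemma valid_mono_le: "valid_mono par m \<Longrightarrow> m1 \<le> m \<Longrightarrow> valid_mono par m1"
  unfolding valid_mono_def le_fun_def
  by (metis (mono_tags, lifting) bot_nat_0.extremum_uniqueI finite_subset le_trans mem_Collect_eq subsetI)

lemma valid_mono_diff: "valid_mono par m \<Longrightarrow> valid_mono par (m - m1)"
  by (erule valid_mono_le) (simp add: le_fun_def)

lemma finite_le_mono:
  assumes "valid_mono par m" shows "finite {m1. m1 \<le> m}"
proof -
  let ?A = "{v. m v \<noteq> 0}"
  have fA: "finite ?A" using assms by (simp add: valid_mono_def)
  have "{m1. m1 \<le> m} \<subseteq> {f. \<forall>x. (x \<in> ?A \<longrightarrow> f x \<in> {..sum m ?A}) \<and> (x \<notin> ?A \<longrightarrow> f x = 0)}"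
  proof
    fix f assume "f \<in> {m1. m1 \<le> m}"
    then have le: "\<And>x. f x \<le> m x" by (simp add: le_fun_def)
    have "f x \<le> sum m ?A" if "m x \<noteq> 0" for x
      using le[of x] member_le_sum[of x ?A m] fA that by auto
    moreover have "f x = 0" if "m x = 0" for x using le[of x] that by simp
    ultimately show "f \<in> {f. \<forall>x. (x \<in> ?A \<longrightarrow> f x \<in> {..sum m ?A}) \<and> (x \<notin> ?A \<longrightarrow> f x = 0)}" by auto
  qed
  then show ?thesis using finite_set_of_finite_funs[OF fA, of "{..sum m ?A}" 0] finite_subset by blast
qed

lemma mono_sign_set_finite:
  assumes "finite {v. a v \<noteq> (0::nat)}" "finite {v. b v \<noteq> (0::nat)}"
  shows "finite {(x, y). par x \<and> par y \<and> a x \<noteq> 0 \<and> b y \<noteq> 0 \<and> y < x}"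
  by (rule finite_subset[OF _ finite_cartesian_product[OF assms]]) auto

text \<open>Validity of \<open>a + b\<close> makes the sign multiplicative: an odd generator cannot
  occur in both \<open>a\<close> and \<open>b\<close>, so the two sets of odd inversions against
  \<open>d\<close> are disjoint.\<close>

lemma mono_sign_add_left:
  assumes "valid_mono par (a + b)" "finite {v. d v \<noteq> 0}"
  shows "mono_sign par (a + b) d = mono_sign par a d * mono_sign par b d"
proof -
  let ?S = "\<lambda>a. {(x, y). par x \<and> par y \<and> a x \<noteq> 0 \<and> d y \<noteq> 0 \<and> y < x}"
  have va: "valid_mono par a" "valid_mono par b"
    using valid_mono_le[OF assms(1)] by (auto simp: le_fun_def)
  have "?S (a + b) = ?S a \<union> ?S b" by auto
  moreover have "?S a \<inter> ?S b = {}"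
  proof -
    have "\<not> (a x \<noteq> 0 \<and> b x \<noteq> 0)" if "par x" for x
    proof -
      have "a x + b x \<le> 1" using assms(1) that by (auto simp: valid_mono_def)
      then show ?thesis by auto
    qed
    then show ?thesis by blast
  qed
  moreover have "finite (?S a)" "finite (?S b)"
    using mono_sign_set_finite va assms(2) by (auto simp: valid_mono_def)
  ultimately show ?thesis by (simp add: mono_sign_def card_Un_disjoint power_add)
qed

lemma mono_sign_add_right:
  assumes "valid_mono par (a + b)" "finite {v. d v \<noteq> 0}"
  shows "mono_sign par d (a + b) = mono_sign par d a * mono_sign par d b"
proof -
  let ?S = "\<lambda>a. {(x, y). par x \<and> par y \<and> d x \<noteq> 0 \<and> a y \<noteq> 0 \<and> y < x}"
  have va: "valid_mono par a" "valid_mono par b"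
    using valid_mono_le[OF assms(1)] by (auto simp: le_fun_def)
  have "?S (a + b) = ?S a \<union> ?S b" by auto
  moreover have "?S a \<inter> ?S b = {}"
  proof -
    have "\<not> (a x \<noteq> 0 \<and> b x \<noteq> 0)" if "par x" for x
    proof -
      have "a x + b x \<le> 1" using assms(1) that by (auto simp: valid_mono_def)
      then show ?thesis by auto
    qed
    then show ?thesis by blast
  qed
  moreover have "finite (?S a)" "finite (?S b)"
    using mono_sign_set_finite va assms(2) by (auto simp: valid_mono_def)
  ultimately show ?thesis by (simp add: mono_sign_def card_Un_disjoint power_add)
qed

lemma smult_assoc: "smult par (smult par f g) h = smult par f (smult par g h)"
proof
  fix m
  show "smult par (smult par f g) h m = smult par f (smult par g h) m"
  proof (cases "valid_mono par m")
    case True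
    let ?D = "\<lambda>m. {m1. m1 \<le> m}"
    have fin: "finite (?D a)" if "a \<le> m" for a using finite_le_mono valid_mono_le[OF True that] by blast
    \<comment> \<open>The cocycle identity behind associativity: both products count the odd
      inversions between the three consecutive parts \<open>b\<close>, \<open>a - b\<close> and
      \<open>m - a\<close> of \<open>m\<close>.\<close>
    have ms: "mono_sign par a (m - a) * mono_sign par b (a - b)
            = mono_sign par b (m - b) * mono_sign par (a - b) (m - b - (a - b))"
      if "a \<le> m" "b \<le> a" for a b
    proof -
      have e: "a = b + (a - b)" "m - b = (a - b) + (m - a)" "m - b - (a - b) = m - a"
        using that by (auto simp: fun_eq_iff le_fun_def)
      have fins: "finite {v. c v \<noteq> 0}" if "c \<le> m" for c
        using valid_mono_le[OF True that] by (simp add: valid_mono_def)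
      have "mono_sign par a (m - a) = mono_sign par b (m - a) * mono_sign par (a - b) (m - a)"
        using mono_sign_add_left[of par b "a - b" "m - a"] e(1) valid_mono_le[OF True that(1)] fins[of "m - a"]
        by (metis valid_mono_def valid_mono_diff True)
      moreover have "mono_sign par b (m - b) = mono_sign par b (a - b) * mono_sign par b (m - a)"
        using mono_sign_add_right[of par "a - b" "m - a" b] e(2) valid_mono_diff[OF True, of b] fins[of b] that
        by (metis order_trans)
      ultimately show ?thesis using e(3) by simp
    qed
    have "smult par (smult par f g) h m
        = (\<Sum>a\<in>?D m. \<Sum>b\<in>?D a. mono_sign par a (m - a) * mono_sign par b (a - b) * f b * g (a - b) * h (m - a))"
      unfolding smult_def using True valid_mono_le[OF True]
      by (auto intro!: sum.cong simp: sum_distrib_left sum_distrib_right algebra_simps)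
    also have "\<dots> = (\<Sum>(a, b)\<in>Sigma (?D m) ?D. mono_sign par a (m - a) * mono_sign par b (a - b) * f b * g (a - b) * h (m - a))"
      using fin True finite_le_mono by (subst sum.Sigma) auto
    also have "\<dots> = (\<Sum>(b, c)\<in>Sigma (?D m) (\<lambda>b. ?D (m - b)).
        mono_sign par b (m - b) * mono_sign par c (m - b - c) * f b * g c * h (m - b - c))"
    proof (rule sum.reindex_bij_witness[where i = "\<lambda>(b, c). (b + c, b)" and j = "\<lambda>(a, b). (b, a - b)"])
      fix x assume x: "x \<in> Sigma (?D m) ?D"
      obtain a b where ab: "x = (a, b)" "a \<le> m" "b \<le> a" using x by auto
      show "(case case x of (a, b) \<Rightarrow> (b, a - b) of (b, c) \<Rightarrow> (b + c, b)) = x"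
        using ab by (auto simp: fun_eq_iff le_fun_def)
      show "(case x of (a, b) \<Rightarrow> (b, a - b)) \<in> Sigma (?D m) (\<lambda>b. ?D (m - b))"
        using ab by (auto simp: le_fun_def intro: order_trans diff_le_mono)
      have "m - b - (a - b) = m - a"
        using ab by (auto simp: fun_eq_iff le_fun_def)
      then show "(case case x of (a, b) \<Rightarrow> (b, a - b) of (b, c) \<Rightarrow>
         mono_sign par b (m - b) * mono_sign par c (m - b - c) * f b * g c * h (m - b - c)) =
         (case x of (a, b) \<Rightarrow> mono_sign par a (m - a) * mono_sign par b (a - b) * f b * g (a - b) * h (m - a))"
        using ms[OF ab(2,3)] ab(1) by simp
    next
      fix y assume "y \<in> Sigma (?D m) (\<lambda>b. ?D (m - b))"
      then obtain b c where bc: "y = (b, c)" "\<And>x. b x \<le> m x" "\<And>x. c x \<le> m x - b x" by (auto simp: le_fun_def)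
      show "(case case y of (b, c) \<Rightarrow> (b + c, b) of (a, b) \<Rightarrow> (b, a - b)) = y"
        using bc(1) by (auto simp: fun_eq_iff)
      have "b x + c x \<le> m x" for x using bc(2)[of x] bc(3)[of x] by linarith
      then show "(case y of (b, c) \<Rightarrow> (b + c, b)) \<in> Sigma (?D m) ?D"
        using bc(1) by (auto simp: le_fun_def)
    qed
    also have "\<dots> = (\<Sum>b\<in>?D m. \<Sum>c\<in>?D (m - b).
        mono_sign par b (m - b) * mono_sign par c (m - b - c) * f b * g c * h (m - b - c))"
      using finite_le_mono[OF True] finite_le_mono[OF valid_mono_diff[OF True]] by (subst sum.Sigma) auto
    also have "\<dots> = smult par f (smult par g h) m"
      unfolding smult_def using True valid_mono_diff[OF True]
      by (auto intro!: sum.cong simp: sum_distrib_left sum_distrib_right algebra_simps)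
    finally show ?thesis .
  qed (simp add: smult_def)
qed

lemma smult_add_left: "smult par (f + g) h = smult par f h + smult par g h"
  and smult_add_right: "smult par h (f + g) = smult par h f + smult par h g"
  by (auto simp: fun_eq_iff smult_def algebra_simps sum.distrib)

lemma smult_scl_left [simp]: "smult par (scl c f) h = scl c (smult par f h)"
  and smult_scl_right [simp]: "smult par h (scl c f) = scl c (smult par h f)"
  by (auto simp: fun_eq_iff smult_def sum_distrib_left algebra_simps intro!: sum.cong)

lemma smult_zero_left [simp]: "smult par 0 h = 0"
  and smult_zero_right [simp]: "smult par h 0 = 0"
  by (auto simp: fun_eq_iff smult_def)

lemma smult_sum_left: "smult par (\<Sum>i\<in>A. f i) h = (\<Sum>i\<in>A. smult par (f i) h)"
  by (induction A rule: infinite_finite_induct) (simp_all add: smult_add_left del: plus_fun_apply zero_fun_apply)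

lemma smult_sum_right: "smult par h (\<Sum>i\<in>A. f i) = (\<Sum>i\<in>A. smult par h (f i))"
  by (induction A rule: infinite_finite_induct) (simp_all add: smult_add_right del: plus_fun_apply zero_fun_apply)

definition mon :: "'v mono \<Rightarrow> 'v spoly" where
  "mon m = (\<lambda>x. if x = m then 1 else 0)"

lemma sone_mon: "sone = mon (\<lambda>_. 0)" and svar_mon: "svar v = mon (\<lambda>u. if u = v then 1 else 0)"
  by (auto simp: sone_def svar_def mon_def)

lemma smult_mon:
  "smult par (mon a) (mon b) = (if valid_mono par (a + b) then scl (mono_sign par a b) (mon (a + b)) else 0)"
proof
  fix m
  have "(\<Sum>m1\<in>{m1. m1 \<le> m}. mono_sign par m1 (m - m1) * mon a m1 * mon b (m - m1))
      = (if m = a + b then mono_sign par a b else 0)" if v: "valid_mono par m"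
  proof -
    have eq: "(a \<le> m \<and> m - a = b) = (m = a + b)"
      by (auto simp: fun_eq_iff le_fun_def) (metis le_add_diff_inverse)
    have "(\<Sum>m1\<in>{m1. m1 \<le> m}. mono_sign par m1 (m - m1) * mon a m1 * mon b (m - m1))
       = (\<Sum>m1\<in>{m1. m1 \<le> m}. if m1 = a then (if m - a = b then mono_sign par a b else 0) else 0)"
      by (rule sum.cong) (auto simp: mon_def)
    also have "\<dots> = (if m = a + b then mono_sign par a b else 0)"
      using finite_le_mono[OF v] eq by (subst sum.delta) auto
    finally show ?thesis .
  qed
  then show "smult par (mon a) (mon b) m
    = (if valid_mono par (a + b) then scl (mono_sign par a b) (mon (a + b)) else 0) m"
    by (auto simp: smult_def mon_def)
qed

text \<open>\<open>smult\<close> discards coefficients at invalid monomials, so \<open>sone\<close>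
  is neutral only on functions that vanish there.\<close>

definition reduced :: "('v \<Rightarrow> bool) \<Rightarrow> 'v spoly \<Rightarrow> bool" where
  "reduced par f \<longleftrightarrow> (\<forall>m. \<not> valid_mono par m \<longrightarrow> f m = 0)"

lemma reduced_smult: "reduced par (smult par f g)"
  by (auto simp: reduced_def smult_def)

lemma reduced_sone: "reduced par sone"
  by (auto simp: reduced_def sone_def valid_mono_def)

lemma mono_sign_zero [simp]: "mono_sign par (\<lambda>_. 0) b = 1" "mono_sign par b (\<lambda>_. 0) = 1"
  by (auto simp: mono_sign_def)

lemma smult_sone_left: assumes "reduced par f" shows "smult par sone f = f"
proof
  fix m
  have "(\<Sum>m1\<in>{m1. m1 \<le> m}. mono_sign par m1 (m - m1) * sone m1 * f (m - m1)) = f m" if v: "valid_mono par m"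
  proof -
    have [simp]: "m - (\<lambda>_. 0) = m" "(\<lambda>_. 0) \<le> m" by (auto simp: fun_eq_iff le_fun_def)
    have "(\<Sum>m1\<in>{m1. m1 \<le> m}. mono_sign par m1 (m - m1) * sone m1 * f (m - m1))
       = (\<Sum>m1\<in>{m1. m1 \<le> m}. if m1 = (\<lambda>_. 0) then f m else 0)"
      by (rule sum.cong) (auto simp: sone_def)
    then show ?thesis using finite_le_mono[OF v] by (simp add: sum.delta)
  qed
  then show "smult par sone f m = f m" using assms by (auto simp: smult_def reduced_def)
qed

definition ssign :: "('v \<Rightarrow> bool) \<Rightarrow> 'v \<Rightarrow> 'v \<Rightarrow> complex" where
  "ssign par a b = (if par a \<and> par b then - 1 else 1)"

lemma svar_swap: "smult par (svar a) (svar b) = scl (ssign par a b) (smult par (svar b) (svar a))"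
proof -
  let ?e = "\<lambda>v u. if u = v then 1 else (0::nat)"
  have c: "?e a + ?e b = ?e b + ?e a" by (auto simp: fun_eq_iff)
  show ?thesis
  proof (cases "a = b")
    case True
    \<comment> \<open>The square of an odd generator is an invalid monomial, so both sides vanish
      and the sign is harmless.\<close>
    have "\<not> valid_mono par (?e b + ?e b)" if "par b"
      using that by (auto simp: valid_mono_def intro!: exI[of _ b])
    then show ?thesis using True by (auto simp: svar_mon smult_mon ssign_def)
  next
    case False
    have S: "{(x, y). par x \<and> par y \<and> ?e a x \<noteq> 0 \<and> ?e b y \<noteq> 0 \<and> y < x}
        = (if par a \<and> par b \<and> b < a then {(a, b)} else {})" for a b by auto
    have "mono_sign par (?e a) (?e b) = ssign par a b * mono_sign par (?e b) (?e a)"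
      unfolding mono_sign_def S using False by (auto simp: ssign_def)
    then show ?thesis unfolding svar_mon smult_mon c by auto
  qed
qed

subsection \<open>Words\<close>

definition iprod :: "('w::linorder \<Rightarrow> bool) \<Rightarrow> ('v \<Rightarrow> 'w spoly) \<Rightarrow> 'v list \<Rightarrow> 'w spoly" where
  "iprod par img w = foldr (\<lambda>v acc. smult par (img v) acc) w sone"

abbreviation wprod :: "('v::linorder \<Rightarrow> bool) \<Rightarrow> 'v list \<Rightarrow> 'v spoly" where
  "wprod par \<equiv> iprod par svar"

lemma iprod_Nil [simp]: "iprod par img [] = sone"
  and iprod_Cons [simp]: "iprod par img (a # w) = smult par (img a) (iprod par img w)"
  by (simp_all add: iprod_def)

lemma reduced_iprod: "reduced par (iprod par img w)"
  by (cases w) (auto simp: reduced_smult reduced_sone)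

lemma iprod_append: "iprod par img (u @ v) = smult par (iprod par img u) (iprod par img v)"
  by (induction u) (auto simp: smult_sone_left reduced_iprod smult_assoc)

fun inversions :: "'v::linorder list \<Rightarrow> nat" where
  "inversions [] = 0"
| "inversions (a # w) = length (filter (\<lambda>b. b < a) w) + inversions w"

lemma inversions_swap: "b < a \<Longrightarrow> inversions (u @ b # a # v) < inversions (u @ a # b # v)"
  by (induction u) auto

lemma ex_descent: "\<not> sorted w \<Longrightarrow> \<exists>u a b v. w = u @ a # b # v \<and> (b::'v::linorder) < a"
proof (induction w rule: induct_list012)
  case (3 x y zs)
  show ?case
  proof (cases "x \<le> y")
    case True
    then have "\<not> sorted (y # zs)" using 3(3) by (auto intro: order_trans)
    then obtain u a b v where "y # zs = u @ a # b # v" "b < a" using 3(2) by blast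
    then have "x # y # zs = (x # u) @ a # b # v" by simp
    then show ?thesis using \<open>b < a\<close> by blast
  next
    case False
    then have "x # y # zs = [] @ x # y # zs \<and> y < x" by simp
    then show ?thesis by blast
  qed
qed auto

text \<open>Induction along bubble sort, with the number of inversions as measure. It carries facts
  from sorted words, which stand for monomials, to arbitrary words.\<close>

lemma bubble_induct:
  assumes "\<And>w. sorted w \<Longrightarrow> P w"
    and "\<And>u a b v. b < a \<Longrightarrow> P (u @ b # a # v) \<Longrightarrow> P (u @ a # b # v)"
  shows "P (w :: 'v::linorder list)"
proof (induction w rule: measure_induct_rule[of inversions])
  case (less w)
  show ?case
  proof (cases "sorted w")
    case False
    then obtain u a b v where "w = u @ a # b # v" "b < a" using ex_descent by blast
    then show ?thesis using assms(2) less inversions_swap by metis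
  qed (use assms(1) in auto)
qed

section \<open>Linear maps on polynomials from functions on words\<close>

definition sword :: "('v::linorder) mono \<Rightarrow> 'v list" where
  "sword m = concat (map (\<lambda>v. replicate (m v) v) (sorted_list_of_set {v. m v \<noteq> 0}))"

text \<open>Only the values of \<open>F\<close> on sorted words enter here; \<open>lin_wprod\<close>
  tells when the other values are consistent with them.\<close>

definition lin :: "('v::linorder list \<Rightarrow> 'a \<Rightarrow> complex) \<Rightarrow> 'v spoly \<Rightarrow> 'a \<Rightarrow> complex" where
  "lin F f = (\<Sum>m\<in>{m. f m \<noteq> 0}. scl (f m) (F (sword m)))"

lemma lin_superset:
  assumes "finite S" "{m. f m \<noteq> 0} \<subseteq> S"
  shows "lin F f = (\<Sum>m\<in>S. scl (f m) (F (sword m)))"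
  unfolding lin_def using assms by (intro sum.mono_neutral_left) auto

lemma lin_add:
  assumes "finite {m. f m \<noteq> 0}" "finite {m. g m \<noteq> 0}"
  shows "lin F (f + g) = lin F f + lin F g"
proof -
  let ?S = "{m. f m \<noteq> 0} \<union> {m. g m \<noteq> 0}"
  have "finite ?S" using assms by auto
  then show ?thesis
    by (subst (1 2 3) lin_superset[where S = ?S])
      (auto simp: sum.distrib[symmetric] fun_eq_iff sum_fun_apply algebra_simps)
qed

lemma lin_scl:
  assumes "finite {m. f m \<noteq> 0}"
  shows "lin F (scl c f) = scl c (lin F f)"
  using assms by (subst (1 2) lin_superset[where S = "{m. f m \<noteq> 0}"])
      (auto simp: fun_eq_iff sum_fun_apply algebra_simps sum_distrib_left)

lemma lin_zero [simp]: "lin F 0 = 0"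
  by (simp add: lin_def)

definition fsupp :: "('a \<Rightarrow> complex) \<Rightarrow> bool" where "fsupp f \<longleftrightarrow> finite {m. f m \<noteq> 0}"

lemma fsupp_add: "fsupp f \<Longrightarrow> fsupp g \<Longrightarrow> fsupp (f + g)"
  unfolding fsupp_def by (rule finite_subset[of _ "{m. f m \<noteq> 0} \<union> {m. g m \<noteq> 0}"]) auto

lemma fsupp_scl: "fsupp f \<Longrightarrow> fsupp (scl c f)"
  unfolding fsupp_def by (rule finite_subset[of _ "{m. f m \<noteq> 0}"]) auto

lemma fsupp_zero [simp]: "fsupp 0" by (simp add: fsupp_def)

lemma fsupp_sum: "(\<And>i. i \<in> A \<Longrightarrow> fsupp (f i)) \<Longrightarrow> fsupp (\<Sum>i\<in>A. f i)"
  by (induction A rule: infinite_finite_induct) (auto simp: fsupp_add)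

lemma lin_sum: "(\<And>i. i \<in> A \<Longrightarrow> fsupp (f i)) \<Longrightarrow> lin F (\<Sum>i\<in>A. f i) = (\<Sum>i\<in>A. lin F (f i))"
proof (induction A rule: infinite_finite_induct)
  case (insert x A)
  then have "fsupp (f x)" "fsupp (\<Sum>i\<in>A. f i)" by (auto simp: fsupp_sum)
  then show ?case using insert by (simp add: lin_add fsupp_def del: plus_fun_apply)
qed auto

lemma fsupp_mon: "fsupp (mon m)"
  by (simp add: fsupp_def mon_def)

lemma fsupp_expand: "fsupp f \<Longrightarrow> f = (\<Sum>m\<in>{m. f m \<noteq> 0}. scl (f m) (mon m))"
  unfolding fsupp_def by (rule ext) (simp add: sum_fun_apply mon_def if_distrib[of "(*) _"] sum.delta cong: if_cong)

lemma fsupp_smult: assumes "fsupp f" "fsupp g" shows "fsupp (smult par f g)"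
proof -
  have "smult par f g = (\<Sum>a\<in>{m. f m \<noteq> 0}. \<Sum>b\<in>{m. g m \<noteq> 0}. scl (f a * g b) (smult par (mon a) (mon b)))"
  proof -
    have "smult par f g = smult par (\<Sum>m\<in>{m. f m \<noteq> 0}. scl (f m) (mon m)) (\<Sum>m\<in>{m. g m \<noteq> 0}. scl (g m) (mon m))"
      by (rule arg_cong2[OF fsupp_expand[OF assms(1)] fsupp_expand[OF assms(2)]])
    then show ?thesis unfolding smult_sum_left unfolding smult_sum_right by (simp add: mult.commute)
  qed
  then show ?thesis by (simp only:) (intro fsupp_sum fsupp_scl, auto simp: smult_mon fsupp_scl fsupp_mon)
qed

lemma spolys_iff: "f \<in> spolys par \<longleftrightarrow> fsupp f \<and> reduced par f"
  by (auto simp: spolys_def fsupp_def reduced_def)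

lemma fsupp_iprod: "(\<And>v. fsupp (img v)) \<Longrightarrow> fsupp (iprod par img w)"
  by (induction w) (auto simp: fsupp_smult sone_mon fsupp_mon)

lemma fsupp_wprod: "fsupp (wprod par w)"
  by (rule fsupp_iprod) (simp add: svar_mon fsupp_mon)

lemma count_list_sword: "finite {v. m v \<noteq> 0} \<Longrightarrow> count_list (sword m) v = m v"
proof -
  assume "finite {v. m v \<noteq> 0}"
  have *: "distinct l \<Longrightarrow> count_list (concat (map (\<lambda>v. replicate (m v) v) l)) v = (if v \<in> set l then m v else 0)" for l
  proof (induction l)
    case (Cons a l)
    have "count_list (replicate k a) v = (if a = v then k else 0)" for k by (induction k) auto
    then show ?case using Cons by auto
  qed simp
  show ?thesis unfolding sword_def using \<open>finite _\<close> by (subst *) auto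
qed

lemma sorted_sword: "sorted (sword m)"
proof -
  have *: "sorted l \<Longrightarrow> sorted (concat (map (\<lambda>v. replicate (m v) v) l))" for l
    by (induction l) (auto simp: sorted_append)
  show ?thesis unfolding sword_def by (rule *) simp
qed

lemma sword_count: assumes "sorted w" shows "sword (count_list w) = w"
proof -
  have f: "finite {v. count_list w v \<noteq> 0}"
    by (rule finite_subset[of _ "set w"]) (auto simp: count_list_0_iff)
  have "mset (sword (count_list w)) = mset w"
    by (rule multiset_eqI) (simp add: count_mset count_list_sword[OF f])
  then show ?thesis using assms sorted_sword
    by (metis properties_for_sort)
qed

lemma sword_inj: "finite {v. m v \<noteq> 0} \<Longrightarrow> count_list (sword m) = m"
  by (auto simp: count_list_sword)

lemma wprod_sorted:
  assumes "sorted w"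
  shows "wprod par w = (if valid_mono par (count_list w) then mon (count_list w) else 0)"
  using assms
proof (induction w)
  case Nil
  have "count_list [] = (\<lambda>_::'a. 0)" by (auto simp: fun_eq_iff)
  then show ?case by (simp add: sone_mon valid_mono_def)
next
  case (Cons a w)
  let ?e = "\<lambda>u. if u = a then 1 else (0::nat)"
  have c: "count_list (a # w) = ?e + count_list w" by (auto simp: fun_eq_iff)
  have v: "valid_mono par (count_list w)" if "valid_mono par (count_list (a # w))"
    using valid_mono_le[OF that] by (auto simp: le_fun_def)
  have "{(x, y). par x \<and> par y \<and> ?e x \<noteq> 0 \<and> count_list w y \<noteq> 0 \<and> y < x} = {}"
    using Cons.prems by (auto simp: count_list_0_iff)
  then have ms: "mono_sign par ?e (count_list w) = 1"
    by (simp only: mono_sign_def card.empty power_0)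
  have IH: "wprod par w = (if valid_mono par (count_list w) then mon (count_list w) else 0)"
    using Cons by simp
  show ?case
  proof (cases "valid_mono par (count_list w)")
    case True
    then have "wprod par (a # w) = smult par (mon ?e) (mon (count_list w))" using IH by (simp add: svar_mon)
    also have "\<dots> = (if valid_mono par (count_list (a # w)) then mon (count_list (a # w)) else 0)"
      unfolding smult_mon c[symmetric] ms scl_one ..
    finally show ?thesis .
  next
    case False
    then show ?thesis using IH v by (auto simp del: zero_fun_apply count_list.simps)
  qed
qed

lemma iprod_swap:
  assumes "smult par (img a) (img b) = scl s (smult par (img b) (img a))"
  shows "iprod par img (u @ a # b # v) = scl s (iprod par img (u @ b # a # v))"
proof -
  have "smult par (img a) (smult par (img b) (iprod par img v)) = scl s (smult par (img b) (smult par (img a) (iprod par img v)))"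
    by (metis assms smult_assoc smult_scl_left)
  then show ?thesis by (simp add: iprod_append)
qed

text \<open>The universal property of the free supercommutative algebra, phrased for functions on
  words. The case \<open>b = a\<close> of the hypothesis makes \<open>F\<close> vanish on words with
  a repeated odd letter, as it must. The set \<open>W\<close> confines the exchange rule to the
  words that sorting reaches; for matrix coefficients it consists of the words in which the letters
  of \<open>U\<close> precede those of \<open>W\<close>.\<close>

theorem lin_wprod:
  assumes "w \<in> W"
    and "\<And>u a b v. u @ a # b # v \<in> W \<Longrightarrow> b \<le> a \<Longrightarrow> u @ b # a # v \<in> W \<and>
           F (u @ a # b # v) = scl (ssign par a b) (F (u @ b # a # v))"
  shows "lin F (wprod par w) = F w"
  using assms(1)
proof (induction w rule: bubble_induct)
  case (1 w)
  show ?case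
  proof (cases "valid_mono par (count_list w)")
    case True
    have "{m. mon (count_list w) m \<noteq> 0} = {count_list w}" by (auto simp: mon_def)
    then show ?thesis using True 1 by (simp add: wprod_sorted lin_def sword_count) (simp add: mon_def)
  next
    case False
    have "finite {v. count_list w v \<noteq> 0}"
      by (rule finite_subset[of _ "set w"]) (auto simp: count_list_0_iff)
    then obtain a where a: "par a" "count_list w a \<ge> 2" using False by (auto simp: valid_mono_def not_le)
    \<comment> \<open>In a sorted word equal letters are adjacent.\<close>
    have "\<exists>u v. w = u @ a # a # v" using 1(1) a(2)
    proof (induction w)
      case (Cons b w)
      show ?case
      proof (cases "count_list w a \<ge> 2")
        case True
        then obtain u v where "w = u @ a # a # v" using Cons by auto
        then show ?thesis by (metis append_Cons)
      next
        case False
        then have ba: "b = a" "count_list w a \<ge> 1" using Cons.prems by (auto split: if_splits)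
        then have "a \<in> set w" by (metis count_notin not_one_le_zero)
        then obtain c w' where w: "w = c # w'" by (cases w) auto
        then have "c = a" using Cons.prems(1) ba \<open>a \<in> set w\<close> by auto
        then show ?thesis using w ba by (metis append_Nil)
      qed
    qed simp
    then obtain u v where w: "w = u @ a # a # v" by blast
    then have "F w = scl (- 1) (F w)" using assms(2)[of u a a v] 1(2) a(1) by (simp add: ssign_def)
    then have "F w = 0" by (auto simp: fun_eq_iff)
    then show ?thesis using False 1(1) by (simp add: wprod_sorted del: zero_fun_apply)
  qed
next
  case (2 u a b v)
  have "wprod par (u @ a # b # v) = scl (ssign par a b) (wprod par (u @ b # a # v))"
    by (rule iprod_swap[OF svar_swap])
  then have "lin F (wprod par (u @ a # b # v)) = scl (ssign par a b) (lin F (wprod par (u @ b # a # v)))"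
    using lin_scl fsupp_wprod[of par "u @ b # a # v"] by (simp add: fsupp_def)
  then show ?case using 2 assms(2)[of u a b v] by simp
qed

lemma valid_wprod_sword: "valid_mono par m \<Longrightarrow> wprod par (sword m) = mon m"
  by (simp add: wprod_sorted sorted_sword sword_inj valid_mono_def)

lemma spolys_expand:
  "f \<in> spolys par \<Longrightarrow> f = (\<Sum>m\<in>{m. f m \<noteq> 0}. scl (f m) (wprod par (sword m)))"
proof -
  assume f: "f \<in> spolys par"
  then have "f = (\<Sum>m\<in>{m. f m \<noteq> 0}. scl (f m) (mon m))" by (intro fsupp_expand) (simp add: spolys_iff)
  also have "\<dots> = (\<Sum>m\<in>{m. f m \<noteq> 0}. scl (f m) (wprod par (sword m)))"
    using f by (intro sum.cong refl) (metis (mono_tags, lifting) mem_Collect_eq spolys_iff reduced_def valid_wprod_sword)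
  finally show ?thesis .
qed

lemma mono_eval_iprod: "mono_eval par img m = iprod par img (sword m)"
proof -
  have p: "smult par (spow par f k) g = (smult par f ^^ k) g" if "reduced par g" for f g k
    using that by (induction k) (auto simp: spow_def smult_sone_left smult_assoc)
  have q: "(smult par (img a) ^^ k) (iprod par img w) = iprod par img (replicate k a @ w)" for a k w
    by (induction k) auto
  have "foldr (\<lambda>v acc. smult par (spow par (img v) (m v)) acc) l sone
      = iprod par img (concat (map (\<lambda>v. replicate (m v) v) l))" for l
    by (induction l) (auto simp: p q reduced_iprod)
  then show ?thesis by (simp add: mono_eval_def sword_def)
qed

lemma seval_lin: "seval par img f = lin (iprod par img) f"
  by (auto simp: seval_def lin_def fun_eq_iff sum_fun_apply mono_eval_iprod)

lemma seval_wprod: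
  assumes "\<And>a b. smult parw (img a) (img b) = scl (ssign par a b) (smult parw (img b) (img a))"
  shows "seval parw img (wprod par w) = iprod parw img w"
  unfolding seval_lin by (rule lin_wprod[where W = UNIV]) (auto intro: iprod_swap assms)

lemma seval_smult:
  assumes "\<And>a b. smult parw (img a) (img b) = scl (ssign par a b) (smult parw (img b) (img a))"
    and f: "f \<in> spolys par" and g: "g \<in> spolys par"
  shows "seval parw img (smult par f g) = smult parw (seval parw img f) (seval parw img g)"
proof -
  let ?A = "{m. f m \<noteq> 0}" and ?B = "{m. g m \<noteq> 0}" and ?L = "lin (iprod parw img)"
  have L: "?L (wprod par w) = iprod parw img w" for w
    using seval_wprod[OF assms(1)] by (simp add: seval_lin)
  have "smult par f g = (\<Sum>a\<in>?A. \<Sum>b\<in>?B. scl (f a * g b) (wprod par (sword a @ sword b)))"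
  proof -
    have "smult par f g = smult par (\<Sum>m\<in>?A. scl (f m) (wprod par (sword m))) (\<Sum>m\<in>?B. scl (g m) (wprod par (sword m)))"
      by (rule arg_cong2[OF spolys_expand[OF f] spolys_expand[OF g]])
    then show ?thesis unfolding smult_sum_left unfolding smult_sum_right by (simp add: iprod_append mult.commute)
  qed
  then have "?L (smult par f g) = (\<Sum>a\<in>?A. \<Sum>b\<in>?B. scl (f a * g b) (iprod parw img (sword a @ sword b)))"
    using fsupp_wprod[of par, unfolded fsupp_def]
    by (simp add: lin_sum fsupp_sum fsupp_scl fsupp_wprod lin_scl L)
  also have "\<dots> = smult parw (?L f) (?L g)"
    unfolding lin_def smult_sum_left unfolding smult_sum_right by (simp add: iprod_append mult.commute)
  finally show ?thesis by (simp add: seval_lin)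
qed

subsection \<open>Koszul signs\<close>

definition ss :: "bool \<Rightarrow> bool \<Rightarrow> complex" where "ss a b = (if a \<and> b then - 1 else 1)"

definition pairs :: "nat \<Rightarrow> (nat \<times> nat) set" where
  "pairs N = {(x, y). x \<in> {1..N} \<and> y \<in> {1..N} \<and> y < x}"

lemma finite_pairs [simp]: "finite (pairs N)"
  by (rule finite_subset[of _ "{1..N} \<times> {1..N}"]) (auto simp: pairs_def)

lemma minus_one_power_card:
  "finite S \<Longrightarrow> (- 1 :: complex) ^ card {x \<in> S. P x} = (\<Prod>x\<in>S. if P x then - 1 else 1)"
  by (simp add: prod.If_cases Int_def)

text \<open>The Koszul sign between \<open>a_1 b_1 ... a_N b_N\<close> and
  \<open>a_1 ... a_N b_1 ... b_N\<close>: the letter \<open>a_x\<close> passes every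
  \<open>b_y\<close> with \<open>y < x\<close>.\<close>

definition cross :: "nat \<Rightarrow> (nat \<Rightarrow> bool) \<Rightarrow> (nat \<Rightarrow> bool) \<Rightarrow> complex" where
  "cross N a b = (\<Prod>(x, y)\<in>pairs N. ss (a x) (b y))"

text \<open>Passing to the inverse turns \<open>csign\<close> into a cocycle for the left action
  \<open>act\<close>, see \<open>ks_comp\<close>.\<close>

definition ks :: "nat \<Rightarrow> (nat \<Rightarrow> nat) \<Rightarrow> (nat \<Rightarrow> ix) \<Rightarrow> complex" where
  "ks N g I = csign N I (inv g)"

lemma csign_prod:
  "csign N I s = (\<Prod>(x, y)\<in>pairs N. if s x < s y \<and> par_ix (I (s x)) \<and> par_ix (I (s y)) then - 1 else 1)"
proof -
  have "{(x, y). x \<in> {1..N} \<and> y \<in> {1..N} \<and> x < y \<and> s y < s x \<and> par_ix (I (s x)) \<and> par_ix (I (s y))}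
    = prod.swap ` {p \<in> pairs N. case p of (x, y) \<Rightarrow> s x < s y \<and> par_ix (I (s x)) \<and> par_ix (I (s y))}"
    by (auto simp: pairs_def image_iff)
  then show ?thesis unfolding csign_def
    by (simp add: card_image minus_one_power_card) (simp add: case_prod_unfold)
qed

text \<open>A permutation of positions permutes unordered pairs; \<open>max\<close> and
  \<open>min\<close> select the representative lying in \<open>pairs N\<close>.\<close>

lemma pairs_reindex:
  assumes t: "t permutes {1..N}" and sym: "\<And>x y. g x y = g y x"
  shows "(\<Prod>(x, y)\<in>pairs N. g (t x) (t y)) = (\<Prod>(x, y)\<in>pairs N. g x y)"
proof (rule prod.reindex_bij_witness[where
      j = "\<lambda>(x, y). (max (t x) (t y), min (t x) (t y))" and
      i = "\<lambda>(x, y). (max (inv t x) (inv t y), min (inv t x) (inv t y))"])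
  have inj: "t x = t y \<longleftrightarrow> x = y" "inv t x = inv t y \<longleftrightarrow> x = y" for x y
    using permutes_inj[OF t] permutes_inj[OF permutes_inv[OF t]] by (auto simp: inj_eq)
  have iv: "inv t (t x) = x" "t (inv t x) = x" for x using permutes_inverses[OF t] by auto
  have im: "t x \<in> {1..N} \<longleftrightarrow> x \<in> {1..N}" "inv t x \<in> {1..N} \<longleftrightarrow> x \<in> {1..N}" for x
    using permutes_in_image[OF t] permutes_in_image[OF permutes_inv[OF t]] by auto
  fix p assume "p \<in> pairs N"
  then obtain x y where p: "p = (x, y)" "x \<in> {1..N}" "y \<in> {1..N}" "y < x" by (auto simp: pairs_def)
  have tn: "t x \<noteq> t y" "inv t x \<noteq> inv t y" using inj p(4) by auto
  show "(case case p of (x, y) \<Rightarrow> (max (t x) (t y), min (t x) (t y)) of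
           (x, y) \<Rightarrow> (max (inv t x) (inv t y), min (inv t x) (inv t y))) = p"
    using p iv by (cases "t x < t y") (auto simp: max_def min_def)
  show "(case case p of (x, y) \<Rightarrow> (max (inv t x) (inv t y), min (inv t x) (inv t y)) of
           (x, y) \<Rightarrow> (max (t x) (t y), min (t x) (t y))) = p"
    using p iv by (cases "inv t x < inv t y") (auto simp: max_def min_def)
  show "(case p of (x, y) \<Rightarrow> (max (t x) (t y), min (t x) (t y))) \<in> pairs N"
    using im(1)[of x] im(1)[of y] p tn by (auto simp: pairs_def max_def min_def)
  show "(case p of (x, y) \<Rightarrow> (max (inv t x) (inv t y), min (inv t x) (inv t y))) \<in> pairs N"
    using im(2)[of x] im(2)[of y] p tn by (auto simp: pairs_def max_def min_def)
  show "(case case p of (x, y) \<Rightarrow> (max (t x) (t y), min (t x) (t y)) of (x, y) \<Rightarrow> g x y)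
      = (case p of (x, y) \<Rightarrow> g (t x) (t y))"
    using p sym by (auto simp: max_def min_def)
qed

text \<open>A pair of odd letters is inverted by \<open>s \<circ> t\<close> iff exactly one of the
  two steps inverts it. The auxiliary \<open>g\<close> is the inversion sign of \<open>s\<close> on
  an unordered pair, so \<open>pairs_reindex\<close> allows it to be evaluated at the images under
  \<open>t\<close>.\<close>

lemma csign_comp:
  assumes s: "s permutes {1..N}" and t: "t permutes {1..N}"
  shows "csign N I (s \<circ> t) = csign N I s * csign N (I \<circ> s) t"
proof -
  define g :: "nat \<Rightarrow> nat \<Rightarrow> complex" where
    "g x y = (if (x < y \<longleftrightarrow> s x < s y) \<or> \<not> (par_ix (I (s x)) \<and> par_ix (I (s y))) then 1 else - 1)" for x y
  have inj: "s x = s y \<longleftrightarrow> x = y" "t x = t y \<longleftrightarrow> x = y" for x y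
    using permutes_inj[OF s] permutes_inj[OF t] by (auto simp: inj_eq)
  have sym: "g x y = g y x" for x y
  proof (cases x y rule: linorder_cases)
    case less then show ?thesis using inj(1)[of x y] by (auto simp: g_def)
  next
    case greater then show ?thesis using inj(1)[of x y] by (auto simp: g_def)
  qed simp
  have "csign N I s = (\<Prod>(x, y)\<in>pairs N. g x y)" unfolding csign_prod
    by (rule prod.cong) (auto simp: g_def pairs_def)
  also have "\<dots> = (\<Prod>(x, y)\<in>pairs N. g (t x) (t y))"
    by (rule pairs_reindex[OF t sym, symmetric])
  finally have "csign N I s * csign N (I \<circ> s) t = (\<Prod>p\<in>pairs N. (case p of (x, y) \<Rightarrow> g (t x) (t y)) *
     (case p of (x, y) \<Rightarrow> if t x < t y \<and> par_ix ((I \<circ> s) (t x)) \<and> par_ix ((I \<circ> s) (t y)) then - 1 else 1))"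
    by (simp add: csign_prod prod.distrib)
  also have "\<dots> = csign N I (s \<circ> t)" unfolding csign_prod
  proof (rule prod.cong[OF refl])
    fix p assume "p \<in> pairs N"
    then obtain x y where p: "p = (x, y)" "y < x" by (auto simp: pairs_def)
    then have "t x \<noteq> t y" "s (t x) \<noteq> s (t y)" using inj by auto
    then show "(case p of (x, y) \<Rightarrow> g (t x) (t y)) *
     (case p of (x, y) \<Rightarrow> if t x < t y \<and> par_ix ((I \<circ> s) (t x)) \<and> par_ix ((I \<circ> s) (t y)) then - 1 else 1) =
      (case p of (x, y) \<Rightarrow> if (s \<circ> t) x < (s \<circ> t) y \<and> par_ix (I ((s \<circ> t) x)) \<and> par_ix (I ((s \<circ> t) y)) then - 1 else 1)"
      using p by (auto simp: g_def)
  qed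
  finally show ?thesis ..
qed

lemma act_comp: "s permutes S \<Longrightarrow> t permutes S \<Longrightarrow> act (s \<circ> t) I = act s (act t I)"
  by (simp add: act_def o_inv_distrib permutes_bij comp_assoc)

lemma act_id [simp]: "act id I = I"
  by (simp add: act_def)

lemma ks_comp:
  assumes "s permutes {1..N}" "t permutes {1..N}"
  shows "ks N (s \<circ> t) I = ks N s (act t I) * ks N t I"
  using csign_comp[OF permutes_inv[OF assms(2)] permutes_inv[OF assms(1)], of I] assms
  by (simp add: ks_def act_def o_inv_distrib permutes_bij)

lemma ks_sq [simp]: "ks N s I * ks N s I = 1"
  by (simp add: ks_def csign_def power_mult_distrib[symmetric])

lemma ks_sq_left [simp]: "ks N s I * (ks N s I * z) = z"
  by (simp add: mult.assoc[symmetric])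

lemma ks_cases: "ks N s I = 1 \<or> ks N s I = - 1"
  by (simp add: ks_def csign_def minus_one_power_iff)

lemma ks_id [simp]: "ks N id I = 1"
  unfolding ks_def csign_prod by (simp, rule prod.neutral) (auto simp: pairs_def)

lemma ks_inv: assumes "s permutes {1..N}" shows "ks N (inv s) (act s I) = ks N s I"
proof -
  have "ks N (inv s) (act s I) * ks N s I = 1"
    using ks_comp[OF permutes_inv[OF assms] assms, of I] permutes_inv_o[OF assms] by simp
  then show ?thesis using ks_cases[of N s I] ks_cases[of N "inv s" "act s I"] by auto
qed

text \<open>An odd letter strictly between \<open>a\<close> and \<open>b\<close> is inverted with
  both of them and contributes an even count; only the pair of exchanged letters remains.\<close>

lemma ks_transpose_eq:
  assumes ab: "a \<in> {1..N}" "b \<in> {1..N}" "a \<noteq> b" and par: "par_ix (I a) = par_ix (I b)"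
  shows "ks N (transpose a b) I = (if par_ix (I a) then - 1 else 1)"
proof -
  have main: "ks N (transpose a b) I = (if par_ix (I a) then - 1 else 1)"
    if ab: "a \<in> {1..N}" "b \<in> {1..N}" "a < b" and par: "par_ix (I a) = par_ix (I b)" for a b
  proof -
    let ?t = "transpose a b"
    let ?S = "{(x, y). x \<in> {1..N} \<and> y \<in> {1..N} \<and> x < y \<and> ?t y < ?t x \<and> par_ix (I (?t x)) \<and> par_ix (I (?t y))}"
    let ?M = "{x. a < x \<and> x < b \<and> par_ix (I x)}"
    have "?S = (if par_ix (I a) then insert (a, b) ({a} \<times> ?M \<union> ?M \<times> {b}) else {})"
      (is "_ = ?R")
    proof -
      have "(x, y) \<in> ?S \<longleftrightarrow> (x, y) \<in> ?R" for x y
        using ab par by (cases "x = a"; cases "x = b"; cases "y = a"; cases "y = b") auto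
      then show ?thesis by auto
    qed
    moreover have "card (insert (a, b) ({a} \<times> ?M \<union> ?M \<times> {b})) = Suc (2 * card ?M)"
    proof -
      have "finite ?M" by (rule finite_subset[of _ "{..b}"]) auto
      then show ?thesis
      proof -
        assume f: "finite ?M"
        have "card ({a} \<times> ?M \<union> ?M \<times> {b}) = card ({a} \<times> ?M) + card (?M \<times> {b})"
          using f by (intro card_Un_disjoint) auto
        moreover have "(a, b) \<notin> {a} \<times> ?M \<union> ?M \<times> {b}" by auto
        ultimately show ?thesis using f by (simp add: card_cartesian_product)
      qed
    qed
    ultimately show ?thesis unfolding ks_def csign_def by (simp split: if_splits)
  qed
  show ?thesis
  proof (cases "a < b")
    case False
    then have "b < a" using ab by auto
    then show ?thesis using main[of b a] ab par by (simp add: transpose_commute)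
  qed (use main ab par in auto)
qed

text \<open>Only the pair \<open>(Suc i, i)\<close> changes its order; the other factors are merely
  permuted.\<close>

lemma cross_adjacent:
  assumes i: "1 \<le> i" "i < N"
  shows "cross N (a \<circ> transpose i (Suc i)) (b \<circ> transpose i (Suc i))
       = cross N a b * ss (a (Suc i)) (b i) * ss (a i) (b (Suc i))"
proof -
  let ?t = "transpose i (Suc i)"
  let ?P = "pairs N - {(Suc i, i)}"
  have m: "(Suc i, i) \<in> pairs N" using i by (auto simp: pairs_def)
  have "(\<Prod>(x, y)\<in>?P. ss (a (?t x)) (b (?t y))) = (\<Prod>(x, y)\<in>?P. ss (a x) (b y))"
    by (rule prod.reindex_bij_witness[where i = "\<lambda>(x, y). (?t x, ?t y)" and j = "\<lambda>(x, y). (?t x, ?t y)"])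
      (use i in \<open>auto simp: pairs_def transpose_def split: if_splits\<close>)
  then have "cross N (a \<circ> ?t) (b \<circ> ?t) = ss (a i) (b (Suc i)) * (\<Prod>(x, y)\<in>?P. ss (a x) (b y))"
    using prod.remove[OF finite_pairs m, of "\<lambda>(x, y). ss (a (?t x)) (b (?t y))"]
    by (simp add: cross_def)
  moreover have "cross N a b = ss (a (Suc i)) (b i) * (\<Prod>(x, y)\<in>?P. ss (a x) (b y))"
    using prod.remove[OF finite_pairs m, of "\<lambda>(x, y). ss (a x) (b y)"]
    by (simp add: cross_def)
  ultimately show ?thesis by (auto simp: ss_def)
qed

lemma ks_adjacent:
  assumes i: "1 \<le> i" "i < N"
  shows "ks N (transpose i (Suc i)) I = ss (par_ix (I i)) (par_ix (I (Suc i)))"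
proof -
  let ?t = "transpose i (Suc i)"
  have "{(x, y). x \<in> {1..N} \<and> y \<in> {1..N} \<and> x < y \<and> ?t y < ?t x \<and> par_ix (I (?t x)) \<and> par_ix (I (?t y))}
    = (if par_ix (I i) \<and> par_ix (I (Suc i)) then {(i, Suc i)} else {})"
    using i by (auto simp: transpose_def split: if_splits)
  then show ?thesis by (simp add: ks_def csign_def ss_def)
qed

lemma cross_cases: "cross N a b = 1 \<or> cross N a b = - 1"
proof -
  have "(\<Prod>p\<in>A. case p of (x, y) \<Rightarrow> ss (a x) (b y)) \<in> {1, - 1}" for A
  proof (induction A rule: infinite_finite_induct)
    case (insert p A)
    have "ss (a (fst p)) (b (snd p)) \<in> {1, - 1}" by (simp add: ss_def)
    then show ?case using insert by (auto simp: case_prod_unfold)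
  qed auto
  then show ?thesis unfolding cross_def by blast
qed

lemma cross_sq [simp]: "cross N a b * cross N a b = 1"
  using cross_cases[of N a b] by auto

lemma cross_xor_left: "cross N (\<lambda>x. a x \<noteq> a' x) b = cross N a b * cross N a' b"
  and cross_xor_right: "cross N b (\<lambda>x. a x \<noteq> a' x) = cross N b a * cross N b a'"
  unfolding cross_def prod.distrib[symmetric] by (auto intro!: prod.cong simp: ss_def)

text \<open>Adjacent transpositions generate the group: a transposition of distance
  \<open>d + 1\<close> is the conjugate of one of distance \<open>d\<close> by an adjacent
  one.\<close>

lemma adjacent_induct [consumes 1, case_names id comp adj]:
  assumes s: "s permutes {1..N}"
    and id: "P id"
    and comp: "\<And>s t. s permutes {1..N} \<Longrightarrow> t permutes {1..N} \<Longrightarrow> P s \<Longrightarrow> P t \<Longrightarrow> P (s \<circ> t)"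
    and adj: "\<And>i. 1 \<le> i \<Longrightarrow> i < N \<Longrightarrow> P (transpose i (Suc i))"
  shows "P s"
proof -
  have tr: "P (transpose a (a + d))" if "1 \<le> a" "a + d \<le> N" for a d
    using that
  proof (induction d)
    case 0 then show ?case using id by (simp add: id_def)
  next
    case (Suc d)
    let ?b = "a + d"
    have "transpose a (a + Suc d) = transpose ?b (Suc ?b) \<circ> transpose a ?b \<circ> transpose ?b (Suc ?b)" if "d \<noteq> 0"
      using that by (auto simp: fun_eq_iff transpose_def)
    moreover have "transpose ?b (Suc ?b) permutes {1..N}" "transpose a ?b permutes {1..N}"
      using Suc.prems by (auto intro!: permutes_swap_id)
    moreover have "P (transpose ?b (Suc ?b))" using adj[of ?b] Suc.prems by simp
    moreover have "P (transpose a ?b)" using Suc by simp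
    ultimately show ?case by (cases "d = 0") (metis add.right_neutral add_Suc_right comp permutes_compose)+
  qed
  have tr': "P (transpose a b)" if "a \<in> {1..N}" "b \<in> {1..N}" for a b
    using tr[of a "b - a"] tr[of b "a - b"] that by (cases "a \<le> b") (auto simp: transpose_commute)
  show ?thesis
    using s finite_atLeastAtMost[of 1 N]
  proof (induction rule: permutes_induct)
    case (swap a b p)
    then show ?case using comp[OF permutes_swap_id[OF swap(1,2)]] tr' by blast
  qed (rule id)
qed

subsection \<open>The regular representation of the symmetric group\<close>

text \<open>Real scalars, because the argument in the group algebra rests on the positivity of an
  inner product. They are mapped into the complex numbers only in
  \<open>kernel_in_ideal\<close>.\<close>

definition rscl :: "real \<Rightarrow> ('a \<Rightarrow> real) \<Rightarrow> 'a \<Rightarrow> real" where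
  "rscl c f = (\<lambda>x. c * f x)"

lemma rscl_apply [simp]: "rscl c f x = c * f x"
  by (simp add: rscl_def)

lemma rscl_1 [simp]: "rscl 1 f = f" and rscl_rscl [simp]: "rscl c (rscl d f) = rscl (c * d) f"
  and rscl_0 [simp]: "rscl 0 f = 0" "rscl c 0 = 0"
  by (auto simp: fun_eq_iff)

lemma rscl_add: "rscl c (f + g) = rscl c f + rscl c g" and rscl_add_left: "rscl (c + d) f = rscl c f + rscl d f"
  by (auto simp: fun_eq_iff algebra_simps)

lemma rsum_apply: "(\<Sum>i\<in>A. f i) x = (\<Sum>i\<in>A. (f i x :: real))"
  by (induction A rule: infinite_finite_induct) auto

lemma rscl_sum: "rscl c (\<Sum>i\<in>A. f i) = (\<Sum>i\<in>A. rscl c (f i))"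
  by (auto simp: fun_eq_iff rsum_apply sum_distrib_left)

definition lact :: "(nat \<Rightarrow> nat) \<Rightarrow> ((nat \<Rightarrow> nat) \<Rightarrow> real) \<Rightarrow> (nat \<Rightarrow> nat) \<Rightarrow> real" where
  "lact s f = (\<lambda>x. f (inv s \<circ> x))"

lemma lact_comp: "bij s \<Longrightarrow> bij t \<Longrightarrow> lact (s \<circ> t) f = lact s (lact t f)"
  by (simp add: lact_def o_inv_distrib comp_assoc)

lemma lact_id [simp]: "lact id f = f" by (simp add: lact_def)

lemma lact_add: "lact s (f + g) = lact s f + lact s g"
  and lact_rscl: "lact s (rscl c f) = rscl c (lact s f)"
  and lact_0: "lact s 0 = 0"
  by (auto simp: lact_def fun_eq_iff)

lemma lact_sum: "lact s (\<Sum>i\<in>A. f i) = (\<Sum>i\<in>A. lact s (f i))"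
  by (auto simp: lact_def fun_eq_iff rsum_apply)

definition sg :: "nat \<Rightarrow> (nat \<Rightarrow> nat) set" where "sg N = {s. s permutes {1..N}}"

text \<open>Functions are defined on all of \<open>nat \<Rightarrow> nat\<close>; those supported on
  \<open>sg N\<close> form the group algebra, and on them \<open>ip\<close> is definite.\<close>

definition hsupp :: "nat \<Rightarrow> ((nat \<Rightarrow> nat) \<Rightarrow> real) \<Rightarrow> bool" where
  "hsupp N f \<longleftrightarrow> (\<forall>x. x \<notin> sg N \<longrightarrow> f x = 0)"

definition ip :: "nat \<Rightarrow> ((nat \<Rightarrow> nat) \<Rightarrow> real) \<Rightarrow> ((nat \<Rightarrow> nat) \<Rightarrow> real) \<Rightarrow> real" where
  "ip N f g = (\<Sum>x\<in>sg N. f x * g x)"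

lemma finite_sg [simp]: "finite (sg N)"
  by (simp add: sg_def finite_permutations)

lemma sg_comp: "s \<in> sg N \<Longrightarrow> t \<in> sg N \<Longrightarrow> s \<circ> t \<in> sg N"
  and sg_inv: "s \<in> sg N \<Longrightarrow> inv s \<in> sg N" and sg_id: "id \<in> sg N"
  and sg_bij: "s \<in> sg N \<Longrightarrow> bij s"
  and sg_transpose: "a \<in> {1..N} \<Longrightarrow> b \<in> {1..N} \<Longrightarrow> transpose a b \<in> sg N"
  by (auto simp: sg_def permutes_compose permutes_inv permutes_id permutes_bij permutes_swap_id)

lemma sg_inv_o: "s \<in> sg N \<Longrightarrow> inv s \<circ> s = id" "s \<in> sg N \<Longrightarrow> s \<circ> inv s = id"
  by (auto simp: sg_def permutes_inv_o)

lemma sg_cancel: "s \<in> sg N \<Longrightarrow> inv s \<circ> (s \<circ> x) = x" "s \<in> sg N \<Longrightarrow> s \<circ> (inv s \<circ> x) = x"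
  by (simp_all only: comp_assoc[symmetric] sg_inv_o id_comp)

lemma hsupp_lact: assumes "s \<in> sg N" "hsupp N f" shows "hsupp N (lact s f)"
  unfolding hsupp_def lact_def
proof (intro allI impI)
  fix x assume x: "x \<notin> sg N"
  have "inv s \<circ> x \<notin> sg N"
  proof
    assume "inv s \<circ> x \<in> sg N"
    then have "s \<circ> (inv s \<circ> x) \<in> sg N" using assms(1) sg_comp by blast
    then show False using x sg_cancel(2)[OF assms(1)] by metis
  qed
  then show "f (inv s \<circ> x) = 0" using assms(2) by (auto simp: hsupp_def)
qed

lemma hsupp_add: "hsupp N f \<Longrightarrow> hsupp N g \<Longrightarrow> hsupp N (f + g)"
  and hsupp_rscl: "hsupp N f \<Longrightarrow> hsupp N (rscl c f)"
  by (auto simp: hsupp_def)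

lemma hsupp_sum: "(\<And>i. i \<in> A \<Longrightarrow> hsupp N (f i)) \<Longrightarrow> hsupp N (\<Sum>i\<in>A. f i)"
  by (auto simp: hsupp_def rsum_apply)

lemma ip_lact: assumes "s \<in> sg N" shows "ip N (lact s f) (lact s g) = ip N f g"
  unfolding ip_def lact_def
  by (rule sum.reindex_bij_witness[where i = "\<lambda>x. s \<circ> x" and j = "\<lambda>x. inv s \<circ> x"])
    (use assms in \<open>auto simp: sg_cancel sg_comp sg_inv simp del: o_apply\<close>)

lemma ip_add: "ip N (f + g) h = ip N f h + ip N g h" "ip N h (f + g) = ip N h f + ip N h g"
  and ip_rscl: "ip N (rscl c f) h = c * ip N f h" "ip N h (rscl c f) = c * ip N h f"
  by (auto simp: ip_def algebra_simps sum.distrib sum_distrib_left)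

lemma ip_sum: "ip N (\<Sum>i\<in>A. f i) h = (\<Sum>i\<in>A. ip N (f i) h)"
  by (induction A rule: infinite_finite_induct)
    (simp_all add: ip_add del: plus_fun_apply zero_fun_apply, simp_all add: ip_def)

lemma ip_pos: "ip N f f \<ge> 0"
  by (auto simp: ip_def intro: sum_nonneg)

lemma ip_zero: assumes "ip N f f = 0" "hsupp N f" shows "f = 0"
proof
  fix x
  have "\<forall>x\<in>sg N. f x * f x = 0"
    using assms(1) unfolding ip_def by (subst (asm) sum_nonneg_eq_0_iff) auto
  then show "f x = 0 x" using assms(2) by (cases "x \<in> sg N") (auto simp: hsupp_def)
qed

lemma conj_transpose: "bij s \<Longrightarrow> s \<circ> transpose a b = transpose (s a) (s b) \<circ> s"
  by (auto simp: fun_eq_iff transpose_def bij_def inj_def)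

lemma bij_tr [simp]: "bij (transpose a b)" by simp

definition symm :: "real \<Rightarrow> nat set \<Rightarrow> ((nat \<Rightarrow> nat) \<Rightarrow> real) \<Rightarrow> bool" where
  "symm d A f \<longleftrightarrow> (\<forall>a\<in>A. \<forall>b\<in>A. a \<noteq> b \<longrightarrow> lact (transpose a b) f = rscl d f)"

lemma symmD: "symm d A f \<Longrightarrow> a \<in> A \<Longrightarrow> b \<in> A \<Longrightarrow> a \<noteq> b \<Longrightarrow> lact (transpose a b) f = rscl d f"
  by (auto simp: symm_def)

lemma symm_subset: "symm d A f \<Longrightarrow> B \<subseteq> A \<Longrightarrow> symm d B f"
  by (auto simp: symm_def)

lemma symm_commute:
  assumes "symm d A f" "bij s" "\<And>a. a \<in> A \<Longrightarrow> s a = a"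
  shows "symm d A (lact s f)"
  unfolding symm_def
proof (intro ballI impI)
  fix a b assume ab: "a \<in> A" "b \<in> A" "a \<noteq> b"
  have "lact (transpose a b) (lact s f) = lact (transpose a b \<circ> s) f" using assms(2) by (simp add: lact_comp)
  also have "transpose a b \<circ> s = s \<circ> transpose a b"
    using conj_transpose[OF assms(2), of a b] assms(3) ab by simp
  also have "lact (s \<circ> transpose a b) f = rscl d (lact s f)"
    using assms(2) symmD[OF assms(1) ab] by (simp add: lact_comp lact_rscl)
  finally show "lact (transpose a b) (lact s f) = rscl d (lact s f)" .
qed

lemma symm_add: "symm d A f \<Longrightarrow> symm d A g \<Longrightarrow> symm d A (f + g)"
  by (simp add: symm_def lact_add rscl_add del: plus_fun_apply)

lemma symm_rscl: "symm d A f \<Longrightarrow> symm d A (rscl c f)"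
  by (simp add: symm_def lact_rscl mult.commute)

lemma symm_0: "symm d A 0"
  by (simp add: symm_def lact_0 del: zero_fun_apply)

lemma symm_sum: "(\<And>i. i \<in> I \<Longrightarrow> symm d A (f i)) \<Longrightarrow> symm d A (\<Sum>i\<in>I. f i)"
  by (simp add: symm_def lact_sum rscl_sum)

text \<open>The transpositions \<open>(x y)\<close>, together with the identity, represent the
  cosets of the permutations of \<open>A\<close> in those of \<open>insert x A\<close>. Hence a
  vector symmetric (or antisymmetric) on \<open>A\<close> becomes so on
  \<open>insert x A\<close>.\<close>

definition extend :: "real \<Rightarrow> nat \<Rightarrow> nat set \<Rightarrow> ((nat \<Rightarrow> nat) \<Rightarrow> real) \<Rightarrow> (nat \<Rightarrow> nat) \<Rightarrow> real" where
  "extend d x A f = f + (\<Sum>y\<in>A. rscl d (lact (transpose x y) f))"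

lemma sg_eq_comp: "bij s \<Longrightarrow> bij t \<Longrightarrow> lact s (lact t f) = lact (s \<circ> t) f"
  by (simp add: lact_comp)

lemma symm_extend:
  assumes d: "d = 1 \<or> d = - 1" and A: "finite A" "x \<notin> A" and s: "symm d A f"
  shows "symm d (insert x A) (extend d x A f)"
proof -
  let ?T = "\<lambda>y. lact (transpose x y)"
  have xy: "?T z (extend d x A f) = rscl d (extend d x A f)" if z: "z \<in> A" for z
  proof -
    have zx: "z \<noteq> x" using z A by auto
    have sq: "?T z (?T z f) = f" by (simp add: sg_eq_comp)
    have t3: "?T z (?T y f) = rscl d (?T y f)" if y: "y \<in> A - {z}" for y
    proof -
      have "transpose x z \<circ> transpose x y = transpose x y \<circ> transpose z y"
        using y z zx A by (auto simp: fun_eq_iff transpose_def)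
      then have "?T z (?T y f) = ?T y (lact (transpose z y) f)" by (simp only: sg_eq_comp bij_tr)
      then show ?thesis using symmD[OF s z, of y] y by (simp add: lact_rscl)
    qed
    have S: "(\<Sum>y\<in>A. g y) = g z + (\<Sum>y\<in>A - {z}. g y)" for g :: "nat \<Rightarrow> (nat \<Rightarrow> nat) \<Rightarrow> real"
      using sum.remove[OF A(1) z] .
    have dd: "d * d = 1" using d by auto
    have "?T z (extend d x A f) = ?T z f + rscl d f + (\<Sum>y\<in>A - {z}. ?T y f)"
      unfolding extend_def S using t3
      by (simp add: lact_add lact_sum lact_rscl sq t3 dd del: plus_fun_apply)
    also have "\<dots> = rscl d (extend d x A f)"
      unfolding extend_def S by (simp add: rscl_add rscl_sum dd algebra_simps del: plus_fun_apply)
    finally show ?thesis .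
  qed
  show ?thesis
    unfolding symm_def
  proof (intro ballI impI)
    fix a b assume ab: "a \<in> insert x A" "b \<in> insert x A" "a \<noteq> b"
    consider "a = x" "b \<in> A" | "b = x" "a \<in> A" | "a \<in> A" "b \<in> A" using ab by auto
    then show "lact (transpose a b) (extend d x A f) = rscl d (extend d x A f)"
    proof cases
      case 1 then show ?thesis using xy by simp
    next
      case 2 then show ?thesis using xy by (simp add: transpose_commute)
    next
      case 3
      then have ax: "a \<noteq> x" "b \<noteq> x" using A by auto
      let ?s = "transpose a b"
      have "lact ?s (?T y f) = rscl d (?T (?s y) f)" for y
      proof -
        have "?s \<circ> transpose x y = transpose x (?s y) \<circ> ?s"
          using conj_transpose[of ?s x y] ax by (simp add: transpose_apply_other)
        then have "lact ?s (?T y f) = ?T (?s y) (lact ?s f)" by (simp only: sg_eq_comp bij_tr)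
        then show ?thesis using symmD[OF s 3] ab by (simp add: lact_rscl)
      qed
      then have "lact ?s (extend d x A f) = rscl d f + (\<Sum>y\<in>A. rscl d (rscl d (?T (?s y) f)))"
        unfolding extend_def using symmD[OF s 3 ab(3)] by (simp add: lact_add lact_sum lact_rscl del: plus_fun_apply)
      also have "(\<Sum>y\<in>A. rscl d (rscl d (?T (?s y) f))) = (\<Sum>y\<in>A. rscl d (rscl d (?T y f)))"
        by (rule sum.permute[OF permutes_swap_id[OF 3], of "\<lambda>y. rscl d (rscl d (?T y f))", unfolded comp_def, symmetric])
      finally show ?thesis by (simp add: extend_def rscl_add rscl_sum del: plus_fun_apply rscl_apply)
    qed
  qed
qed

text \<open>Up to the factor \<open>1 + card A\<close> the extended vector \<open>?u\<close> is an
  orthogonal projection of \<open>w\<close>: each \<open>(x y)\<close> is an isometry acting on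
  \<open>?u\<close> by \<open>d\<close>, so
  \<open>ip N ?u ?u = (1 + card A) * ip N w ?u\<close>.\<close>

lemma extend_pos:
  assumes d: "d = 1 \<or> d = - 1" and A: "finite A" "x \<notin> A" "insert x A \<subseteq> {1..N}" and s: "symm d A w"
  shows "ip N w (extend d x A w) \<ge> 0"
proof -
  let ?u = "extend d x A w"
  have dd: "d * d = 1" using d by auto
  have "ip N (rscl d (lact (transpose x y) w)) ?u = ip N w ?u" if y: "y \<in> A" for y
  proof -
    have t: "transpose x y \<in> sg N" using y A by (intro sg_transpose) auto
    have "lact (transpose x y) ?u = rscl d ?u"
      using symmD[OF symm_extend[OF d A(1,2) s], of x y] y A by auto
    then have u: "?u = rscl d (lact (transpose x y) ?u)" using dd by simp
    have "ip N (lact (transpose x y) w) ?u = d * ip N w ?u"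
      by (subst u) (simp add: ip_rscl ip_lact[OF t])
    then show ?thesis using dd by (simp add: ip_rscl mult.assoc[symmetric])
  qed
  then have "ip N ?u ?u = (1 + real (card A)) * ip N w ?u"
    by (subst (1) extend_def) (simp add: ip_add ip_sum algebra_simps del: plus_fun_apply)
  moreover have "ip N ?u ?u \<ge> 0" by (rule ip_pos)
  ultimately show ?thesis by (simp add: zero_le_mult_iff)
qed

subsection \<open>Column groups\<close>

definition CG :: "nat set \<Rightarrow> (nat \<Rightarrow> nat) \<Rightarrow> (nat \<Rightarrow> nat) set" where
  "CG P col = {s. s permutes P \<and> (\<forall>x\<in>P. col (s x) = col x)}"

definition wt :: "real \<Rightarrow> (nat \<Rightarrow> nat) \<Rightarrow> real" where
  "wt d s = (if d = 1 then of_int (sign s) else 1)"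

text \<open>For \<open>d = 1\<close> the blocks are symmetric and the columns antisymmetric; for \<open>d = - 1\<close> the roles are exchanged.\<close>

definition alt :: "real \<Rightarrow> nat set \<Rightarrow> (nat \<Rightarrow> nat) \<Rightarrow> ((nat \<Rightarrow> nat) \<Rightarrow> real) \<Rightarrow> (nat \<Rightarrow> nat) \<Rightarrow> real" where
  "alt d P col f = (\<Sum>s\<in>CG P col. rscl (wt d s) (lact s f))"

lemma CG_cong: "(\<And>x y. x \<in> P \<Longrightarrow> y \<in> P \<Longrightarrow> col x = col y \<longleftrightarrow> col' x = col' y) \<Longrightarrow> CG P col = CG P col'"
  unfolding CG_def by (intro Collect_cong conj_cong refl ball_cong) (auto simp: permutes_in_image)

lemma alt_cong: "(\<And>x y. x \<in> P \<Longrightarrow> y \<in> P \<Longrightarrow> col x = col y \<longleftrightarrow> col' x = col' y) \<Longrightarrow> alt d P col f = alt d P col' f"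
  unfolding alt_def by (intro sum.cong CG_cong refl) auto

lemma CG_comp: "s \<in> CG P col \<Longrightarrow> t \<in> CG P col \<Longrightarrow> s \<circ> t \<in> CG P col"
  by (auto simp: CG_def permutes_compose permutes_in_image)

lemma CG_inv: assumes "s \<in> CG P col" shows "inv s \<in> CG P col"
proof -
  have s: "s permutes P" using assms by (simp add: CG_def)
  have "col (inv s x) = col x" if "x \<in> P" for x
  proof -
    have "inv s x \<in> P" using permutes_in_image[OF permutes_inv[OF s]] that by auto
    then have "col (s (inv s x)) = col (inv s x)" using assms by (auto simp: CG_def)
    then show ?thesis using permutes_inverses[OF s] by simp
  qed
  then show ?thesis using permutes_inv[OF s] by (simp add: CG_def)
qed

lemma CG_permutation: "s \<in> CG P col \<Longrightarrow> finite P \<Longrightarrow> permutation s"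
  using permutes_imp_permutation by (auto simp: CG_def)

lemma CG_bij: "s \<in> CG P col \<Longrightarrow> bij s"
  using permutes_bij by (auto simp: CG_def)

lemma CG_transpose: "a \<in> P \<Longrightarrow> b \<in> P \<Longrightarrow> col a = col b \<Longrightarrow> transpose a b \<in> CG P col"
  by (auto simp: CG_def permutes_swap_id transpose_def)

lemma wt_comp: "permutation s \<Longrightarrow> permutation t \<Longrightarrow> wt d (s \<circ> t) = wt d s * wt d t"
  by (simp add: wt_def sign_compose)

lemma wt_transpose: "d = 1 \<or> d = - 1 \<Longrightarrow> a \<noteq> b \<Longrightarrow> wt d (transpose a b) = - d"
  by (auto simp: wt_def sign_swap_id)

lemma wt_sq: "wt d s * wt d s = 1"
  by (auto simp: wt_def simp flip: of_int_mult)

lemma alt_left: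
  assumes "finite P" "t \<in> CG P col"
  shows "lact t (alt d P col f) = rscl (wt d t) (alt d P col f)"
proof -
  have "lact t (alt d P col f) = (\<Sum>s\<in>CG P col. rscl (wt d t * wt d (t \<circ> s)) (lact (t \<circ> s) f))"
    unfolding alt_def lact_sum
    using wt_comp[OF CG_permutation[OF assms(2,1)] CG_permutation[OF _ assms(1)]] wt_sq[of d t]
    by (intro sum.cong) (auto simp: lact_rscl lact_comp CG_bij[OF assms(2)] CG_bij mult.assoc[symmetric] simp del: o_apply)
  also have "\<dots> = (\<Sum>s\<in>CG P col. rscl (wt d t * wt d s) (lact s f))"
  proof (rule sum.reindex_bij_witness[where j = "\<lambda>s. t \<circ> s" and i = "\<lambda>s. inv t \<circ> s"])
    have e: "inv t \<circ> t = id" "t \<circ> inv t = id" using assms(2) permutes_inv_o by (auto simp: CG_def)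
    then show "inv t \<circ> (t \<circ> s) = s" "t \<circ> (inv t \<circ> s) = s" for s by (simp_all only: comp_assoc[symmetric] id_comp)
  qed (use assms CG_comp CG_inv in auto)
  finally show ?thesis by (simp add: alt_def rscl_sum)
qed

text \<open>The terms of \<open>s\<close> and \<open>s \<circ> transpose a b\<close> cancel: the
  weight changes by \<open>- d\<close> and the vector by \<open>d\<close>. This is the usual
  vanishing when two points of one row lie in one column.\<close>

lemma alt_right:
  assumes P: "finite P" and ab: "a \<in> P" "b \<in> P" "a \<noteq> b" "col a = col b"
    and d: "d = 1 \<or> d = - 1" and f: "lact (transpose a b) f = rscl d f"
  shows "alt d P col f = 0"
proof -
  let ?t = "transpose a b"
  have t: "?t \<in> CG P col" using ab by (intro CG_transpose)
  have "alt d P col f = (\<Sum>s\<in>CG P col. rscl (wt d (s \<circ> ?t)) (lact (s \<circ> ?t) f))"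
    unfolding alt_def
  proof (rule sum.reindex_bij_witness[where i = "\<lambda>s. s \<circ> ?t" and j = "\<lambda>s. s \<circ> ?t"])
    show "s \<circ> ?t \<circ> ?t = s" for s :: "nat \<Rightarrow> nat" by (simp add: comp_assoc)
    then show "s \<circ> ?t \<circ> ?t = s" for s :: "nat \<Rightarrow> nat" .
    show "rscl (wt d (s \<circ> ?t \<circ> ?t)) (lact (s \<circ> ?t \<circ> ?t) f) = rscl (wt d s) (lact s f)" for s :: "nat \<Rightarrow> nat"
      by (simp add: comp_assoc)
  qed (use t CG_comp in auto)
  also have "\<dots> = (\<Sum>s\<in>CG P col. rscl (- 1) (rscl (wt d s) (lact s f)))"
  proof (rule sum.cong[OF refl])
    fix s assume s: "s \<in> CG P col"
    have "lact (s \<circ> ?t) f = rscl d (lact s f)" using f by (simp add: lact_comp CG_bij[OF s] lact_rscl)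
    moreover have "wt d (s \<circ> ?t) = wt d s * (- d)"
      using wt_comp[OF CG_permutation[OF s P] permutation_swap_id] wt_transpose[OF d ab(3)] by simp
    ultimately show "rscl (wt d (s \<circ> ?t)) (lact (s \<circ> ?t) f) = rscl (- 1) (rscl (wt d s) (lact s f))"
      using d by auto
  qed
  also have "\<dots> = rscl (- 1) (alt d P col f)" by (simp add: alt_def rscl_sum)
  finally show ?thesis by (auto simp: fun_eq_iff)
qed

text \<open>An element \<open>s\<close> of the larger column group is determined by
  \<open>s x\<close> and by \<open>transpose x (s x) \<circ> s\<close>, which fixes
  \<open>x\<close>. The value \<open>s x = x\<close> gives the first term; the other coset
  representatives have weight \<open>- d\<close>.\<close>

lemma alt_insert:
  assumes P: "finite P" "x \<notin> P" and d: "d = 1 \<or> d = - 1"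
  shows "alt d (insert x P) col f
    = alt d P col f - (\<Sum>y\<in>{y\<in>P. col y = col x}. rscl d (lact (transpose x y) (alt d P col f)))"
proof -
  let ?Y = "{y \<in> insert x P. col y = col x}"
  let ?j = "\<lambda>(y, s). transpose x y \<circ> s"
  have px: "s x = x" if "s \<in> CG P col" for s using that P by (auto simp: CG_def permutes_not_in)
  have bij: "bij_betw ?j (?Y \<times> CG P col) (CG (insert x P) col)"
  proof (rule bij_betw_byWitness[where f' = "\<lambda>s. (s x, transpose x (s x) \<circ> s)"])
    show "\<forall>p\<in>?Y \<times> CG P col. (\<lambda>s. (s x, transpose x (s x) \<circ> s)) (?j p) = p"
    proof
      fix p assume "p \<in> ?Y \<times> CG P col"
      then obtain y s where p: "p = (y, s)" "s \<in> CG P col" by auto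
      then have "s x = x" using px by blast
      then have "(transpose x y \<circ> s) x = y" by simp
      moreover have "transpose x y \<circ> (transpose x y \<circ> s) = s" by (simp add: comp_assoc[symmetric])
      ultimately show "(\<lambda>s. (s x, transpose x (s x) \<circ> s)) (?j p) = p" using p by simp
    qed
    show "\<forall>s\<in>CG (insert x P) col. ?j (s x, transpose x (s x) \<circ> s) = s"
      by (simp add: comp_assoc[symmetric])
    show "?j ` (?Y \<times> CG P col) \<subseteq> CG (insert x P) col"
    proof clarify
      fix y s assume y: "y \<in> insert x P" "col y = col x" and s: "s \<in> CG P col"
      have "s permutes insert x P" using s permutes_subset[of s P "insert x P"] by (auto simp: CG_def)
      then have "s \<in> CG (insert x P) col" using s px[OF s] by (auto simp: CG_def)
      moreover have "transpose x y \<in> CG (insert x P) col" using y by (intro CG_transpose) auto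
      ultimately show "transpose x y \<circ> s \<in> CG (insert x P) col" using CG_comp by blast
    qed
    show "(\<lambda>s. (s x, transpose x (s x) \<circ> s)) ` CG (insert x P) col \<subseteq> ?Y \<times> CG P col"
    proof clarify
      fix s assume s: "s \<in> CG (insert x P) col"
      then have sp: "s permutes insert x P" and sc: "\<And>z. z \<in> insert x P \<Longrightarrow> col (s z) = col z" by (auto simp: CG_def)
      have sx: "s x \<in> insert x P" "col (s x) = col x" using sc permutes_in_image[OF sp, of x] by auto
      have p: "transpose x (s x) \<circ> s permutes P" by (rule permutes_insert_lemma[OF sp])
      have "col ((transpose x (s x) \<circ> s) z) = col z" if "z \<in> P" for z
        using sc[of z] sx that by (auto simp: transpose_def)
      then show "s x \<in> ?Y \<and> transpose x (s x) \<circ> s \<in> CG P col" using sx p by (auto simp: CG_def)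
    qed
  qed
  have "alt d (insert x P) col f = (\<Sum>p\<in>?Y \<times> CG P col. rscl (wt d (?j p)) (lact (?j p) f))"
    unfolding alt_def using sum.reindex_bij_betw[OF bij, of "\<lambda>s. rscl (wt d s) (lact s f)"] by simp
  also have "\<dots> = (\<Sum>y\<in>?Y. \<Sum>s\<in>CG P col. rscl (wt d (transpose x y \<circ> s)) (lact (transpose x y \<circ> s) f))"
    by (subst sum.cartesian_product) (simp add: case_prod_unfold)
  also have "\<dots> = (\<Sum>y\<in>?Y. rscl (wt d (transpose x y)) (lact (transpose x y) (alt d P col f)))"
    unfolding alt_def lact_sum rscl_sum
    using wt_comp[OF permutation_swap_id CG_permutation[OF _ P(1)]]
    by (intro sum.cong refl) (simp add: lact_comp CG_bij lact_rscl)
  also have "?Y = insert x {y\<in>P. col y = col x}" by auto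
  also have "(\<Sum>y\<in>insert x {y\<in>P. col y = col x}. rscl (wt d (transpose x y)) (lact (transpose x y) (alt d P col f)))
      = alt d P col f + (\<Sum>y\<in>{y\<in>P. col y = col x}. rscl (wt d (transpose x y)) (lact (transpose x y) (alt d P col f)))"
  proof (subst sum.insert)
    show "finite {y \<in> P. col y = col x}" "x \<notin> {y \<in> P. col y = col x}" using P by auto
    have "wt d (transpose x x) = 1" by (simp add: wt_def)
    moreover have "lact (transpose x x) h = h" for h by (metis lact_id transpose_same)
    ultimately show "rscl (wt d (transpose x x)) (lact (transpose x x) (alt d P col f)) +
      (\<Sum>y\<in>{y \<in> P. col y = col x}. rscl (wt d (transpose x y)) (lact (transpose x y) (alt d P col f))) =
      alt d P col f + (\<Sum>y\<in>{y\<in>P. col y = col x}. rscl (wt d (transpose x y)) (lact (transpose x y) (alt d P col f)))"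
      by (simp only: rscl_1)
  qed
  also have "(\<Sum>y\<in>{y\<in>P. col y = col x}. rscl (wt d (transpose x y)) (lact (transpose x y) (alt d P col f)))
      = (\<Sum>y\<in>{y\<in>P. col y = col x}. rscl (- d) (lact (transpose x y) (alt d P col f)))"
    using P by (intro sum.cong refl arg_cong2[of _ _ _ _ rscl] wt_transpose[OF d]) auto
  also have "\<dots> = - (\<Sum>y\<in>{y\<in>P. col y = col x}. rscl d (lact (transpose x y) (alt d P col f)))"
    by (simp add: fun_eq_iff rsum_apply sum_negf)
  finally show ?thesis unfolding diff_conv_add_uminus .
qed

text \<open>A sum of Jucys-Murphy type commutes with every permutation of \<open>Y\<close> fixing
  \<open>x\<close>. Its eigenvalues therefore survive column antisymmetrization, which is
  \<open>alt_sum_transpose\<close>.\<close>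

lemma lact_sum_transpose_commute:
  assumes "s permutes P" "P \<subseteq> Y" "s x = x"
  shows "(\<Sum>y\<in>Y. lact (transpose x y) (lact s f)) = lact s (\<Sum>y\<in>Y. lact (transpose x y) f)"
proof -
  have b: "bij s" using assms(1) by (rule permutes_bij)
  have sY: "s permutes Y" using permutes_subset[OF assms(1,2)] .
  have "(\<Sum>y\<in>Y. lact (transpose x y) (lact s f)) = (\<Sum>y\<in>Y. lact (transpose x (s y)) (lact s f))"
    using sum.permute[OF sY, of "\<lambda>y. lact (transpose x y) (lact s f)"] by (simp add: comp_def)
  also have "\<dots> = (\<Sum>y\<in>Y. lact s (lact (transpose x y) f))"
  proof (rule sum.cong[OF refl])
    fix y
    have "transpose x (s y) \<circ> s = s \<circ> transpose x y" using conj_transpose[OF b, of x y] assms(3) by simp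
    then show "lact (transpose x (s y)) (lact s f) = lact s (lact (transpose x y) f)"
      by (simp only: sg_eq_comp b bij_tr)
  qed
  finally show ?thesis by (simp add: lact_sum)
qed

lemma alt_sum_transpose:
  assumes "P \<subseteq> Y" "x \<notin> P" and e: "(\<Sum>y\<in>Y. lact (transpose x y) f) = rscl c f"
  shows "(\<Sum>y\<in>Y. lact (transpose x y) (alt d P col f)) = rscl c (alt d P col f)"
proof -
  have "(\<Sum>y\<in>Y. lact (transpose x y) (alt d P col f))
      = (\<Sum>s\<in>CG P col. rscl (wt d s) (\<Sum>y\<in>Y. lact (transpose x y) (lact s f)))"
    unfolding alt_def lact_sum rscl_sum lact_rscl by (rule sum.swap)
  also have "\<dots> = (\<Sum>s\<in>CG P col. rscl (wt d s) (lact s (rscl c f)))"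
  proof (rule sum.cong[OF refl])
    fix s assume "s \<in> CG P col"
    then have "s permutes P" "s x = x" using assms(2) by (auto simp: CG_def permutes_not_in)
    then show "rscl (wt d s) (\<Sum>y\<in>Y. lact (transpose x y) (lact s f)) = rscl (wt d s) (lact s (rscl c f))"
      using lact_sum_transpose_commute[OF _ assms(1)] e by simp
  qed
  finally show ?thesis by (simp add: alt_def rscl_sum lact_rscl mult.commute)
qed

lemma hsupp_alt: assumes "hsupp N f" "P \<subseteq> {1..N}" shows "hsupp N (alt d P col f)"
  unfolding alt_def
proof (intro hsupp_sum hsupp_rscl hsupp_lact assms(1))
  fix s assume "s \<in> CG P col"
  then show "s \<in> sg N" using permutes_subset[OF _ assms(2)] by (auto simp: CG_def sg_def)
qed

lemma symm_alt: assumes "symm d A f" "A \<inter> P = {}" shows "symm d A (alt e P col f)"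
  unfolding alt_def
proof (intro symm_sum symm_rscl symm_commute[OF assms(1)])
  fix s a assume "s \<in> CG P col"
  then show "bij s" by (rule CG_bij)
  assume "a \<in> A"
  then have "a \<notin> P" using assms(2) by auto
  then show "s a = a" using \<open>s \<in> CG P col\<close> by (auto simp: CG_def permutes_not_in)
qed

text \<open>The heart of the construction: rows before \<open>j\<close> are full, row
  \<open>j\<close> has \<open>b\<close> of its \<open>c\<close> cells, and \<open>x\<close> is a new
  point of row \<open>j\<close>. Suppose every admissible column kills the vector and let
  \<open>w = alt d P col f\<close>. Then the operators \<open>d * (x y)\<close> sum to
  \<open>c\<close> on \<open>w\<close> when \<open>y\<close> runs over \<open>P\<close>, one unit
  per column. Over all earlier blocks and the filled cells of row \<open>j\<close> they sum to
  \<open>b - j\<close>. So the points of earlier blocks outside \<open>P\<close> give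
  \<open>b - j - c\<close>. Adding the identity once for each of the \<open>j\<close> blocks
  produces a sum of positive operators with the eigenvalue \<open>b - c < 0\<close>, which is absurd
  unless \<open>w = 0\<close>.\<close>

lemma alt_extend_step:
  fixes A :: "nat \<Rightarrow> nat set"
  assumes d: "d = 1 \<or> d = - 1" and supp: "hsupp N f"
    and A: "\<And>i. i \<le> j \<Longrightarrow> A i \<subseteq> {1..N}"
    and disj: "\<And>i i'. i \<le> j \<Longrightarrow> i' \<le> j \<Longrightarrow> i \<noteq> i' \<Longrightarrow> A i \<inter> A i' = {}"
    and symm: "\<And>i. i \<le> j \<Longrightarrow> symm d (A i) f"
    and hw: "\<And>i x. i < j \<Longrightarrow> x \<in> A j \<Longrightarrow> (\<Sum>y\<in>A i. lact (transpose x y) f) = rscl (- d) f"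
    and P: "P \<subseteq> (\<Union>i\<le>j. A i)"
    and full: "\<And>i. i < j \<Longrightarrow> bij_betw col (A i \<inter> P) {..<c}"
    and part: "bij_betw col (A j \<inter> P) {..<b}" and bc: "b < c"
    and nz: "alt d P col f \<noteq> 0" and x: "x \<in> A j" "x \<notin> P"
  shows "\<exists>b'. b \<le> b' \<and> b' < c \<and> alt d (insert x P) (col(x := b')) f \<noteq> 0"
proof (rule ccontr)
  assume contra: "\<not> ?thesis"
  let ?w = "alt d P col f"
  let ?T = "\<lambda>y. lact (transpose x y)"
  have dd: "d * d = 1" using d by auto
  have PN: "P \<subseteq> {1..N}" using P A by fastforce
  then have fP: "finite P" using finite_subset by blast
  have fA: "finite (A i)" if "i \<le> j" for i using A[OF that] finite_subset by blast
  have xN: "x \<in> {1..N}" using x A[OF order_refl] by auto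
  \<comment> \<open>A column \<open>b' < b\<close> already contains a point of row \<open>j\<close>,
    so \<open>alt_right\<close> applies; for the remaining columns the vanishing is the assumption
    to be refuted. \<open>alt_insert\<close> turns each vanishing into eigenvalue 1 for that
    column.\<close>
  have vanish: "(\<Sum>y\<in>{y\<in>P. col y = b'}. rscl d (?T y ?w)) = ?w" if b': "b' < c" for b'
  proof -
    have "alt d (insert x P) (col(x := b')) f = 0"
    proof (cases "b' < b")
      case True
      then have "b' \<in> col ` (A j \<inter> P)" using part by (auto simp: bij_betw_def)
      then obtain y where y: "y \<in> A j" "y \<in> P" "col y = b'" by auto
      have "lact (transpose x y) f = rscl d f"
        using symmD[OF symm[of j] x(1) y(1)] x y by auto
      then show ?thesis using alt_right[of "insert x P" x y "col(x := b')" d f] fP x y d by auto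
    next
      case False
      then show ?thesis using contra b' by auto
    qed
    moreover have "alt d P (col(x := b')) f = ?w" using x by (intro alt_cong) auto
    moreover have "{y\<in>P. (col(x := b')) y = b'} = {y\<in>P. col y = b'}" using x by auto
    ultimately show ?thesis using alt_insert[OF fP x(2) d, of "col(x := b')" f] by simp
  qed
  have colP: "col y < c" if yP: "y \<in> P" for y
  proof -
    obtain i where i: "i \<le> j" "y \<in> A i" using subsetD[OF P yP] by auto
    show ?thesis
    proof (cases "i = j")
      case True
      then have "col y \<in> {..<b}" using bij_betwE[OF part] i yP by blast
      then show ?thesis using bc by simp
    next
      case False
      then have "col y \<in> {..<c}" using bij_betwE[OF full[of i]] i yP by auto
      then show ?thesis by simp
    qed
  qed
  have sumP: "(\<Sum>y\<in>P. rscl d (?T y ?w)) = rscl (real c) ?w"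
  proof -
    have "(\<Sum>y\<in>P. rscl d (?T y ?w)) = (\<Sum>b'<c. \<Sum>y\<in>{y\<in>P. col y = b'}. rscl d (?T y ?w))"
      using fP colP by (intro sum.group[symmetric]) auto
    also have "\<dots> = (\<Sum>b'<c. ?w)" using vanish by (intro sum.cong) auto
    finally show ?thesis by (simp add: fun_eq_iff rsum_apply)
  qed
  let ?U = "\<Union>i<j. A i" and ?J = "A j \<inter> P"
  let ?Y = "?U \<union> ?J"
  have fU: "finite ?U" "finite ?J" using fA fP by auto
  have UJ: "?U \<inter> ?J = {}"
  proof -
    have "A i \<inter> A j = {}" if "i < j" for i using disj[of i j] that by simp
    then show ?thesis by blast
  qed
  have PY: "P \<subseteq> ?Y"
  proof
    fix y assume y: "y \<in> P"
    then obtain i where "i \<le> j" "y \<in> A i" using P by blast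
    then show "y \<in> ?Y" using y by (cases "i = j") auto
  qed
  have sumY: "(\<Sum>y\<in>?Y. ?T y f) = rscl (d * (real b - real j)) f"
  proof -
    have "(\<Sum>y\<in>?U. ?T y f) = (\<Sum>i<j. \<Sum>y\<in>A i. ?T y f)"
      using fA disj by (intro sum.UNION_disjoint) (auto simp: less_imp_le)
    also have "\<dots> = (\<Sum>i<j. rscl (- d) f)" using hw x by (intro sum.cong) auto
    finally have 1: "(\<Sum>y\<in>?U. ?T y f) = rscl (- d * real j) f" by (simp add: fun_eq_iff rsum_apply)
    have "(\<Sum>y\<in>?J. ?T y f) = (\<Sum>y\<in>?J. rscl d f)"
      using symmD[OF symm[of j] x(1)] x by (intro sum.cong) auto
    moreover have "card ?J = b" using part bij_betw_same_card by fastforce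
    ultimately have 2: "(\<Sum>y\<in>?J. ?T y f) = rscl (d * real b) f" by (simp add: fun_eq_iff rsum_apply)
    show ?thesis using sum.union_disjoint[OF fU UJ, of "\<lambda>y. ?T y f"] 1 2
      by (simp add: fun_eq_iff algebra_simps)
  qed
  have sumYw: "(\<Sum>y\<in>?Y. rscl d (?T y ?w)) = rscl (real b - real j) ?w"
    using alt_sum_transpose[OF PY x(2) sumY, of d col] dd
    by (simp add: rscl_sum[symmetric] mult.assoc[symmetric])
  have YP: "?Y - P = (\<Union>i<j. A i - P)" by auto
  have "(\<Sum>y\<in>?Y - P. rscl d (?T y ?w)) = (\<Sum>y\<in>?Y. rscl d (?T y ?w)) - (\<Sum>y\<in>P. rscl d (?T y ?w))"
    using fU PY by (intro sum_diff) auto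
  also have "\<dots> = rscl (real b - real j - real c) ?w"
    unfolding sumYw sumP by (simp add: fun_eq_iff algebra_simps)
  finally have D: "(\<Sum>y\<in>?Y - P. rscl d (?T y ?w)) = rscl (real b - real j - real c) ?w" .
  have "(\<Sum>y\<in>?Y - P. rscl d (?T y ?w)) = (\<Sum>i<j. \<Sum>y\<in>A i - P. rscl d (?T y ?w))"
    unfolding YP
  proof (rule sum.UNION_disjoint)
    show "\<forall>i\<in>{..<j}. finite (A i - P)" using fA by simp
    show "\<forall>i\<in>{..<j}. \<forall>i'\<in>{..<j}. i \<noteq> i' \<longrightarrow> (A i - P) \<inter> (A i' - P) = {}"
    proof (intro ballI impI)
      fix i i' assume "i \<in> {..<j}" "i' \<in> {..<j}" "i \<noteq> i'"
      then have "A i \<inter> A i' = {}" using disj by simp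
      then show "(A i - P) \<inter> (A i' - P) = {}" by blast
    qed
  qed simp
  \<comment> \<open>Each of the \<open>j\<close> blocks receives one summand \<open>?w\<close>,
    which completes its sum to an \<open>extend\<close> and cancels the
    \<open>- real j\<close>.\<close>
  then have "(\<Sum>i<j. extend d x (A i - P) ?w) = rscl (real b - real c) ?w"
    using D unfolding extend_def sum.distrib by (simp add: fun_eq_iff rsum_apply algebra_simps)
  moreover have "0 \<le> ip N ?w (\<Sum>i<j. extend d x (A i - P) ?w)"
  proof -
    have "0 \<le> ip N ?w (extend d x (A i - P) ?w)" if i: "i < j" for i
    proof (rule extend_pos[OF d])
      show "finite (A i - P)" using fA[of i] i by simp
      show "x \<notin> A i - P" using disj[of i j] i x by auto
      show "insert x (A i - P) \<subseteq> {1..N}" using xN A[of i] i by auto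
      have "symm d (A i) f" using symm i by simp
      then have "symm d (A i - P) f" by (rule symm_subset) auto
      then show "symm d (A i - P) ?w" by (rule symm_alt) auto
    qed
    then have "0 \<le> (\<Sum>i<j. ip N ?w (extend d x (A i - P) ?w))" by (intro sum_nonneg) auto
    also have "\<dots> = ip N ?w (\<Sum>i<j. extend d x (A i - P) ?w)"
      unfolding ip_def rsum_apply sum_distrib_left by (rule sum.swap)
    finally show ?thesis .
  qed
  ultimately have "0 \<le> (real b - real c) * ip N ?w ?w" by (simp add: ip_rscl)
  then have "ip N ?w ?w = 0" using bc ip_pos[of N ?w] by (auto simp: zero_le_mult_iff)
  then show False using ip_zero[OF _ hsupp_alt[OF supp PN]] nz by blast
qed

text \<open>Applied twice in \<open>regular_dichotomy\<close>: with \<open>d = - 1\<close> and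
  \<open>c = 1\<close> to symmetrize a transversal of the antisymmetric blocks, and with
  \<open>d = 1\<close> and \<open>c = Suc m\<close> to fill the rectangle. The bound on
  \<open>card (A i)\<close> guarantees a fresh point for every cell.\<close>

lemma column_arrangement_exists:
  fixes A :: "nat \<Rightarrow> nat set"
  assumes d: "d = 1 \<or> d = - 1" and supp: "hsupp N f" and f: "f \<noteq> 0"
    and A: "\<And>i. i \<le> r \<Longrightarrow> A i \<subseteq> {1..N}"
    and disj: "\<And>i i'. i \<le> r \<Longrightarrow> i' \<le> r \<Longrightarrow> i \<noteq> i' \<Longrightarrow> A i \<inter> A i' = {}"
    and symm: "\<And>i. i \<le> r \<Longrightarrow> symm d (A i) f"
    and hw: "\<And>i j x. i < j \<Longrightarrow> j \<le> r \<Longrightarrow> x \<in> A j \<Longrightarrow> (\<Sum>y\<in>A i. lact (transpose x y) f) = rscl (- d) f"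
    and card: "\<And>i. i \<le> r \<Longrightarrow> c \<le> card (A i)"
  shows "\<exists>P col. P \<subseteq> (\<Union>i\<le>r. A i) \<and> (\<forall>i\<le>r. bij_betw col (A i \<inter> P) {..<c}) \<and> alt d P col f \<noteq> 0"
proof -
  define stage where "stage j b \<longleftrightarrow> (\<exists>P col. P \<subseteq> (\<Union>i\<le>j. A i) \<and> (\<forall>i<j. bij_betw col (A i \<inter> P) {..<c}) \<and>
      bij_betw col (A j \<inter> P) {..<b} \<and> alt d P col f \<noteq> 0)" for j b :: nat
  have step: "stage j (Suc b)" if "stage j b" "b < c" and j: "j \<le> r" for j b
  proof -
    obtain P col where P: "P \<subseteq> (\<Union>i\<le>j. A i)" "\<And>i. i < j \<Longrightarrow> bij_betw col (A i \<inter> P) {..<c}"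
      "bij_betw col (A j \<inter> P) {..<b}" "alt d P col f \<noteq> 0" using \<open>stage j b\<close> unfolding stage_def by blast
    have "card (A j \<inter> P) = b" using P(3) bij_betw_same_card by fastforce
    then have "A j \<inter> P \<noteq> A j" using card[OF j] \<open>b < c\<close> by auto
    then obtain x where x: "x \<in> A j" "x \<notin> P" by blast
    obtain b' where b': "b \<le> b'" "b' < c" "alt d (insert x P) (col(x := b')) f \<noteq> 0"
      using alt_extend_step[OF d supp _ _ _ _ P(1,2,3) \<open>b < c\<close> P(4) x] A disj symm hw j by force
    \<comment> \<open>The new cell may have landed in a column \<open>b'\<close> beyond
      \<open>b\<close>. Exchanging the names of \<open>b\<close> and \<open>b'\<close> makes the
      columns of row \<open>j\<close> an initial segment again; as \<open>b \<le> b'\<close>, those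
      already used by row \<open>j\<close> keep their names, and full rows still meet all
      columns.\<close>
    define col' where "col' = transpose b b' \<circ> (col(x := b'))"
    have tr: "bij_betw (transpose b b') {..<c} {..<c}"
      using b' \<open>b < c\<close> by (intro permutes_imp_bij permutes_swap_id) auto
    have "bij_betw col' (A i \<inter> insert x P) {..<c}" if i: "i < j" for i
    proof -
      have "x \<notin> A i" using disj[of i j] i j x by auto
      then have "A i \<inter> insert x P = A i \<inter> P" by auto
      moreover have "bij_betw (col(x := b')) (A i \<inter> P) {..<c}"
      proof -
        have "bij_betw (col(x := b')) (A i \<inter> P) {..<c} = bij_betw col (A i \<inter> P) {..<c}"
          using x by (intro bij_betw_cong) auto
        then show ?thesis using P(2)[OF i] by simp
      qed
      ultimately show ?thesis unfolding col'_def using bij_betw_trans tr by metis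
    qed
    moreover have "bij_betw col' (A j \<inter> insert x P) {..<Suc b}"
    proof -
      have 1: "bij_betw col' (A j \<inter> P) {..<b}"
      proof -
        have "bij_betw (col(x := b')) (A j \<inter> P) {..<b}"
        proof -
          have "bij_betw (col(x := b')) (A j \<inter> P) {..<b} = bij_betw col (A j \<inter> P) {..<b}"
            using x by (intro bij_betw_cong) auto
          then show ?thesis using P(3) by simp
        qed
        moreover have "bij_betw (transpose b b') {..<b} {..<b}"
        proof -
          have "bij_betw (transpose b b') {..<b} {..<b} = bij_betw id {..<b} {..<b}"
            using b' by (intro bij_betw_cong) (auto simp: transpose_def)
          then show ?thesis by simp
        qed
        ultimately show ?thesis unfolding col'_def using bij_betw_trans by metis
      qed
      have 2: "col' x = b" by (simp add: col'_def)
      have "A j \<inter> insert x P = insert x (A j \<inter> P)" using x by auto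
      moreover have "{..<Suc b} = insert b {..<b}" by auto
      ultimately show ?thesis using 1 2 x notIn_Un_bij_betw[of x "A j \<inter> P" col' "{..<b}"] by auto
    qed
    moreover have "alt d (insert x P) col' f \<noteq> 0"
    proof -
      have "alt d (insert x P) col' f = alt d (insert x P) (col(x := b')) f"
        unfolding col'_def by (intro alt_cong) (simp only: o_apply inj_eq[OF bij_is_inj[OF bij_tr]])
      then show ?thesis using b'(3) by simp
    qed
    moreover have "insert x P \<subseteq> (\<Union>i\<le>j. A i)" using P(1) x by auto
    ultimately show ?thesis unfolding stage_def by blast
  qed
  have row: "stage j b" if "stage j 0" "b \<le> c" "j \<le> r" for j b
    using that by (induction b) (auto intro: step)
  have "j \<le> r \<Longrightarrow> stage j c" for j
  proof (induction j)
    case 0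
    have "alt d {} id f = f" by (simp add: alt_def CG_def wt_def)
    then have "stage 0 0" unfolding stage_def using f by (intro exI[of _ "{}"] exI[of _ id]) auto
    then show ?case using row by simp
  next
    case (Suc j)
    then obtain P col where P: "P \<subseteq> (\<Union>i\<le>j. A i)" "\<And>i. i < j \<Longrightarrow> bij_betw col (A i \<inter> P) {..<c}"
      "bij_betw col (A j \<inter> P) {..<c}" "alt d P col f \<noteq> 0" unfolding stage_def by auto
    have "A (Suc j) \<inter> P = {}" 
    proof -
      have "A (Suc j) \<inter> A i = {}" if "i \<le> j" for i using disj[of "Suc j" i] Suc.prems that by simp
      then show ?thesis using P(1) by blast
    qed
    then have 1: "bij_betw col (A (Suc j) \<inter> P) {..<0}" by (simp add: bij_betw_def)
    have 2: "\<forall>i<Suc j. bij_betw col (A i \<inter> P) {..<c}" using P(2,3) by (auto simp: less_Suc_eq)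
    have 3: "P \<subseteq> (\<Union>i\<le>Suc j. A i)" using P(1) unfolding atMost_Suc by blast
    have "stage (Suc j) 0" unfolding stage_def using 1 2 3 P(4) by blast
    then show ?case using row Suc.prems by simp
  qed
  then have "stage r c" by simp
  then obtain P col where P: "P \<subseteq> (\<Union>i\<le>r. A i)" "\<And>i. i < r \<Longrightarrow> bij_betw col (A i \<inter> P) {..<c}"
      "bij_betw col (A r \<inter> P) {..<c}" "alt d P col f \<noteq> 0" unfolding stage_def by auto
  then have "\<forall>i\<le>r. bij_betw col (A i \<inter> P) {..<c}" by (auto simp: le_less)
  then show ?thesis using P by blast
qed

subsection \<open>Maximal configurations\<close>

text \<open>Only transpositions of \<open>X\<close> are demanded, because the notion is also applied
  to the vectors symmetric on the first \<open>n\<close> blocks, which are preserved by permutations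
  of the remaining points but in general not by all permutations.\<close>

definition linear_set :: "((nat \<Rightarrow> nat) \<Rightarrow> real) set \<Rightarrow> nat set \<Rightarrow> bool" where
  "linear_set L X \<longleftrightarrow> (\<forall>f\<in>L. \<forall>g\<in>L. f + g \<in> L) \<and> (\<forall>f\<in>L. \<forall>c. rscl c f \<in> L) \<and> 0 \<in> L \<and>
     (\<forall>f\<in>L. \<forall>x\<in>X. \<forall>y\<in>X. lact (transpose x y) f \<in> L)"

text \<open>A label \<open>lab z < n\<close> puts \<open>z\<close> into block \<open>lab z\<close>, other labels leave it outside all blocks. Moving a point into an
  earlier block increases \<open>\<Sum>z\<in>X. n - lab z\<close>, so its maximality kills all symmetrized extensions of a block.\<close>

definition cfg :: "((nat \<Rightarrow> nat) \<Rightarrow> real) set \<Rightarrow> nat set \<Rightarrow> nat \<Rightarrow> real \<Rightarrow> (nat \<Rightarrow> nat) \<Rightarrow> ((nat \<Rightarrow> nat) \<Rightarrow> real) \<Rightarrow> bool" where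
  "cfg L X n d lab f \<longleftrightarrow> f \<in> L \<and> f \<noteq> 0 \<and> (\<forall>i<n. symm d {z\<in>X. lab z = i} f)"

lemma linear_set_sum: "linear_set L X \<Longrightarrow> (\<And>i. i \<in> I \<Longrightarrow> f i \<in> L) \<Longrightarrow> (\<Sum>i\<in>I. f i) \<in> L"
  by (induction I rule: infinite_finite_induct)
    (simp_all add: linear_set_def del: plus_fun_apply zero_fun_apply)

lemma linear_set_lact_perm:
  assumes L: "linear_set L X" and X: "finite X" and s: "s permutes X" and f: "f \<in> L"
  shows "lact s f \<in> L"
  using s X
proof (induction rule: permutes_induct)
  case (swap a b p)
  then show ?case using L by (simp add: lact_comp permutes_bij linear_set_def del: o_apply)
qed (simp add: f del: id_apply)

text \<open>The eigenvalue relation is asserted for every vector fitting the maximal labelling, not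
  just for the one found: later the vector is replaced while the blocks stay.\<close>

lemma maximal_cfg:
  assumes L: "linear_set L X" and X: "finite X" and d: "d = 1 \<or> d = - 1" and f0: "f0 \<in> L" "f0 \<noteq> 0"
  shows "\<exists>lab f. cfg L X n d lab f \<and>
    (\<forall>lab' f'. cfg L X n d lab' f' \<longrightarrow> (\<Sum>z\<in>X. n - lab' z) \<le> (\<Sum>z\<in>X. n - lab z)) \<and>
    (\<forall>f i x. cfg L X n d lab f \<longrightarrow> i < n \<longrightarrow> x \<in> X \<longrightarrow> i < lab x \<longrightarrow>
       (\<Sum>y\<in>{y\<in>X. lab y = i}. lact (transpose x y) f) = rscl (- d) f)"
proof -
  let ?mu = "\<lambda>lab. \<Sum>z\<in>X. n - lab z"
  have dd: "d * d = 1" using d by auto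
  have 0: "cfg L X n d (\<lambda>_. n) f0" using f0 by (auto simp: cfg_def symm_def)
  have bound: "?mu lab \<le> card X * n" for lab using sum_bounded_above[of X "\<lambda>z. n - lab z" n] by simp
  obtain lab where lab: "\<exists>f. cfg L X n d lab f"
    "\<And>lab'. \<exists>f. cfg L X n d lab' f \<Longrightarrow> ?mu lab' \<le> ?mu lab"
    using ex_has_greatest_nat[of "\<lambda>lab. \<exists>f. cfg L X n d lab f" "\<lambda>_. n" ?mu "Suc (card X * n)"] 0 bound
    by (metis less_Suc_eq_le)
  have "(\<Sum>y\<in>{y\<in>X. lab y = i}. lact (transpose x y) f) = rscl (- d) f"
    if c: "cfg L X n d lab f" and i: "i < n" and x: "x \<in> X" "i < lab x" for f i x
  proof -
    let ?A = "{y\<in>X. lab y = i}"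
    let ?g = "extend d x ?A f" and ?lab = "lab(x := i)"
    have xA: "x \<notin> ?A" using x by auto
    have "?g \<in> L"
    proof -
      have "f \<in> L" using c by (simp add: cfg_def)
      moreover have "(\<Sum>y\<in>?A. rscl d (lact (transpose x y) f)) \<in> L"
        using L x \<open>f \<in> L\<close> by (intro linear_set_sum[OF L]) (simp add: linear_set_def)
      ultimately show ?thesis using L unfolding extend_def by (simp add: linear_set_def del: plus_fun_apply)
    qed
    moreover have "symm d {z\<in>X. ?lab z = k} ?g" if k: "k < n" for k
    proof (cases "k = i")
      case True
      then have "{z\<in>X. ?lab z = k} = insert x ?A" using x by auto
      then show ?thesis using symm_extend[OF d _ xA] X c i by (simp add: cfg_def)
    next
      case False
      \<comment> \<open>The other blocks stay symmetric because \<open>(x y)\<close> fixes their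
        points: \<open>y\<close> lies in block \<open>i\<close>, and \<open>x\<close> has left its
        own block.\<close>
      then have sub: "{z\<in>X. ?lab z = k} \<subseteq> {z\<in>X. lab z = k}" "x \<notin> {z\<in>X. ?lab z = k}" by auto
      then have s: "symm d {z\<in>X. ?lab z = k} f" using c k symm_subset[OF _ sub(1)] unfolding cfg_def by blast
      show ?thesis unfolding extend_def
      proof (intro symm_add[OF s] symm_sum symm_rscl symm_commute[OF s])
        fix y a assume "y \<in> ?A" "a \<in> {z\<in>X. ?lab z = k}"
        then have "a \<noteq> x" "a \<noteq> y" using False sub by auto
        then show "transpose x y a = a" by simp
      qed simp
    qed
    moreover have "?mu ?lab > ?mu lab"
      using x i X by (intro sum_strict_mono_ex1) auto
    ultimately have g: "?g = 0" using lab(2)[of ?lab] leD unfolding cfg_def by blast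
    show ?thesis
    proof
      fix z
      have "?g z = 0" using g by simp
      then have "f z + d * (\<Sum>y\<in>?A. lact (transpose x y) f) z = 0"
        by (simp add: extend_def rsum_apply sum_distrib_left)
      then have "d * (f z + d * (\<Sum>y\<in>?A. lact (transpose x y) f) z) = 0" by (metis mult_zero_right)
      then have "d * f z + (d * d) * (\<Sum>y\<in>?A. lact (transpose x y) f) z = 0" by (simp only: distrib_left mult.assoc)
      then show "(\<Sum>y\<in>?A. lact (transpose x y) f) z = rscl (- d) f z" unfolding dd by simp
    qed
  qed
  then show ?thesis using lab by blast
qed

section \<open>Colourings, filled rectangles and the dichotomy\<close>

definition Kset :: "nat \<Rightarrow> nat \<Rightarrow> nat \<Rightarrow> (nat \<Rightarrow> ix) set" where
  "Kset N n m = ({1..N} \<rightarrow>\<^sub>E Rset n m)"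

definition stabK :: "nat \<Rightarrow> (nat \<Rightarrow> ix) \<Rightarrow> (nat \<Rightarrow> nat) set" where
  "stabK N K = {s \<in> sg N. act s K = K}"

definition rks :: "nat \<Rightarrow> (nat \<Rightarrow> nat) \<Rightarrow> (nat \<Rightarrow> ix) \<Rightarrow> real" where
  "rks N s K = Re (ks N s K)"

lemma of_real_rks: "complex_of_real (rks N s K) = ks N s K"
  using ks_cases[of N s K] by (auto simp: rks_def)

lemma rks_sq: "rks N s K * rks N s K = 1"
  using ks_cases[of N s K] by (auto simp: rks_def)

text \<open>Label-preserving permutations are products of transpositions inside label classes:
  composing \<open>s\<close> with \<open>transpose a (s a)\<close> makes \<open>a\<close> a fixed
  point and creates no new moved point.\<close>

lemma label_induct [consumes 3, case_names id swap]:
  assumes "s permutes S" "finite S" "\<forall>z\<in>S. l (s z) = l z"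
    and id: "P id"
    and swap: "\<And>a b s. a \<in> S \<Longrightarrow> b \<in> S \<Longrightarrow> a \<noteq> b \<Longrightarrow> l a = l b \<Longrightarrow> s permutes S \<Longrightarrow>
      \<forall>z\<in>S. l (s z) = l z \<Longrightarrow> P s \<Longrightarrow> P (transpose a b \<circ> s)"
  shows "P s"
  using assms(1,3)
proof (induction "card {z. s z \<noteq> z}" arbitrary: s rule: less_induct)
  case less
  show ?case
  proof (cases "s = id")
    case False
    then obtain a where a: "s a \<noteq> a" by (auto simp: fun_eq_iff)
    define b where "b = s a"
    have aS: "a \<in> S" using a less.prems(1) permutes_not_in by metis
    have bS: "b \<in> S" using aS permutes_in_image[OF less.prems(1)] by (simp add: b_def)
    have ab: "a \<noteq> b" "l a = l b" using a bspec[OF less.prems(2) aS] by (auto simp: b_def)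
    let ?s = "transpose a b \<circ> s"
    have p: "?s permutes S" using permutes_compose[OF less.prems(1) permutes_swap_id[OF aS bS]] .
    have inj: "s u = s v \<longleftrightarrow> u = v" for u v using permutes_inj[OF less.prems(1)] by (simp add: inj_eq)
    have lab: "l (?s z) = l z" if "z \<in> S" for z
      using bspec[OF less.prems(2) that] ab by (auto simp: transpose_def)
    have fin: "finite {z. s z \<noteq> z}"
      by (rule finite_subset[OF _ assms(2)]) (use less.prems(1) permutes_not_in in fastforce)
    have "{z. ?s z \<noteq> z} \<subseteq> {z. s z \<noteq> z} - {a}"
    proof
      fix z assume z: "z \<in> {z. ?s z \<noteq> z}"
      have "z \<noteq> a" using z by (auto simp: b_def)
      moreover have "s z \<noteq> z"
      proof
        assume e: "s z = z"
        then have "z \<noteq> b" using \<open>z \<noteq> a\<close> inj[of z a] b_def by auto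
        then show False using z e \<open>z \<noteq> a\<close> by simp
      qed
      ultimately show "z \<in> {z. s z \<noteq> z} - {a}" by simp
    qed
    then have "card {z. ?s z \<noteq> z} < card {z. s z \<noteq> z}"
      using fin a by (intro psubset_card_mono) auto
    then have "P ?s" using less.hyps p lab by blast
    then have "P (transpose a b \<circ> ?s)" using swap[OF aS bS ab p] lab by blast
    moreover have "transpose a b \<circ> ?s = s" by (simp add: comp_assoc[symmetric])
    ultimately show ?thesis by metis
  qed (use id in \<open>simp del: id_apply\<close>)
qed

lemma extend_bij_permutes:
  assumes U: "finite U" "S \<subseteq> U" "T \<subseteq> U" and g: "bij_betw g S T"
  shows "\<exists>x. x permutes U \<and> (\<forall>s\<in>S. x s = g s)"
proof -
  have "card (U - S) = card (U - T)"
    using bij_betw_same_card[OF g] U by (simp add: card_Diff_subset finite_subset)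
  then obtain h where h: "bij_betw h (U - S) (U - T)" using finite_same_card_bij U by (metis finite_Diff)
  let ?x = "\<lambda>u. if u \<in> S then g u else if u \<in> U then h u else u"
  have "bij_betw ?x S T" using g by (subst bij_betw_cong[of _ _ g]) auto
  moreover have "bij_betw ?x (U - S) (U - T)" using h by (subst bij_betw_cong[of _ _ h]) auto
  ultimately have "bij_betw ?x (S \<union> (U - S)) (T \<union> (U - T))" by (rule bij_betw_combine) auto
  then have "bij_betw ?x U U" using U by (simp add: Un_absorb1)
  then have "?x permutes U" using U by (intro bij_imp_permutes) auto
  then show ?thesis by auto
qed

lemma conj_permutes:
  assumes "s permutes S" "bij x" shows "x \<circ> s \<circ> inv x permutes x ` S"
proof (rule bij_imp_permutes)
  have xS: "bij_betw x S (x ` S)" using assms(2) by (meson bij_betw_imageI bij_is_inj inj_on_subset subset_UNIV)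
  have "bij_betw (inv x) (x ` S) S"
  proof (rule bij_betw_imageI)
    show "inj_on (inv x) (x ` S)" using bij_is_inj[OF bij_imp_bij_inv[OF assms(2)]] inj_on_subset by blast
    show "inv x ` (x ` S) = S" using bij_is_inj[OF assms(2)] by (simp add: image_inv_f_f)
  qed
  from bij_betw_trans[OF bij_betw_trans[OF this permutes_imp_bij[OF assms(1)]] xS]
  show "bij_betw (x \<circ> s \<circ> inv x) (x ` S) (x ` S)" by (simp add: comp_assoc)
  fix z assume "z \<notin> x ` S"
  then have "inv x z \<notin> S" using assms(2) by (metis bij_inv_eq_iff image_eqI)
  then show "(x \<circ> s \<circ> inv x) z = z" using assms by (simp add: permutes_not_in bij_is_surj surj_f_inv_f)
qed

lemma rscl_nonzero: "c \<noteq> 0 \<Longrightarrow> f \<noteq> 0 \<Longrightarrow> rscl c f \<noteq> 0"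
  by (auto simp: fun_eq_iff)

text \<open>The stabilizer of \<open>K\<close> is generated by transpositions of equal colours, so
  it acts on \<open>f\<close> through the Koszul sign. Every summand then equals \<open>f\<close>,
  and the sum is the order of the stabilizer times \<open>f\<close>.\<close>

lemma color_case:
  assumes f: "f \<noteq> 0" and K: "K \<in> Kset N n m"
    and tr: "\<And>a b. a \<in> {1..N} \<Longrightarrow> b \<in> {1..N} \<Longrightarrow> a \<noteq> b \<Longrightarrow> K a = K b \<Longrightarrow>
      lact (transpose a b) f = rscl (if par_ix (K a) then - 1 else 1) f"
  shows "(\<Sum>s\<in>stabK N K. rscl (rks N s K) (lact (inv s) f)) \<noteq> 0"
proof -
  have fix_iff: "act s K = K \<longleftrightarrow> (\<forall>z\<in>{1..N}. K (s z) = K z)" if "s \<in> sg N" for s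
  proof -
    have p: "s permutes {1..N}" using that by (simp add: sg_def)
    have "act s K = K \<longleftrightarrow> (\<forall>z. K (inv s (s z)) = K (s z))"
      unfolding act_def fun_eq_iff using permutes_surj[OF p] by (metis comp_apply surjD)
    also have "\<dots> \<longleftrightarrow> (\<forall>z. K z = K (s z))" using permutes_inverses[OF p] by simp
    also have "\<dots> \<longleftrightarrow> (\<forall>z\<in>{1..N}. K (s z) = K z)" using permutes_not_in[OF p] by metis
    finally show ?thesis .
  qed
  have main: "lact s f = rscl (rks N s K) f" if s: "s \<in> stabK N K" for s
  proof -
    have sp: "s permutes {1..N}" and sK: "\<forall>z\<in>{1..N}. K (s z) = K z"
      using s fix_iff by (auto simp: stabK_def sg_def)
    from sp finite_atLeastAtMost sK show ?thesis
    proof (induction rule: label_induct)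
      case id
      have "rks N id K = 1" by (simp add: rks_def del: id_apply)
      then show ?case by (simp del: id_apply)
    next
      case (swap a b s)
      have sg: "s \<in> sg N" using swap by (simp add: sg_def)
      have aK: "act s K = K" using fix_iff[OF sg] swap by blast
      have tp: "transpose a b permutes {1..N}" using swap by (intro permutes_swap_id) auto
      have "ks N (transpose a b \<circ> s) K = (if par_ix (K a) then - 1 else 1) * ks N s K"
        using ks_comp[OF tp swap(5), of K] ks_transpose_eq[OF swap(1,2,3)] swap(4) aK by simp
      then have r: "rks N (transpose a b \<circ> s) K = (if par_ix (K a) then - 1 else 1) * rks N s K"
        unfolding rks_def by simp
      have "lact (transpose a b \<circ> s) f = lact (transpose a b) (lact s f)"
        using sg_bij[OF sg] by (simp add: lact_comp del: o_apply)
      also have "\<dots> = rscl (rks N (transpose a b \<circ> s) K) f"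
        unfolding swap(7) lact_rscl r tr[OF swap(1,2,3,4)] by simp
      finally show ?case .
    qed
  qed
  have inv: "lact (inv s) f = rscl (rks N s K) f" if s: "s \<in> stabK N K" for s
  proof -
    have "bij s" "s \<in> sg N" using s sg_bij by (auto simp: stabK_def)
    then have "f = lact (inv s) (lact s f)"
      using lact_comp[of "inv s" s f] sg_inv_o[of s N] by (simp add: bij_imp_bij_inv del: id_apply o_apply)
    also have "\<dots> = rscl (rks N s K) (lact (inv s) f)" unfolding main[OF s] lact_rscl ..
    finally have "rscl (rks N s K) f = rscl (rks N s K) (rscl (rks N s K) (lact (inv s) f))" by metis
    then show ?thesis by (simp add: rks_sq del: rscl_apply)
  qed
  have "(\<Sum>s\<in>stabK N K. rscl (rks N s K) (lact (inv s) f)) = (\<Sum>s\<in>stabK N K. f)"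
    using inv by (intro sum.cong refl) (simp add: rks_sq del: rscl_apply)
  also have "\<dots> = rscl (real (card (stabK N K))) f" by (simp add: fun_eq_iff rsum_apply)
  finally have e: "(\<Sum>s\<in>stabK N K. rscl (rks N s K) (lact (inv s) f)) = rscl (real (card (stabK N K))) f" .
  have "id \<in> stabK N K" "finite (stabK N K)" by (auto simp: stabK_def sg_id simp del: id_apply)
  then have "card (stabK N K) \<noteq> 0" by auto
  then show ?thesis unfolding e using f by (intro rscl_nonzero) auto
qed

text \<open>A permutation \<open>x\<close> carries the cells of \<open>t\<close> to the points of
  \<open>P\<close> according to block and column; \<open>F\<close> is \<open>f\<close> transported
  back. The row group fixes \<open>F\<close>, and \<open>inv (r \<circ> s)\<close> applies
  \<open>inv r\<close> first, so the double sum is the order of the row group times the transported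
  column antisymmetrizer, which is not zero.\<close>

lemma tableau_case:
  assumes t: "standard_tableau n m t" and L: "\<And>s f. s \<in> sg N \<Longrightarrow> f \<in> L \<Longrightarrow> lact s f \<in> L"
    and f: "f \<in> L" and symm: "\<And>i. i \<le> n \<Longrightarrow> symm 1 (A i) f"
    and disj: "\<And>i i'. i \<le> n \<Longrightarrow> i' \<le> n \<Longrightarrow> i \<noteq> i' \<Longrightarrow> A i \<inter> A i' = {}"
    and P: "P \<subseteq> (\<Union>i\<le>n. A i)" "P \<subseteq> {1..N}" and bij: "\<And>i. i \<le> n \<Longrightarrow> bij_betw col (A i \<inter> P) {..<Suc m}"
    and nz: "alt 1 P col f \<noteq> 0"
  shows "Nbox n m \<le> N \<and> (\<exists>F\<in>L. (\<Sum>r\<in>row_stab n m t. \<Sum>s\<in>col_stab n m t.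
      rscl (of_int (sign s)) (lact (inv (r \<circ> s)) F)) \<noteq> 0)"
proof -
  let ?c = "cells n m" and ?B = "{1..Nbox n m}"
  have tb: "bij_betw t ?c ?B" using t by (simp add: standard_tableau_def)
  define y where "y = (\<lambda>(a, b). inv_into (A a \<inter> P) col b)"
  have y: "y (a, b) \<in> A a" "y (a, b) \<in> P" "col (y (a, b)) = b" if "a \<le> n" "b \<le> m" for a b
  proof -
    have "b \<in> col ` (A a \<inter> P)" using bij[OF that(1)] that(2) by (auto simp: bij_betw_def)
    then show "y (a, b) \<in> A a" "y (a, b) \<in> P" "col (y (a, b)) = b"
      using inv_into_into[of b col "A a \<inter> P"] f_inv_into_f[of b col "A a \<inter> P"] by (auto simp: y_def)
  qed
  have cin: "c \<in> ?c \<longleftrightarrow> fst c \<le> n \<and> snd c \<le> m" for c by (cases c) (auto simp: cells_def)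
  have yb: "bij_betw y ?c P"
  proof (rule bij_betw_imageI)
    show "inj_on y ?c"
    proof (rule inj_onI)
      fix c c' assume c: "c \<in> ?c" "c' \<in> ?c" "y c = y c'"
      obtain a b a' b' where e: "c = (a, b)" "c' = (a', b')" by (cases c, cases c')
      have "b = b'" using y(3)[of a b] y(3)[of a' b'] c e by (simp add: cin)
      moreover have "a = a'" using y(1)[of a b] y(1)[of a' b'] c e disj[of a a'] by (auto simp: cin)
      ultimately show "c = c'" using e by simp
    qed
    show "y ` ?c = P"
    proof
      show "y ` ?c \<subseteq> P" using y(2) by (auto simp: cin)
      show "P \<subseteq> y ` ?c"
      proof
        fix p assume p: "p \<in> P"
        then obtain a where a: "a \<le> n" "p \<in> A a" using P(1) by blast
        have "col p < Suc m" using bij_betwE[OF bij[OF a(1)]] a p by auto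
        then have "col p \<le> m" by simp
        moreover have "y (a, col p) = p"
          using bij[OF a(1)] a p by (auto simp: y_def bij_betw_def intro: inv_into_f_f)
        ultimately show "p \<in> y ` ?c" using a by (intro image_eqI[of _ _ "(a, col p)"]) (auto simp: cin)
      qed
    qed
  qed
  have card: "card P = Nbox n m" using bij_betw_same_card[OF yb] by (simp add: cells_def Nbox_def)
  then have NN: "Nbox n m \<le> N" using card_mono[OF _ P(2)] by simp
  have ytb: "bij_betw (y \<circ> inv_into ?c t) ?B P" using bij_betw_trans[OF bij_betw_inv_into[OF tb] yb] .
  have "\<exists>x. x permutes {1..N} \<and> (\<forall>s\<in>?B. x s = (y \<circ> inv_into ?c t) s)"
    using NN by (intro extend_bij_permutes[OF _ _ P(2) ytb]) auto
  then obtain x where x: "x permutes {1..N}" "\<And>s. s \<in> ?B \<Longrightarrow> x s = (y \<circ> inv_into ?c t) s" by blast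
  have xt: "x (t c) = y c" if "c \<in> ?c" for c
    using x(2)[of "t c"] bij_betwE[OF tb] that inv_into_f_f[of t ?c c] tb by (auto simp: bij_betw_def)
  have xB: "x ` ?B = P"
  proof -
    have "x ` ?B = (y \<circ> inv_into ?c t) ` ?B" using x(2) by (intro image_cong) auto
    then show ?thesis using ytb by (simp add: bij_betw_def)
  qed
  have xs: "x \<in> sg N" using x by (simp add: sg_def)
  have bx: "bij x" "bij (inv x)" using sg_bij[OF xs] by (auto intro: bij_imp_bij_inv)
  have xi: "inv x (x z) = z" "x (inv x z) = z" for z using permutes_inverses[OF x(1)] by auto
  have BN: "?B \<subseteq> {1..N}" using NN by auto
  define F where "F = lact (inv x) f"
  have FL: "F \<in> L" unfolding F_def using L sg_inv[OF xs] f by blast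
  have conj: "lact s F = lact (inv x) (lact (x \<circ> s \<circ> inv x) f)" if "bij s" for s
  proof -
    have "s \<circ> inv x = inv x \<circ> (x \<circ> s \<circ> inv x)" using xi by (auto simp: fun_eq_iff)
    moreover have "bij (x \<circ> s \<circ> inv x)" using bx that by (intro bij_comp)
    ultimately show ?thesis unfolding F_def using bx that by (simp only: sg_eq_comp)
  qed
  have Rbij: "bij r" if "r \<in> row_stab n m t" for r using that permutes_bij by (auto simp: row_stab_def)
  have Cbij: "bij s" if "s \<in> col_stab n m t" for s using that permutes_bij by (auto simp: col_stab_def)
  have Rfix: "lact r F = F" if r: "r \<in> row_stab n m t" for r
  proof -
    have rp: "r permutes ?B" using r by (simp add: row_stab_def)
    define l where "l = (\<lambda>p. fst (inv_into ?c y p))"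
    have ly: "l (y c) = fst c" if "c \<in> ?c" for c
      using that yb inv_into_f_f[of y ?c c] by (simp add: l_def bij_betw_def)
    have "x \<circ> r \<circ> inv x permutes P" using conj_permutes[OF rp bx(1)] xB by simp
    moreover have "finite P" using P(2) finite_subset by blast
    moreover have "\<forall>p\<in>P. l ((x \<circ> r \<circ> inv x) p) = l p"
    proof
      fix p assume pP: "p \<in> P"
      obtain c where c: "c \<in> ?c" "p = y c" using yb pP by (auto simp: bij_betw_def)
      then have p: "p = x (t c)" using xt by simp
      obtain b where b: "b \<le> m" "r (t c) = t (fst c, b)" using r c by (auto simp: row_stab_def)
      have cb: "(fst c, b) \<in> ?c" using b c by (auto simp: cin)
      have "(x \<circ> r \<circ> inv x) p = y (fst c, b)" using p xi b xt[OF cb] by simp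
      then show "l ((x \<circ> r \<circ> inv x) p) = l p" using ly[OF cb] ly[OF c(1)] c by simp
    qed
    ultimately have "lact (x \<circ> r \<circ> inv x) f = f"
    proof (induction rule: label_induct)
      case (swap a b s)
      obtain c c' where c: "c \<in> ?c" "a = y c" "c' \<in> ?c" "b = y c'" using yb swap(1,2) by (auto simp: bij_betw_def)
      have fc: "fst c = fst c'" using swap(4) c ly by simp
      have "y c \<in> A (fst c)" "y c' \<in> A (fst c')"
        using c y(1)[of "fst c" "snd c"] y(1)[of "fst c'" "snd c'"] by (auto simp: cin)
      then have "a \<in> A (fst c)" "b \<in> A (fst c)" using c fc by auto
      then have "lact (transpose a b) f = f" using symmD[OF symm[of "fst c"]] swap(3) c by (simp add: cin)
      then show ?case using swap(5,7) permutes_bij[OF swap(5)] by (simp add: lact_comp del: o_apply)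
    qed (simp del: id_apply)
    then show ?thesis using conj[OF Rbij[OF r]] by (simp add: F_def)
  qed
  have Rfix': "lact (inv r) F = F" if r: "r \<in> row_stab n m t" for r
  proof -
    have "lact (inv r) (lact r F) = lact (inv r \<circ> r) F"
      using Rbij[OF r] by (simp add: lact_comp bij_imp_bij_inv del: o_apply)
    also have "inv r \<circ> r = id" using Rbij[OF r] by (simp add: bij_is_inj)
    finally show ?thesis using Rfix[OF r] by (simp del: id_apply)
  qed
  have alt: "(\<Sum>s\<in>col_stab n m t. rscl (of_int (sign s)) (lact (inv s) F)) = lact (inv x) (alt 1 P col f)"
  proof -
    have "(\<Sum>s\<in>col_stab n m t. rscl (of_int (sign s)) (lact (inv s) F))
       = (\<Sum>s\<in>CG P col. rscl (of_int (sign s)) (lact (inv x) (lact s f)))"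
    proof (rule sum.reindex_bij_witness[where j = "\<lambda>s. x \<circ> inv s \<circ> inv x" and i = "\<lambda>s. inv x \<circ> inv s \<circ> x"])
      fix s assume s: "s \<in> col_stab n m t"
      have sp: "s permutes ?B" using s by (simp add: col_stab_def)
      have ib: "bij (inv s)" using Cbij[OF s] by (rule bij_imp_bij_inv)
      have i3: "inv (x \<circ> inv s \<circ> inv x) = x \<circ> s \<circ> inv x"
        using bx Cbij[OF s] ib by (simp add: o_inv_distrib bij_comp inv_inv_eq comp_assoc)
      show "inv x \<circ> inv (x \<circ> inv s \<circ> inv x) \<circ> x = s" unfolding i3 using xi by (auto simp: fun_eq_iff)
      have "x \<circ> s \<circ> inv x permutes P" using conj_permutes[OF sp bx(1)] xB by simp
      moreover have "col ((x \<circ> s \<circ> inv x) p) = col p" if pP: "p \<in> P" for p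
      proof -
        obtain c where c: "c \<in> ?c" "p = y c" using yb pP by (auto simp: bij_betw_def)
        then have p: "p = x (t c)" using xt by simp
        obtain a where a: "a \<le> n" "s (t c) = t (a, snd c)" using s c by (auto simp: col_stab_def)
        have ca: "(a, snd c) \<in> ?c" using a c by (auto simp: cin)
        have "(x \<circ> s \<circ> inv x) p = y (a, snd c)" using p xi a xt[OF ca] by simp
        then show ?thesis using y(3)[of a "snd c"] y(3)[of "fst c" "snd c"] ca c by (simp add: cin)
      qed
      ultimately have "x \<circ> s \<circ> inv x \<in> CG P col" by (simp add: CG_def)
      then have "inv (x \<circ> s \<circ> inv x) \<in> CG P col" by (rule CG_inv)
      moreover have "inv (x \<circ> s \<circ> inv x) = x \<circ> inv s \<circ> inv x" using i3
        by (metis bij_comp bij_imp_bij_inv bx(1) bx(2) ib inv_inv_eq)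
      ultimately show "x \<circ> inv s \<circ> inv x \<in> CG P col" by metis
      have ps: "permutation (inv s)" "permutation s" "permutation x" "permutation (inv x)"
        using sp x(1) permutes_imp_permutation permutes_inv finite_atLeastAtMost by blast+
      have "sign (x \<circ> inv s \<circ> inv x) = sign s"
        using ps by (simp add: sign_compose permutation_compose sign_inverse mult.commute)
      then show "rscl (real_of_int (sign (x \<circ> inv s \<circ> inv x))) (lact (inv x) (lact (x \<circ> inv s \<circ> inv x) f))
          = rscl (real_of_int (sign s)) (lact (inv s) F)"
        using conj[OF ib] by (simp del: o_apply)
    next
      fix s assume s: "s \<in> CG P col"
      have sp: "s permutes P" using s by (simp add: CG_def)
      have sb: "bij s" "bij (inv s)" using CG_bij[OF s] bij_imp_bij_inv by auto
      have i3: "inv (inv x \<circ> inv s \<circ> x) = inv x \<circ> s \<circ> x"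
        using bx sb by (simp add: o_inv_distrib bij_comp inv_inv_eq comp_assoc)
      show "x \<circ> inv (inv x \<circ> inv s \<circ> x) \<circ> inv x = s" unfolding i3 using xi by (auto simp: fun_eq_iff)
      have "inv x ` P = ?B" using xB xi by (force simp: image_iff)
      then have "inv x \<circ> inv s \<circ> inv (inv x) permutes ?B"
        using conj_permutes[OF permutes_inv[OF sp] bx(2)] by simp
      then have p: "inv x \<circ> inv s \<circ> x permutes ?B" using bx(1) by (simp add: inv_inv_eq)
      moreover have "\<exists>a\<le>n. (inv x \<circ> inv s \<circ> x) (t c) = t (a, snd c)" if c: "c \<in> ?c" for c
      proof -
        have pc: "y c \<in> P" using yb c by (auto simp: bij_betw_def)
        have s': "inv s (y c) \<in> P" "col (inv s (y c)) = col (y c)"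
          using CG_inv[OF s] pc permutes_in_image[of "inv s" P] by (auto simp: CG_def)
        obtain c' where c': "c' \<in> ?c" "inv s (y c) = y c'" using yb s'(1) by (auto simp: bij_betw_def)
        have "snd c' = snd c"
          using s'(2) c' y(3)[of "fst c'" "snd c'"] y(3)[of "fst c" "snd c"] c by (simp add: cin)
        moreover have "(inv x \<circ> inv s \<circ> x) (t c) = t c'"
          using xt[OF c] c' xt[OF c'(1)] xi(1)[of "t c'"] by simp
        ultimately show ?thesis using c'(1) by (metis cin prod.collapse)
      qed
      ultimately show "inv x \<circ> inv s \<circ> x \<in> col_stab n m t" by (simp add: col_stab_def)
    qed
    then show ?thesis by (simp add: alt_def wt_def lact_sum lact_rscl)
  qed
  have "(\<Sum>r\<in>row_stab n m t. \<Sum>s\<in>col_stab n m t. rscl (of_int (sign s)) (lact (inv (r \<circ> s)) F))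
     = (\<Sum>r\<in>row_stab n m t. lact (inv x) (alt 1 P col f))"
  proof (rule sum.cong[OF refl])
    fix r assume r: "r \<in> row_stab n m t"
    have "lact (inv (r \<circ> s)) F = lact (inv s) F" if "s \<in> col_stab n m t" for s
      using Rfix'[OF r] Rbij[OF r] Cbij[OF that] by (simp add: o_inv_distrib lact_comp bij_imp_bij_inv del: o_apply)
    then show "(\<Sum>s\<in>col_stab n m t. rscl (of_int (sign s)) (lact (inv (r \<circ> s)) F)) = lact (inv x) (alt 1 P col f)"
      unfolding alt[symmetric] by (intro sum.cong) auto
  qed
  also have "\<dots> = rscl (real (card (row_stab n m t))) (lact (inv x) (alt 1 P col f))"
    by (simp add: fun_eq_iff rsum_apply)
  finally have e: "(\<Sum>r\<in>row_stab n m t. \<Sum>s\<in>col_stab n m t. rscl (of_int (sign s)) (lact (inv (r \<circ> s)) F)) = \<dots>" .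
  have "id \<in> row_stab n m t" by (auto simp: row_stab_def permutes_id cin)
  moreover have "finite (row_stab n m t)"
    by (rule finite_subset[OF _ finite_permutations[of ?B]]) (auto simp: row_stab_def)
  ultimately have c0: "card (row_stab n m t) \<noteq> 0" by auto
  have "lact (inv x) (alt 1 P col f) \<noteq> 0"
  proof
    assume "lact (inv x) (alt 1 P col f) = 0"
    then have "lact x (lact (inv x) (alt 1 P col f)) = lact x 0" by metis
    then have "lact (x \<circ> inv x) (alt 1 P col f) = 0" using bx by (simp only: sg_eq_comp lact_0)
    then show False using nz sg_inv_o(2)[OF xs] by (simp del: id_apply)
  qed
  then have "rscl (real (card (row_stab n m t))) (lact (inv x) (alt 1 P col f)) \<noteq> 0"
    using c0 by (intro rscl_nonzero) auto
  then show ?thesis using NN FL unfolding e[symmetric] by blast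
qed

theorem regular_dichotomy:
  assumes t: "standard_tableau n m t"
    and Llin: "\<And>f g. f \<in> L \<Longrightarrow> g \<in> L \<Longrightarrow> f + g \<in> L" "\<And>c f. f \<in> L \<Longrightarrow> rscl c f \<in> L"
    and Lact: "\<And>s f. s \<in> sg N \<Longrightarrow> f \<in> L \<Longrightarrow> lact s f \<in> L"
    and supp: "\<And>f. f \<in> L \<Longrightarrow> hsupp N f"
    and f0: "f0 \<in> L" "f0 \<noteq> 0"
  shows "(\<exists>K\<in>Kset N n m. \<exists>f\<in>L. (\<Sum>s\<in>stabK N K. rscl (rks N s K) (lact (inv s) f)) \<noteq> 0) \<or>
     (Nbox n m \<le> N \<and> (\<exists>f\<in>L. (\<Sum>r\<in>row_stab n m t. \<Sum>s\<in>col_stab n m t.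
      rscl (of_int (sign s)) (lact (inv (r \<circ> s)) f)) \<noteq> 0))"
proof -
  let ?N = "{1..N}"
  have zero: "0 \<in> L" using Llin(2)[OF f0(1), of 0] by (simp del: zero_fun_apply)
  have lin: "linear_set L ?N"
    unfolding linear_set_def using Llin Lact zero sg_transpose by blast
  obtain lab1 f1 where lab1: "cfg L ?N n 1 lab1 f1"
    "\<And>lab' f'. cfg L ?N n 1 lab' f' \<Longrightarrow> (\<Sum>z\<in>?N. n - lab' z) \<le> (\<Sum>z\<in>?N. n - lab1 z)"
    "\<And>f i x. cfg L ?N n 1 lab1 f \<Longrightarrow> i < n \<Longrightarrow> x \<in> ?N \<Longrightarrow> i < lab1 x \<Longrightarrow>
       (\<Sum>y\<in>{y\<in>?N. lab1 y = i}. lact (transpose x y) f) = rscl (- 1) f"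
    using maximal_cfg[OF lin finite_atLeastAtMost disjI1[OF refl] f0, of n] by blast
  define X where "X = {z\<in>?N. \<not> lab1 z < n}"
  \<comment> \<open>The second maximal choice is made inside this subspace, so that the symmetric
    blocks of the first one survive.\<close>
  define L' where "L' = {f\<in>L. \<forall>i<n. symm 1 {z\<in>?N. lab1 z = i} f}"
  have fX: "finite X" and XN: "X \<subseteq> ?N" by (auto simp: X_def)
  have lin': "linear_set L' X"
    unfolding linear_set_def
  proof (intro conjI ballI allI)
    fix f g assume "f \<in> L'" "g \<in> L'"
    then show "f + g \<in> L'" using Llin(1) symm_add unfolding L'_def by blast
  next
    fix f c assume "f \<in> L'"
    then show "rscl c f \<in> L'" using Llin(2) symm_rscl unfolding L'_def by blast
  next
    show "0 \<in> L'" using zero symm_0 unfolding L'_def by blast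
  next
    fix f x y assume f: "f \<in> L'" and xy: "x \<in> X" "y \<in> X"
    have "symm 1 {z\<in>?N. lab1 z = i} (lact (transpose x y) f)" if "i < n" for i
    proof (rule symm_commute)
      show "symm 1 {z\<in>?N. lab1 z = i} f" using f that by (simp add: L'_def)
      fix a assume "a \<in> {z\<in>?N. lab1 z = i}"
      then have "a \<noteq> x" "a \<noteq> y" using xy that by (auto simp: X_def)
      then show "transpose x y a = a" by simp
    qed simp
    moreover have "lact (transpose x y) f \<in> L"
      using f xy XN Lact sg_transpose unfolding L'_def by blast
    ultimately show "lact (transpose x y) f \<in> L'" by (simp add: L'_def)
  qed
  have f1: "f1 \<in> L'" "f1 \<noteq> 0" using lab1(1) by (auto simp: cfg_def L'_def)
  obtain lab2 f2 where lab2: "cfg L' X m (- 1) lab2 f2"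
    "\<And>f i x. cfg L' X m (- 1) lab2 f \<Longrightarrow> i < m \<Longrightarrow> x \<in> X \<Longrightarrow> i < lab2 x \<Longrightarrow>
       (\<Sum>y\<in>{y\<in>X. lab2 y = i}. lact (transpose x y) f) = rscl (- (- 1)) f"
    using maximal_cfg[OF lin' fX disjI2[OF refl] f1, of m] by blast
  have f2: "f2 \<in> L'" "f2 \<noteq> 0" "\<And>i. i < m \<Longrightarrow> symm (- 1) {z\<in>X. lab2 z = i} f2"
    using lab2(1) by (auto simp: cfg_def)
  have f2L: "f2 \<in> L" "\<And>i. i < n \<Longrightarrow> symm 1 {z\<in>?N. lab1 z = i} f2" using f2(1) by (auto simp: L'_def)
  show ?thesis
  proof (cases "\<forall>z\<in>X. lab2 z < m")
    case True
    \<comment> \<open>Labels start at 0 and indices in \<open>Rset\<close> at 1. Symmetric blocks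
      receive even colours, antisymmetric ones odd colours, matching the Koszul sign of a
      transposition of equal letters.\<close>
    define K where "K = (\<lambda>z\<in>?N. if lab1 z < n then (False, Suc (lab1 z)) else (True, Suc (lab2 z)))"
    have "K z \<in> Rset n m" if "z \<in> ?N" for z
      using True that by (cases "lab1 z < n") (auto simp: K_def Rset_def X_def)
    then have "K \<in> Kset N n m" by (auto simp: Kset_def K_def)
    moreover have "lact (transpose a b) f2 = rscl (if par_ix (K a) then - 1 else 1) f2"
      if ab: "a \<in> ?N" "b \<in> ?N" "a \<noteq> b" "K a = K b" for a b
    proof (cases "lab1 a < n")
      case l: True
      then have "lab1 b = lab1 a" using ab by (auto simp: K_def split: if_splits)
      then show ?thesis using symmD[OF f2L(2)[OF l]] ab l by (simp add: K_def par_ix_def)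
    next
      case l: False
      then have l': "lab2 b = lab2 a" "\<not> lab1 b < n" using ab by (auto simp: K_def split: if_splits)
      then have "a \<in> X" "b \<in> X" using ab l by (auto simp: X_def)
      then show ?thesis using symmD[OF f2(3)[of "lab2 a"]] True ab l l' by (simp add: K_def par_ix_def)
    qed
    ultimately show ?thesis using color_case[OF f2(2)] f2L(1) by blast
  next
    case False
    then obtain x where x: "x \<in> X" "\<not> lab2 x < m" by blast
    \<comment> \<open>The leftover point counts as one further block behind the \<open>m\<close>
      antisymmetric ones. Since \<open>lab2 x\<close> is at least \<open>m\<close>, the eigenvalue
      relations hold for \<open>x\<close> with respect to all of them.\<close>
    define A where "A i = (if i < m then {z\<in>X. lab2 z = i} else {x})" for i
    have hwA: "(\<Sum>y\<in>A i. lact (transpose z y) f2) = rscl (- (- 1)) f2" if "i < j" "j \<le> m" "z \<in> A j" for i j z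
    proof -
      have "z \<in> X" "i < lab2 z" "i < m" using that x by (auto simp: A_def split: if_splits)
      then show ?thesis using lab2(2)[OF lab2(1), of i z] by (simp add: A_def)
    qed
    \<comment> \<open>With \<open>d = - 1\<close> the columns are symmetrized. A single column picks
      one point from each of the \<open>m + 1\<close> blocks.\<close>
    have "\<exists>P col. P \<subseteq> (\<Union>i\<le>m. A i) \<and> (\<forall>i\<le>m. bij_betw col (A i \<inter> P) {..<1}) \<and> alt (- 1) P col f2 \<noteq> 0"
    proof (rule column_arrangement_exists[where N = N and d = "- 1" and r = m and A = A and c = 1])
      show "hsupp N f2" using supp f2L by blast
      show "A i \<subseteq> {1..N}" for i using x by (auto simp: A_def X_def)
      show "A i \<inter> A i' = {}" if "i \<le> m" "i' \<le> m" "i \<noteq> i'" for i i' using that x by (auto simp: A_def)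
      show "symm (- 1) (A i) f2" for i using f2(3) by (auto simp: A_def symm_def)
      \<comment> \<open>An empty block would equate the empty sum with the nonzero vector
        \<open>f2\<close>.\<close>
      show "1 \<le> card (A i)" if "i \<le> m" for i
      proof (rule ccontr)
        assume "\<not> 1 \<le> card (A i)"
        moreover have "finite (A i)" using fX by (auto simp: A_def)
        ultimately have Ai: "A i = {}" by (simp add: not_le)
        then have "i < m" by (auto simp: A_def split: if_splits)
        then have "(\<Sum>y\<in>A i. lact (transpose x y) f2) = rscl 1 f2" using hwA[of i m x] by (simp add: A_def)
        then show False using Ai f2(2) by (simp del: zero_fun_apply)
      qed
    qed (use hwA f2 in auto)
    then obtain P col where P: "P \<subseteq> (\<Union>i\<le>m. A i)" "\<And>i. i \<le> m \<Longrightarrow> bij_betw col (A i \<inter> P) {..<1}"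
      "alt (- 1) P col f2 \<noteq> 0" by blast
    define f3 where "f3 = alt (- 1) P col f2"
    have PX: "P \<subseteq> X"
    proof -
      have "A i \<subseteq> X" for i using x by (auto simp: A_def)
      then show ?thesis using P(1) by blast
    qed
    have fP: "finite P" using PX fX finite_subset by blast
    have col0: "col p = 0" if p: "p \<in> P" for p
    proof -
      obtain i where "i \<le> m" "p \<in> A i" using P(1) p by blast
      then have "col p \<in> {..<1}" using bij_betwE[OF P(2)] p by blast
      then show ?thesis by simp
    qed
    have cardP: "card P = Suc m"
    proof -
      have "P = (\<Union>i\<in>{..m}. A i \<inter> P)" using P(1) by blast
      moreover have "card (\<Union>i\<in>{..m}. A i \<inter> P) = (\<Sum>i\<in>{..m}. card (A i \<inter> P))"
        using fP x by (intro card_UN_disjoint) (auto simp: A_def)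
      moreover have "card (A i \<inter> P) = 1" if "i \<le> m" for i using bij_betw_same_card[OF P(2)[OF that]] by simp
      ultimately show ?thesis by simp
    qed
    have f3L': "f3 \<in> L'"
      unfolding f3_def alt_def
    proof (rule linear_set_sum[OF lin'])
      fix s assume "s \<in> CG P col"
      then have "s permutes X" using permutes_subset[OF _ PX] by (auto simp: CG_def)
      then have "lact s f2 \<in> L'" using linear_set_lact_perm[OF lin' fX _ f2(1)] by blast
      then show "rscl (wt (- 1) s) (lact s f2) \<in> L'" using lin' unfolding linear_set_def by blast
    qed
    then have f3L: "f3 \<in> L" "\<And>i. i < n \<Longrightarrow> symm 1 {z\<in>?N. lab1 z = i} f3" by (auto simp: L'_def)
    have f3nz: "f3 \<noteq> 0" using P(3) by (simp add: f3_def del: zero_fun_apply)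
    have f3P: "symm 1 P f3"
      unfolding symm_def
    proof (intro ballI impI)
      fix a b assume "a \<in> P" "b \<in> P" "a \<noteq> b"
      then have "transpose a b \<in> CG P col" using col0 by (intro CG_transpose) auto
      then show "lact (transpose a b) f3 = rscl 1 f3"
        unfolding f3_def using alt_left[OF fP, of _ col "- 1" f2] by (simp add: wt_def del: rscl_apply)
    qed
    \<comment> \<open>The vector has changed but the labelling has not, so the eigenvalue relations
      of the first maximal choice hold for \<open>f3\<close>.\<close>
    have c3: "cfg L ?N n 1 lab1 f3" using f3L f3nz by (simp add: cfg_def)
    define A' where "A' i = (if i < n then {z\<in>?N. lab1 z = i} else P)" for i
    have cardA': "Suc m \<le> card (A' i)" if i: "i \<le> n" for i
    proof (rule ccontr)
      assume small: "\<not> Suc m \<le> card (A' i)"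
      then have i: "i < n" using i cardP by (auto simp: A'_def split: if_splits)
      let ?B = "{z\<in>?N. lab1 z = i}"
      have B: "card ?B < card P" using small i cardP by (simp add: A'_def)
      \<comment> \<open>The larger set \<open>P\<close> takes over block \<open>i\<close>, and the
        old points of that block are released with label \<open>n\<close>. Points of
        \<open>P\<close> contributed nothing before, so the measure grows by
        \<open>(card P - card ?B) * (n - i)\<close>, against maximality.\<close>
      let ?lab = "\<lambda>z. if z \<in> P then i else if lab1 z = i then n else lab1 z"
      have "symm 1 {z\<in>?N. ?lab z = k} f3" if k: "k < n" for k
      proof (cases "k = i")
        case True
        then have "{z\<in>?N. ?lab z = k} \<subseteq> P" using i by (auto split: if_splits)
        then show ?thesis using f3P symm_subset by blast
      next
        case False
        then have "{z\<in>?N. ?lab z = k} \<subseteq> {z\<in>?N. lab1 z = k}" using k by (auto split: if_splits)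
        then show ?thesis using f3L(2)[OF k] symm_subset by blast
      qed
      then have "cfg L ?N n 1 ?lab f3" using f3L f3nz by (simp add: cfg_def)
      then have le: "(\<Sum>z\<in>?N. n - ?lab z) \<le> (\<Sum>z\<in>?N. n - lab1 z)" by (rule lab1(2))
      have ind: "(\<Sum>z\<in>?N. if z \<in> S then n - i else 0) = card S * (n - i)" if "S \<subseteq> ?N" for S
        using sum.inter_restrict[of ?N "\<lambda>_. n - i" S] that by (simp add: inf.absorb2)
      have "(\<Sum>z\<in>?N. (n - ?lab z) + (if z \<in> ?B then n - i else 0))
          = (\<Sum>z\<in>?N. (n - lab1 z) + (if z \<in> P then n - i else 0))"
        using PX i by (intro sum.cong) (auto simp: X_def)
      then have "(\<Sum>z\<in>?N. n - ?lab z) + card ?B * (n - i) = (\<Sum>z\<in>?N. n - lab1 z) + card P * (n - i)"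
      proof -
        assume e: "(\<Sum>z\<in>?N. (n - ?lab z) + (if z \<in> ?B then n - i else 0))
          = (\<Sum>z\<in>?N. (n - lab1 z) + (if z \<in> P then n - i else 0))"
        have "?B \<subseteq> ?N" "P \<subseteq> ?N" using PX XN by blast+
        from e[unfolded sum.distrib ind[OF this(1)] ind[OF this(2)]] show ?thesis .
      qed
      moreover have "card ?B * (n - i) < card P * (n - i)" using B i by simp
      ultimately show False using le by linarith
    qed
    have "\<exists>P' col'. P' \<subseteq> (\<Union>i\<le>n. A' i) \<and> (\<forall>i\<le>n. bij_betw col' (A' i \<inter> P') {..<Suc m}) \<and> alt 1 P' col' f3 \<noteq> 0"
    proof (rule column_arrangement_exists[where N = N and d = 1 and r = n and A = A' and c = "Suc m"])
      show "hsupp N f3" using supp f3L by blast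
      show "A' i \<subseteq> {1..N}" for i using PX XN by (auto simp: A'_def)
      show "A' i \<inter> A' i' = {}" if "i \<le> n" "i' \<le> n" "i \<noteq> i'" for i i' using that PX by (auto simp: A'_def X_def)
      show "symm 1 (A' i) f3" for i using f3L(2) f3P by (simp add: A'_def)
      show "(\<Sum>y\<in>A' i. lact (transpose z y) f3) = rscl (- 1) f3" if "i < j" "j \<le> n" "z \<in> A' j" for i j z
      proof -
        have "z \<in> ?N" "i < lab1 z" "i < n" using that PX by (auto simp: A'_def X_def split: if_splits)
        then show ?thesis using lab1(3)[OF c3, of i z] by (simp add: A'_def)
      qed
    qed (use cardA' f3nz in auto)
    then obtain P' col' where P': "P' \<subseteq> (\<Union>i\<le>n. A' i)" "\<And>i. i \<le> n \<Longrightarrow> bij_betw col' (A' i \<inter> P') {..<Suc m}"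
      "alt 1 P' col' f3 \<noteq> 0" by blast
    have "P' \<subseteq> ?N" using P'(1) PX XN by (fastforce simp: A'_def split: if_splits)
    then have "Nbox n m \<le> N \<and> (\<exists>f\<in>L. (\<Sum>r\<in>row_stab n m t. \<Sum>s\<in>col_stab n m t.
      rscl (of_int (sign s)) (lact (inv (r \<circ> s)) f)) \<noteq> 0)"
      using f3L f3P P' PX
      by (intro tableau_case[OF t Lact f3L(1), where A = A' and P = P' and col = col']) (auto simp: A'_def X_def)
    then show ?thesis by blast
  qed
qed

section \<open>Duality and the identity of the group algebra\<close>

interpretation rfun: vector_space "rscl :: real \<Rightarrow> ('a \<Rightarrow> real) \<Rightarrow> 'a \<Rightarrow> real"
  by unfold_locales (auto simp: fun_eq_iff algebra_simps)

interpretation rfun_pair: vector_space_pair "rscl :: real \<Rightarrow> ('a \<Rightarrow> real) \<Rightarrow> 'a \<Rightarrow> real" "(*) :: real \<Rightarrow> real \<Rightarrow> real"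
  by unfold_locales (auto simp: algebra_simps)

text \<open>A linear functional vanishing on \<open>B\<close> but not at \<open>g\<close> is
  extended from a basis. All functions concerned live on the finite set \<open>X\<close>, so it is
  the pairing with its values on point masses.\<close>

lemma separating_functional:
  fixes g :: "'a \<Rightarrow> real"
  assumes "finite X" "g \<notin> rfun.span B"
    and supp: "\<And>f x. f \<in> insert g B \<Longrightarrow> x \<notin> X \<Longrightarrow> f x = 0"
  shows "\<exists>v. (\<forall>f\<in>B. (\<Sum>x\<in>X. f x * v x) = 0) \<and> (\<Sum>x\<in>X. g x * v x) \<noteq> 0"
proof -
  obtain B' where B': "B' \<subseteq> B" "rfun.independent B'" "B \<subseteq> rfun.span B'"
    using rfun.maximal_independent_subset[of B] by metis
  have sp: "rfun.span B' = rfun.span B"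
    using B' by (metis rfun.span_eq rfun.span_mono rfun.span_superset order_trans subset_antisym rfun.span_span)
  then have "rfun.independent (insert g B')" using assms(2) B'(2) by (simp add: rfun.independent_insert)
  then obtain h where h: "Vector_Spaces.linear rscl (*) h" "\<And>f. f \<in> insert g B' \<Longrightarrow> h f = (if f = g then 1 else 0)"
    using rfun_pair.linear_independent_extend[of "insert g B'" "\<lambda>f. if f = g then 1 else 0"] by blast
  interpret h: Vector_Spaces.linear rscl "(*)" h by (rule h(1))
  define e where "e x = (\<lambda>z. if z = x then 1 else (0::real))" for x :: 'a
  define v where "v x = h (e x)" for x
  have ev: "h f = (\<Sum>x\<in>X. f x * v x)" if "\<And>x. x \<notin> X \<Longrightarrow> f x = 0" for f
  proof -
    have "f = (\<Sum>x\<in>X. rscl (f x) (e x))"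
    proof
      fix z
      show "f z = (\<Sum>x\<in>X. rscl (f x) (e x)) z"
        using that[of z] assms(1) by (simp add: rsum_apply e_def if_distrib[of "(*) _"] sum.delta cong: if_cong)
    qed
    then have "h f = h (\<Sum>x\<in>X. rscl (f x) (e x))" by (rule arg_cong)
    then show ?thesis by (simp add: h.sum h.scale v_def)
  qed
  have "h f = 0" if "f \<in> B" for f
  proof -
    have "f \<in> rfun.span B'" using that B' by blast
    moreover have "h b = 0" if "b \<in> B'" for b
    proof -
      have "b \<noteq> g" using that assms(2) B'(1) rfun.span_base by blast
      then show ?thesis using h(2) that by simp
    qed
    ultimately show ?thesis by (metis h.eq_0_on_span)
  qed
  then show ?thesis using ev supp h(2)[of g] by (intro exI[of _ v]) (metis insertCI zero_neq_one)
qed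

text \<open>The coefficient functions of all \<open>x h\<^sub>K y\<close> and
  \<open>x e\<^sub>t y\<close>. For \<open>N < Nbox n m\<close> the rectangle does not fit and the
  second family is empty.\<close>

definition bgen :: "nat \<Rightarrow> nat \<Rightarrow> nat \<Rightarrow> (nat \<times> nat \<Rightarrow> nat) \<Rightarrow> ((nat \<Rightarrow> nat) \<Rightarrow> real) set" where
  "bgen N n m t =
     {(\<lambda>z. \<Sum>s\<in>stabK N K. if z = x \<circ> s \<circ> y then rks N s K else 0) | x y K. x \<in> sg N \<and> y \<in> sg N \<and> K \<in> Kset N n m} \<union>
     {(\<lambda>z. \<Sum>r\<in>row_stab n m t. \<Sum>s\<in>col_stab n m t. if z = x \<circ> (r \<circ> s) \<circ> y then of_int (sign s) else 0)
       | x y. x \<in> sg N \<and> y \<in> sg N \<and> Nbox n m \<le> N}"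

lemma stab_sg:
  "s \<in> row_stab n m t \<Longrightarrow> Nbox n m \<le> N \<Longrightarrow> s \<in> sg N"
  "s \<in> col_stab n m t \<Longrightarrow> Nbox n m \<le> N \<Longrightarrow> s \<in> sg N"
  by (auto simp: row_stab_def col_stab_def sg_def intro: permutes_subset)

theorem identity_in_span:
  assumes t: "standard_tableau n m t"
  shows "(\<lambda>z. if z = id then 1 else 0) \<in> rfun.span (bgen N n m t)"
proof (rule ccontr)
  let ?d = "\<lambda>z. if z = id then 1 else (0::real)"
  assume "?d \<notin> rfun.span (bgen N n m t)"
  moreover have "f z = 0" if f: "f \<in> insert ?d (bgen N n m t)" and z: "z \<notin> sg N" for f z
  proof -
    have 1: "z \<noteq> id" using z sg_id by auto
    have 2: "z \<noteq> x \<circ> s \<circ> y" if "x \<in> sg N" "y \<in> sg N" "s \<in> sg N" for x y s using z that sg_comp by blast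
    show ?thesis using f 1 2 unfolding bgen_def
      by (auto simp: stabK_def sg_comp stab_sg intro!: sum.neutral simp del: o_apply)
  qed
  ultimately obtain v where v: "\<And>f. f \<in> bgen N n m t \<Longrightarrow> (\<Sum>x\<in>sg N. f x * v x) = 0"
    "(\<Sum>x\<in>sg N. ?d x * v x) \<noteq> 0" using separating_functional[of "sg N" ?d "bgen N n m t"] by auto
  \<comment> \<open>The orthogonal complement of the span. The factors \<open>x\<close> in
    \<open>bgen\<close> make it stable under left translation; the factors \<open>y\<close> turn
    orthogonality into the vanishing of the whole function to which the adjoint of
    \<open>h\<^sub>K\<close> or \<open>e\<^sub>t\<close> maps it, \<open>y\<close> being the point
    of evaluation.\<close>
  define L where "L = {f. hsupp N f \<and> (\<forall>g\<in>bgen N n m t. (\<Sum>z\<in>sg N. g z * f z) = 0)}"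
  define f0 where "f0 z = (if z \<in> sg N then v z else 0)" for z
  have shift: "(\<Sum>z\<in>sg N. (if z = w then c else 0) * f z) = c * f w" if "w \<in> sg N" for w c and f :: "(nat \<Rightarrow> nat) \<Rightarrow> real"
    using that by (simp add: if_distrib[of "\<lambda>u. u * _"] sum.delta cong: if_cong)
  have K: "(\<Sum>z\<in>sg N. (\<Sum>s\<in>stabK N K. if z = x \<circ> s \<circ> y then rks N s K else 0) * f z)
      = (\<Sum>s\<in>stabK N K. rks N s K * f (x \<circ> s \<circ> y))" if "x \<in> sg N" "y \<in> sg N" for x y K f
    unfolding sum_distrib_right
    by (rule trans[OF sum.swap], intro sum.cong refl shift sg_comp) (use that in \<open>auto simp: stabK_def\<close>)
  have T: "(\<Sum>z\<in>sg N. (\<Sum>r\<in>row_stab n m t. \<Sum>s\<in>col_stab n m t. if z = x \<circ> (r \<circ> s) \<circ> y then of_int (sign s) else 0) * f z)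
      = (\<Sum>r\<in>row_stab n m t. \<Sum>s\<in>col_stab n m t. of_int (sign s) * f (x \<circ> (r \<circ> s) \<circ> y))"
    if "x \<in> sg N" "y \<in> sg N" "Nbox n m \<le> N" for x y and f :: "(nat \<Rightarrow> nat) \<Rightarrow> real"
    unfolding sum_distrib_right
    by (rule trans[OF sum.swap], rule sum.cong[OF refl], rule trans[OF sum.swap], rule sum.cong[OF refl],
        intro shift sg_comp) (use that stab_sg in auto)
  have LK: "(\<Sum>s\<in>stabK N K. rks N s K * f (x \<circ> s \<circ> y)) = 0"
    if "f \<in> L" "x \<in> sg N" "y \<in> sg N" "K \<in> Kset N n m" for f x y K
  proof -
    have "(\<lambda>z. \<Sum>s\<in>stabK N K. if z = x \<circ> s \<circ> y then rks N s K else 0) \<in> bgen N n m t"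
      unfolding bgen_def using that by blast
    then show ?thesis using that(1) K[OF that(2,3), of K f] unfolding L_def by auto
  qed
  have LT: "(\<Sum>r\<in>row_stab n m t. \<Sum>s\<in>col_stab n m t. of_int (sign s) * f (x \<circ> (r \<circ> s) \<circ> y)) = 0"
    if "f \<in> L" "x \<in> sg N" "y \<in> sg N" "Nbox n m \<le> N" for f x y
  proof -
    have "(\<lambda>z. \<Sum>r\<in>row_stab n m t. \<Sum>s\<in>col_stab n m t. if z = x \<circ> (r \<circ> s) \<circ> y then of_int (sign s) else 0) \<in> bgen N n m t"
      unfolding bgen_def using that by blast
    then show ?thesis using that(1) T[OF that(2,3,4), of f] unfolding L_def by auto
  qed
  have LI: "f \<in> L" if "hsupp N f"
    "\<And>x y K. x \<in> sg N \<Longrightarrow> y \<in> sg N \<Longrightarrow> K \<in> Kset N n m \<Longrightarrow> (\<Sum>s\<in>stabK N K. rks N s K * f (x \<circ> s \<circ> y)) = 0"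
    "\<And>x y. x \<in> sg N \<Longrightarrow> y \<in> sg N \<Longrightarrow> Nbox n m \<le> N \<Longrightarrow>
      (\<Sum>r\<in>row_stab n m t. \<Sum>s\<in>col_stab n m t. of_int (sign s) * f (x \<circ> (r \<circ> s) \<circ> y)) = 0" for f
    unfolding L_def bgen_def using that K T by auto
  have f0L: "f0 \<in> L"
  proof -
    have "(\<Sum>z\<in>sg N. g z * f0 z) = 0" if "g \<in> bgen N n m t" for g
      using v(1)[OF that] by (simp add: f0_def cong: sum.cong)
    then show ?thesis by (simp add: L_def hsupp_def f0_def)
  qed
  have f0nz: "f0 \<noteq> 0"
  proof
    assume "f0 = 0"
    then have "v id = 0" using sg_id[of N] by (auto simp: f0_def fun_eq_iff dest: spec[of _ id] split: if_splits)
    then show False using v(2) by (auto intro!: sum.neutral)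
  qed
  have Ladd: "f + g \<in> L" if "f \<in> L" "g \<in> L" for f g
    using that by (auto simp: L_def hsupp_add distrib_left sum.distrib)
  have Lscl: "rscl c f \<in> L" if "f \<in> L" for c f
  proof -
    have "(\<Sum>z\<in>sg N. g z * rscl c f z) = c * (\<Sum>z\<in>sg N. g z * f z)" for g
      unfolding sum_distrib_left by (rule sum.cong) auto
    then show ?thesis using that by (simp add: L_def hsupp_rscl del: rscl_apply)
  qed
  have Lsupp: "hsupp N f" if "f \<in> L" for f using that by (simp add: L_def)
  have Lact: "lact u f \<in> L" if u: "u \<in> sg N" and f: "f \<in> L" for u f
    proof (rule LI)
      show "hsupp N (lact u f)" using hsupp_lact[OF u] f by (simp add: L_def)
      show "(\<Sum>s\<in>stabK N K. rks N s K * lact u f (x \<circ> s \<circ> y)) = 0"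
        if "x \<in> sg N" "y \<in> sg N" "K \<in> Kset N n m" for x y K
        using LK[OF f sg_comp[OF sg_inv[OF u] that(1)] that(2,3)] by (simp add: lact_def comp_assoc)
      show "(\<Sum>r\<in>row_stab n m t. \<Sum>s\<in>col_stab n m t. of_int (sign s) * lact u f (x \<circ> (r \<circ> s) \<circ> y)) = 0"
        if "x \<in> sg N" "y \<in> sg N" "Nbox n m \<le> N" for x y
        using LT[OF f sg_comp[OF sg_inv[OF u] that(1)] that(2,3)] by (simp add: lact_def comp_assoc)
    qed
  have "(\<exists>K\<in>Kset N n m. \<exists>f\<in>L. (\<Sum>s\<in>stabK N K. rscl (rks N s K) (lact (inv s) f)) \<noteq> 0) \<or>
     (Nbox n m \<le> N \<and> (\<exists>f\<in>L. (\<Sum>r\<in>row_stab n m t. \<Sum>s\<in>col_stab n m t.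
      rscl (of_int (sign s)) (lact (inv (r \<circ> s)) f)) \<noteq> 0))"
    by (rule regular_dichotomy[OF t _ _ _ _ f0L f0nz]) (use Ladd Lscl Lact Lsupp in blast)+
  then show False
  proof (elim disjE)
    assume "\<exists>K\<in>Kset N n m. \<exists>f\<in>L. (\<Sum>s\<in>stabK N K. rscl (rks N s K) (lact (inv s) f)) \<noteq> 0"
    then obtain K f where Kf: "K \<in> Kset N n m" "f \<in> L" "(\<Sum>s\<in>stabK N K. rscl (rks N s K) (lact (inv s) f)) \<noteq> 0" by blast
    have ii: "inv (inv s) = s" if "s \<in> stabK N K" for s
      using that sg_bij by (auto simp: stabK_def inv_inv_eq)
    have "(\<Sum>s\<in>stabK N K. rscl (rks N s K) (lact (inv s) f)) z = 0" for z
    proof (cases "z \<in> sg N")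
      case True
      then show ?thesis using LK[OF Kf(2) sg_id True Kf(1)] by (simp add: rsum_apply lact_def ii cong: sum.cong)
    next
      case False
      have "hsupp N (\<Sum>s\<in>stabK N K. rscl (rks N s K) (lact (inv s) f))"
        using Kf(2) by (intro hsupp_sum hsupp_rscl hsupp_lact sg_inv) (auto simp: L_def stabK_def)
      then show ?thesis using False by (simp add: hsupp_def)
    qed
    then show False using Kf(3) by (auto simp: fun_eq_iff)
  next
    assume "Nbox n m \<le> N \<and> (\<exists>f\<in>L. (\<Sum>r\<in>row_stab n m t. \<Sum>s\<in>col_stab n m t.
        rscl (real_of_int (sign s)) (lact (inv (r \<circ> s)) f)) \<noteq> 0)"
    then obtain f where NN: "Nbox n m \<le> N" and f: "f \<in> L" "(\<Sum>r\<in>row_stab n m t. \<Sum>s\<in>col_stab n m t.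
        rscl (real_of_int (sign s)) (lact (inv (r \<circ> s)) f)) \<noteq> 0" by blast
    have rs: "r \<circ> s \<in> sg N" if "r \<in> row_stab n m t" "s \<in> col_stab n m t" for r s
      using that stab_sg NN sg_comp by blast
    have ii: "inv (inv (r \<circ> s)) = r \<circ> s" if "r \<in> row_stab n m t" "s \<in> col_stab n m t" for r s
      using sg_bij[OF rs[OF that]] by (simp add: inv_inv_eq del: o_apply)
    have "(\<Sum>r\<in>row_stab n m t. \<Sum>s\<in>col_stab n m t. rscl (real_of_int (sign s)) (lact (inv (r \<circ> s)) f)) z = 0" for z
    proof (cases "z \<in> sg N")
      case True
      then show ?thesis using LT[OF f(1) sg_id True NN] by (simp add: rsum_apply lact_def ii del: o_apply cong: sum.cong)
    next
      case False
      have "hsupp N (\<Sum>r\<in>row_stab n m t. \<Sum>s\<in>col_stab n m t. rscl (real_of_int (sign s)) (lact (inv (r \<circ> s)) f))"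
        using f(1) rs by (intro hsupp_sum hsupp_rscl hsupp_lact sg_inv) (auto simp: L_def)
      then show ?thesis using False by (simp add: hsupp_def)
    qed
    then show False using f(2) by (auto simp: fun_eq_iff)
  qed
qed

subsection \<open>Straightening\<close>

text \<open>The lines are either the columns of the tableau, with \<open>chi\<close> the Koszul sign times the sign character, or its rows, with
  \<open>chi\<close> the Koszul sign. A letter satisfying \<open>neg\<close> that is repeated in a line makes \<open>F\<close> vanish.\<close>

locale straightening =
  fixes N B M :: nat and y :: "nat \<Rightarrow> nat \<Rightarrow> nat" and ln ps :: "nat \<Rightarrow> nat"
    and chi :: "(nat \<Rightarrow> nat) \<Rightarrow> (nat \<Rightarrow> ix) \<Rightarrow> complex" and neg :: "ix \<Rightarrow> bool"
    and Y :: "(nat \<Rightarrow> ix) \<Rightarrow> 'c \<Rightarrow> complex"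
  assumes cell: "\<And>b i. b \<le> B \<Longrightarrow> i \<le> M \<Longrightarrow> y b i \<in> {1..N} \<and> ln (y b i) = b \<and> ps (y b i) = i"
    and pos: "\<And>p. p \<in> {1..N} \<Longrightarrow> ln p \<le> B \<and> ps p \<le> M \<and> y (ln p) (ps p) = p"
    and chi_comp: "\<And>s t I. s \<in> sg N \<Longrightarrow> t \<in> sg N \<Longrightarrow> chi (s \<circ> t) I = chi s (act t I) * chi t I"
    and chi_sq: "\<And>s I. chi s I * chi s I = 1"
    and chi_transpose: "\<And>a b I. a \<in> {1..N} \<Longrightarrow> b \<in> {1..N} \<Longrightarrow> a \<noteq> b \<Longrightarrow> I a = I b \<Longrightarrow>
        chi (transpose a b) I = (if neg (I a) then - 1 else 1)"
begin

definition In where "In = {s \<in> sg N. \<forall>p\<in>{1..N}. ln (s p) = ln p}"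
definition Out where "Out = {s \<in> sg N. \<forall>p\<in>{1..N}. ps (s p) = ps p}"

text \<open>In both applications this is the action of the Young symmetrizer of the rectangle or its
  reverse. If the lines are the columns, \<open>chi\<close> contains the sign of \<open>g\<close>
  and the explicit \<open>sign g\<close> removes it from the rows; if they are the rows,
  \<open>sign g\<close> supplies the sign of the columns.\<close>

definition F :: "(nat \<Rightarrow> ix) \<Rightarrow> 'c \<Rightarrow> complex" where
  "F I = (\<Sum>g\<in>Out. \<Sum>h\<in>In. scl (of_int (sign g) * chi (g \<circ> h) I) (Y (act (g \<circ> h) I)))"

lemma sg_in: "s \<in> sg N \<Longrightarrow> s p \<in> {1..N} \<longleftrightarrow> p \<in> {1..N}"
  using permutes_in_image[of s "{1..N}" p] by (simp add: sg_def)

lemma In_sg: "s \<in> In \<Longrightarrow> s \<in> sg N" and Out_sg: "s \<in> Out \<Longrightarrow> s \<in> sg N"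
  by (auto simp: In_def Out_def)

lemma In_comp: "s \<in> In \<Longrightarrow> t \<in> In \<Longrightarrow> s \<circ> t \<in> In"
  unfolding In_def using sg_comp sg_in by auto

lemma In_inv: assumes "s \<in> In" shows "inv s \<in> In"
proof -
  have s: "s \<in> sg N" using assms by (rule In_sg)
  have "ln (inv s p) = ln p" if "p \<in> {1..N}" for p
  proof -
    have "inv s p \<in> {1..N}" using sg_in[OF sg_inv[OF s]] that by blast
    then have "ln (s (inv s p)) = ln (inv s p)" using assms by (simp add: In_def)
    moreover have "s (inv s p) = p" using s permutes_inverses by (auto simp: sg_def)
    ultimately show ?thesis by simp
  qed
  then show ?thesis using sg_inv[OF s] by (simp add: In_def)
qed

lemma sg_act: "s \<in> sg N \<Longrightarrow> t \<in> sg N \<Longrightarrow> act (s \<circ> t) I = act s (act t I)"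
  by (rule act_comp) (auto simp: sg_def)

lemma F_In: assumes t: "t \<in> In" shows "scl (chi t I) (F (act t I)) = F I"
proof -
  have ts: "t \<in> sg N" using t by (rule In_sg)
  have "scl (chi t I) (F (act t I)) = (\<Sum>g\<in>Out. \<Sum>h\<in>In.
      scl (of_int (sign g) * chi (g \<circ> (h \<circ> t)) I) (Y (act (g \<circ> (h \<circ> t)) I)))"
    unfolding F_def scl_sum
  proof (intro sum.cong refl)
    fix g h assume g: "g \<in> Out" and h: "h \<in> In"
    have gh: "g \<circ> h \<in> sg N" using g h In_sg Out_sg sg_comp by blast
    have "chi (g \<circ> (h \<circ> t)) I = chi (g \<circ> h) (act t I) * chi t I"
      using chi_comp[OF gh ts] by (simp add: comp_assoc)
    moreover have "act (g \<circ> (h \<circ> t)) I = act (g \<circ> h) (act t I)"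
      using sg_act[OF gh ts] by (simp add: comp_assoc)
    ultimately show "scl (chi t I) (scl (of_int (sign g) * chi (g \<circ> h) (act t I)) (Y (act (g \<circ> h) (act t I))))
       = scl (of_int (sign g) * chi (g \<circ> (h \<circ> t)) I) (Y (act (g \<circ> (h \<circ> t)) I))"
      by (simp add: algebra_simps del: o_apply scl_apply)
  qed
  also have "\<dots> = F I" unfolding F_def
  proof (rule sum.cong[OF refl])
    fix g
    show "(\<Sum>h\<in>In. scl (of_int (sign g) * chi (g \<circ> (h \<circ> t)) I) (Y (act (g \<circ> (h \<circ> t)) I)))
      = (\<Sum>h\<in>In. scl (of_int (sign g) * chi (g \<circ> h) I) (Y (act (g \<circ> h) I)))"
    proof (rule sum.reindex_bij_witness[where j = "\<lambda>h. h \<circ> t" and i = "\<lambda>h. h \<circ> inv t"])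
      show "h \<circ> t \<circ> inv t = h" "h \<circ> inv t \<circ> t = h" for h :: "nat \<Rightarrow> nat"
        by (simp_all only: comp_assoc sg_inv_o[OF ts] comp_id)
    qed (use t In_comp In_inv in auto)
  qed
  finally show ?thesis .
qed

text \<open>The end of line \<open>b\<close> from place \<open>i\<close> on and the beginning of
  line \<open>b + 1\<close> up to place \<open>i\<close>: \<open>M + 2\<close> cells, one more than
  there are places.\<close>

definition garnir :: "nat \<Rightarrow> nat \<Rightarrow> nat set" where
  "garnir b i = y b ` {i..M} \<union> y (Suc b) ` {..i}"

lemma garnir_facts:
  assumes "b < B" "i \<le> M"
  shows "garnir b i \<subseteq> {1..N}" "card (garnir b i) = Suc (Suc M)" "finite (garnir b i)"
proof -
  show s: "garnir b i \<subseteq> {1..N}" using cell[of b] cell[of "Suc b"] assms by (auto simp: garnir_def)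
  show "finite (garnir b i)" by (simp add: garnir_def)
  have inj: "inj_on (y b') {..M}" if "b' \<le> B" for b'
    by (rule inj_onI) (metis atMost_iff cell that)
  have "y b ` {i..M} \<inter> y (Suc b) ` {..i} = {}"
  proof -
    have "ln p = b" if "p \<in> y b ` {i..M}" for p using that cell[of b] assms by auto
    moreover have "ln p = Suc b" if "p \<in> y (Suc b) ` {..i}" for p using that cell[of "Suc b"] assms by auto
    ultimately show ?thesis by fastforce
  qed
  then have "card (garnir b i) = card (y b ` {i..M}) + card (y (Suc b) ` {..i})"
    unfolding garnir_def by (intro card_Un_disjoint) auto
  moreover have "card (y b ` {i..M}) = Suc M - i"
    using inj_on_subset[OF inj[of b]] assms by (subst card_image) auto
  moreover have "card (y (Suc b) ` {..i}) = Suc i"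
    using inj_on_subset[OF inj[of "Suc b"]] assms by (subst card_image) auto
  ultimately show "card (garnir b i) = Suc (Suc M)" using assms by simp
qed

text \<open>For each \<open>h\<close> the pigeonhole principle gives two points of \<open>X\<close>
  with \<open>h p\<close> and \<open>h q\<close> at the same place. The transposition
  \<open>?u\<close> of these images lies in \<open>Out\<close>, and the involution sending
  \<open>(r, g)\<close> to \<open>(?t \<circ> r, g \<circ> ?u)\<close> keeps
  \<open>g \<circ> h \<circ> r\<close> but reverses \<open>sign g\<close>.\<close>

lemma F_garnir:
  assumes X: "X \<subseteq> {1..N}" "card X > Suc M"
  shows "(\<Sum>r\<in>{r. r permutes X}. scl (chi r I) (F (act r I))) = 0"
proof -
  have fX: "finite X" using X(1) finite_subset by blast
  have rs: "r \<in> sg N" if "r permutes X" for r using permutes_subset[OF that X(1)] by (simp add: sg_def)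
  let ?G = "{r. r permutes X}"
  have "(\<Sum>r\<in>?G. scl (chi r I) (F (act r I)))
     = (\<Sum>r\<in>?G. \<Sum>h\<in>In. \<Sum>g\<in>Out. scl (of_int (sign g) * chi (g \<circ> h \<circ> r) I) (Y (act (g \<circ> h \<circ> r) I)))"
    unfolding F_def scl_sum
  proof (rule sum.cong[OF refl], rule trans[OF sum.swap], intro sum.cong refl)
    fix r g h assume r: "r \<in> ?G" and h: "h \<in> In" and g: "g \<in> Out"
    have gh: "g \<circ> h \<in> sg N" using g h In_sg Out_sg sg_comp by blast
    have rr: "r \<in> sg N" using r rs by simp
    show "scl (chi r I) (scl (of_int (sign g) * chi (g \<circ> h) (act r I)) (Y (act (g \<circ> h) (act r I))))
       = scl (of_int (sign g) * chi (g \<circ> h \<circ> r) I) (Y (act (g \<circ> h \<circ> r) I))"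
      using chi_comp[OF gh rr] sg_act[OF gh rr] by (simp add: algebra_simps del: o_apply scl_apply)
  qed
  also have "\<dots> = (\<Sum>h\<in>In. \<Sum>r\<in>?G. \<Sum>g\<in>Out. scl (of_int (sign g) * chi (g \<circ> h \<circ> r) I) (Y (act (g \<circ> h \<circ> r) I)))"
    by (rule sum.swap)
  also have "\<dots> = 0"
  proof (rule sum.neutral, rule ballI)
    fix h assume h: "h \<in> In"
    have hs: "h \<in> sg N" using h by (rule In_sg)
    have "card ((\<lambda>p. ps (h p)) ` X) < card X"
    proof -
      have "(\<lambda>p. ps (h p)) ` X \<subseteq> {..M}" using X(1) pos sg_in[OF hs] by auto
      then have "card ((\<lambda>p. ps (h p)) ` X) \<le> Suc M" using card_mono[of "{..M}"] by fastforce
      then show ?thesis using X(2) by simp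
    qed
    then have "\<not> inj_on (\<lambda>p. ps (h p)) X" using pigeonhole by blast
    then obtain p q where pq: "p \<in> X" "q \<in> X" "p \<noteq> q" "ps (h p) = ps (h q)" by (auto simp: inj_on_def)
    let ?t = "transpose p q" and ?u = "transpose (h p) (h q)"
    have hpq: "h p \<in> {1..N}" "h q \<in> {1..N}" using pq X(1) sg_in[OF hs] by blast+
    have us: "?u \<in> sg N" using hpq by (rule sg_transpose)
    have uO: "?u \<in> Out" using us pq(4) by (auto simp: Out_def transpose_def)
    have hne: "h p \<noteq> h q" using pq(3) sg_bij[OF hs] by (auto simp: bij_def inj_def)
    have gO: "g \<circ> ?u \<in> Out" if g: "g \<in> Out" for g
      using g uO sg_comp sg_in[OF us] by (auto simp: Out_def)
    have tG: "?t \<circ> r \<in> ?G" if "r \<in> ?G" for r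
      using that permutes_compose[OF _ permutes_swap_id[OF pq(1,2)]] by simp
    define T where "T = (\<lambda>(r, g). scl (of_int (sign g) * chi (g \<circ> h \<circ> r) I) (Y (act (g \<circ> h \<circ> r) I)))"
    have "(\<Sum>r\<in>?G. \<Sum>g\<in>Out. scl (of_int (sign g) * chi (g \<circ> h \<circ> r) I) (Y (act (g \<circ> h \<circ> r) I))) = sum T (?G \<times> Out)"
      by (simp add: sum.cartesian_product T_def)
    moreover have "sum T (?G \<times> Out) = (\<Sum>x\<in>?G \<times> Out. scl (- 1) (T x))"
    proof (rule sum.reindex_bij_witness[where i = "\<lambda>(r, g). (?t \<circ> r, g \<circ> ?u)" and j = "\<lambda>(r, g). (?t \<circ> r, g \<circ> ?u)"])
      fix x assume x: "x \<in> ?G \<times> Out"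
      obtain r g where rg: "x = (r, g)" "r \<in> ?G" "g \<in> Out" using x by auto
      have inv: "?t \<circ> (?t \<circ> r) = r" "g \<circ> ?u \<circ> ?u = g"
        by (simp_all add: comp_assoc[symmetric]) (simp add: comp_assoc)
      then show "(case case x of (r, g) \<Rightarrow> (?t \<circ> r, g \<circ> ?u) of (r, g) \<Rightarrow> (?t \<circ> r, g \<circ> ?u)) = x" using rg by simp
      then show "(case case x of (r, g) \<Rightarrow> (?t \<circ> r, g \<circ> ?u) of (r, g) \<Rightarrow> (?t \<circ> r, g \<circ> ?u)) = x" .
      show "(case x of (r, g) \<Rightarrow> (?t \<circ> r, g \<circ> ?u)) \<in> ?G \<times> Out" using gO[OF rg(3)] tG[OF rg(2)] unfolding rg(1) by (simp del: o_apply)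
      then show "(case x of (r, g) \<Rightarrow> (?t \<circ> r, g \<circ> ?u)) \<in> ?G \<times> Out" .
      have ht: "?u \<circ> h = h \<circ> ?t" using conj_transpose[OF sg_bij[OF hs], of p q] by simp
      have "g \<circ> ?u \<circ> h \<circ> (?t \<circ> r) = g \<circ> (?u \<circ> h) \<circ> ?t \<circ> r" by (simp add: comp_assoc)
      also have "\<dots> = g \<circ> h \<circ> (?t \<circ> ?t) \<circ> r" unfolding ht by (simp add: comp_assoc)
      finally have e: "g \<circ> ?u \<circ> h \<circ> (?t \<circ> r) = g \<circ> h \<circ> r" by simp
      have pg: "permutation g" using Out_sg[OF rg(3)] permutes_imp_permutation by (auto simp: sg_def)
      have "sign (g \<circ> ?u) = - sign g"
        using sign_compose[OF pg permutation_swap_id] hne by (simp add: sign_swap_id)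
      then show "scl (- 1) (T (case x of (r, g) \<Rightarrow> (?t \<circ> r, g \<circ> ?u))) = T x"
        unfolding rg T_def by (simp add: e del: o_apply scl_apply)
    qed
    moreover have "(\<Sum>x\<in>?G \<times> Out. scl (- 1) (T x)) = scl (- 1) (sum T (?G \<times> Out))"
      by (simp add: scl_sum)
    ultimately have "sum T (?G \<times> Out) = scl (- 1) (sum T (?G \<times> Out))" by metis
    then have "sum T (?G \<times> Out) = 0" by (auto simp: fun_eq_iff)
    then show "(\<Sum>r\<in>?G. \<Sum>g\<in>Out. scl (of_int (sign g) * chi (g \<circ> h \<circ> r) I) (Y (act (g \<circ> h \<circ> r) I))) = 0"
      by (simp add: sum.cartesian_product T_def)
  qed
  finally show ?thesis .
qed

lemma card_exchange:
  assumes "finite X1" "finite X2" "X1 \<inter> X2 = {}" and r: "r permutes X1 \<union> X2"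
  shows "card {p\<in>X1. r p \<in> X2} = card {p\<in>X2. r p \<in> X1}"
proof -
  let ?U = "{p\<in>X1. r p \<in> X2}" and ?V = "{p\<in>X2. r p \<in> X1}"
  have rX: "r p \<in> X1 \<union> X2 \<longleftrightarrow> p \<in> X1 \<union> X2" for p using permutes_in_image[OF r] .
  have "r ` (?U \<union> (X2 - ?V)) = X2"
  proof
    show "r ` (?U \<union> (X2 - ?V)) \<subseteq> X2" using rX by blast
    show "X2 \<subseteq> r ` (?U \<union> (X2 - ?V))"
    proof
      fix q assume q: "q \<in> X2"
      then obtain p where p: "q = r p" using permutes_surj[OF r] by blast
      then have "p \<in> X1 \<union> X2" using q rX by blast
      then show "q \<in> r ` (?U \<union> (X2 - ?V))" using p q assms(3) by blast
    qed
  qed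
  then have "card X2 = card (?U \<union> (X2 - ?V))"
    using card_image[OF inj_on_subset[OF permutes_inj[OF r] subset_UNIV]] by metis
  also have "\<dots> = card ?U + card (X2 - ?V)" using assms by (intro card_Un_disjoint) auto
  also have "card (X2 - ?V) = card X2 - card ?V" using assms by (intro card_Diff_subset) auto
  finally show ?thesis using card_mono[of X2 ?V] assms by auto
qed

lemma act_transpose_eq: "I a = I b \<Longrightarrow> act (transpose a b) I = I"
  by (auto simp: act_def fun_eq_iff transpose_def)

text \<open>Induction on the number of points crossing from the first line to the second.
  Precomposing with the transposition of two crossing points changes neither sequence nor sign,
  since both carry the letter \<open>z\<close>, and removes one crossing; without crossings
  \<open>r\<close> lies in \<open>In\<close>.\<close>

lemma F_exchange_equal:
  assumes X: "X1 \<union> X2 \<subseteq> {1..N}" "X1 \<inter> X2 = {}"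
    and l: "\<And>p. p \<in> X1 \<Longrightarrow> ln p = b" "\<And>p. p \<in> X2 \<Longrightarrow> ln p = Suc b"
    and z: "\<not> neg z"
    and r: "r permutes X1 \<union> X2"
    and U: "\<And>p. p \<in> X1 \<Longrightarrow> r p \<in> X2 \<Longrightarrow> I p = z" and V: "\<And>p. p \<in> X2 \<Longrightarrow> r p \<in> X1 \<Longrightarrow> I p = z"
  shows "scl (chi r I) (F (act r I)) = F I"
  using r U V
proof (induction "card {p\<in>X1. r p \<in> X2}" arbitrary: r rule: less_induct)
  case less
  let ?U = "\<lambda>r. {p\<in>X1. r p \<in> X2}" and ?V = "\<lambda>r. {p\<in>X2. r p \<in> X1}"
  have fX: "finite X1" "finite X2" using X(1) finite_subset by auto
  have rs: "r \<in> sg N" using permutes_subset[OF less.prems(1) X(1)] by (simp add: sg_def)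
  have rX: "r p \<in> X1 \<union> X2 \<longleftrightarrow> p \<in> X1 \<union> X2" for p using permutes_in_image[OF less.prems(1)] .
  have cardUV: "card (?U r) = card (?V r)" by (rule card_exchange[OF fX X(2) less.prems(1)])
  show ?case
  proof (cases "?U r = {}")
    case True
    then have "card (?V r) = 0" using cardUV by (metis card.empty)
    then have "?V r = {}" using fX by auto
    have "ln (r p) = ln p" for p
    proof (cases "p \<in> X1 \<union> X2")
      case p: True
      then have "r p \<in> X1 \<union> X2" using rX by blast
      then show ?thesis using p l True \<open>?V r = {}\<close> by (metis (mono_tags, lifting) Un_iff empty_Collect_eq)
    qed (simp add: permutes_not_in[OF less.prems(1)])
    then have "r \<in> In" using rs by (simp add: In_def)
    then show ?thesis by (rule F_In)
  next
    case False
    then obtain u where u: "u \<in> X1" "r u \<in> X2" by blast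
    have "finite (?U r)" using fX by simp
    then have "card (?U r) \<noteq> 0" using False by (simp only: card_0_eq not_False_eq_True)
    then have "?V r \<noteq> {}" using cardUV by (metis card.empty)
    then obtain v where v: "v \<in> X2" "r v \<in> X1" by blast
    let ?t = "transpose u v"
    let ?r = "r \<circ> ?t"
    have uv: "u \<noteq> v" using u v X(2) by blast
    have Iuv: "I u = z" "I v = z" using less.prems u v by blast+
    have tX: "?t permutes X1 \<union> X2" using u v by (intro permutes_swap_id) auto
    have r': "?r permutes X1 \<union> X2" using permutes_compose[OF tX less.prems(1)] .
    have U': "?U ?r = ?U r - {u}"
      using u v X(2) uv by (auto simp: transpose_def split: if_splits)
    have "card (?U ?r) < card (?U r)" unfolding U' using u fX by (intro card_Diff1_less) auto
    moreover have "I p = z" if "p \<in> X1" "?r p \<in> X2" for p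
      using that less.prems(2) u v X(2) Iuv by (auto simp: transpose_def split: if_splits)
    moreover have "I p = z" if "p \<in> X2" "?r p \<in> X1" for p
      using that less.prems(3) u v X(2) Iuv by (auto simp: transpose_def split: if_splits)
    ultimately have IH: "scl (chi ?r I) (F (act ?r I)) = F I" using less.hyps r' by blast
    have uvN: "u \<in> {1..N}" "v \<in> {1..N}" using u v X(1) by auto
    have ts: "?t \<in> sg N" using uvN by (rule sg_transpose)
    have tI: "act ?t I = I" using Iuv by (intro act_transpose_eq) simp
    have ct: "chi ?t I = 1" using chi_transpose[OF uvN uv] Iuv z by simp
    have "chi ?r I = chi r I" using chi_comp[OF rs ts, of I] tI ct by simp
    moreover have "act ?r I = act r I" using sg_act[OF rs ts, of I] tI by simp
    ultimately show ?thesis using IH by simp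
  qed
qed

definition good :: "(nat \<Rightarrow> ix) \<Rightarrow> bool" where
  "good I \<longleftrightarrow> (\<forall>b i. b \<le> B \<and> i < M \<longrightarrow> I (y b i) \<le> I (y b (Suc i)) \<and> (I (y b i) = I (y b (Suc i)) \<longrightarrow> \<not> neg (I (y b i)))) \<and>
    (\<forall>b i. b < B \<and> i \<le> M \<longrightarrow> I (y b i) \<le> I (y (Suc b) i) \<and> (I (y b i) = I (y (Suc b) i) \<longrightarrow> neg (I (y b i))))"

text \<open>The measure is lexicographic: first the weight of letters towards later lines
  (\<open>mu ln\<close>), then towards later places (\<open>mu ps\<close>). A descent inside a line
  is sorted by \<open>F_In\<close>, raising the second weight; a forbidden repetition makes
  \<open>F I\<close> vanish; a violation between neighbouring lines is resolved by a Garnir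
  relation, raising the first.\<close>

theorem straighten:
  assumes R: "finite R" and IR: "\<And>p. p \<in> {1..N} \<Longrightarrow> I p \<in> R"
    and W0: "0 \<in> W" and Wadd: "\<And>f g. f \<in> W \<Longrightarrow> g \<in> W \<Longrightarrow> f + g \<in> W" and Wscl: "\<And>c f. f \<in> W \<Longrightarrow> scl c f \<in> W"
    and Wgood: "\<And>I. good I \<Longrightarrow> (\<And>p. p \<in> {1..N} \<Longrightarrow> I p \<in> R) \<Longrightarrow> F I \<in> W"
  shows "F I \<in> W"
proof -
  \<comment> \<open>Letters are replaced by their rank in the finite set \<open>R\<close>, which
    makes the weights bounded natural numbers.\<close>
  define rank where "rank u = card {v\<in>R. v < u}" for u
  have rank_mono: "rank u \<le> rank v" if "u \<le> v" for u v
    unfolding rank_def using R that by (intro card_mono) auto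
  have rank_strict: "rank u < rank v" if "u < v" "u \<in> R" for u v
    unfolding rank_def using R that by (intro psubset_card_mono) auto
  have rank_le: "rank u \<le> card R" for u unfolding rank_def using R by (intro card_mono) auto
  define mu where "mu l I = (\<Sum>p\<in>{1..N}. l p * rank (I p))" for l :: "nat \<Rightarrow> nat" and I
  have mu_act: "mu l (act s I) = (\<Sum>p\<in>{1..N}. l (s p) * rank (I p))" if "s \<in> sg N" for l s I
  proof -
    have s: "s permutes {1..N}" using that by (simp add: sg_def)
    have "mu l (act s I) = (\<Sum>p\<in>{1..N}. l (s p) * rank (act s I (s p)))"
      unfolding mu_def using sum.permute[OF s, of "\<lambda>p. l p * rank (act s I p)"] by (simp add: comp_def)
    then show ?thesis by (simp add: act_def permutes_inverses[OF s])
  qed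
  have mu_bound: "mu l I \<le> N * (c * card R)" if "\<And>p. p \<in> {1..N} \<Longrightarrow> l p \<le> c" for l c I
  proof -
    have "mu l I \<le> (\<Sum>p\<in>{1..N}. c * card R)" unfolding mu_def using that rank_le by (intro sum_mono mult_le_mono) auto
    then show ?thesis by simp
  qed
  have actR: "act s I p \<in> R" if "s \<in> sg N" "\<forall>p\<in>{1..N}. I p \<in> R" "p \<in> {1..N}" for s I p
    using that sg_in[OF sg_inv[OF that(1)], of p] by (simp add: act_def)
  have Wsum: "(\<Sum>x\<in>A. f x) \<in> W" if "\<And>x. x \<in> A \<Longrightarrow> f x \<in> W" for f :: "'z \<Rightarrow> _" and A
    using that by (induction A rule: infinite_finite_induct) (simp_all add: W0 Wadd del: zero_fun_apply plus_fun_apply)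
  let ?u = "N * (B * card R)" and ?v = "N * (M * card R)"
  show ?thesis using IR
  proof (induction "(?u - mu ln I, ?v - mu ps I)" arbitrary: I rule: wf_induct_rule[OF wf_lex_prod[OF wf_less_than wf_less_than]])
    case less: (1 I)
    note IR = less.prems
    have IRb: "\<forall>p\<in>{1..N}. I p \<in> R" using IR by blast
    have bound: "mu ln I \<le> ?u" "mu ps I \<le> ?v" for I using mu_bound pos by auto
    have IH: "F J \<in> W" if "\<And>p. p \<in> {1..N} \<Longrightarrow> J p \<in> R" "mu ln J > mu ln I \<or> (mu ln J = mu ln I \<and> mu ps J > mu ps I)" for J
    proof -
      have "((?u - mu ln J, ?v - mu ps J), (?u - mu ln I, ?v - mu ps I)) \<in> less_than <*lex*> less_than"
        using that(2) bound[of I] bound[of J] by auto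
      then show ?thesis using less.hyps that(1) by blast
    qed
    consider (desc) b i where "b \<le> B" "i < M" "I (y b (Suc i)) < I (y b i)"
      | (rep) b i where "b \<le> B" "i < M" "I (y b i) = I (y b (Suc i))" "neg (I (y b i))"
      | (viol) "\<And>b i. b \<le> B \<Longrightarrow> i < M \<Longrightarrow> I (y b i) \<le> I (y b (Suc i)) \<and> (I (y b i) = I (y b (Suc i)) \<longrightarrow> \<not> neg (I (y b i)))" "\<not> good I"
      | (fine) "good I"
      by (metis not_le)
    then show ?case
    proof cases
      case desc
      let ?p = "y b i" and ?q = "y b (Suc i)"
      let ?t = "transpose ?p ?q"
      have c: "?p \<in> {1..N}" "?q \<in> {1..N}" "ln ?p = b" "ln ?q = b" "ps ?p = i" "ps ?q = Suc i"
        using cell[of b i] cell[of b "Suc i"] desc by auto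
      then have pq: "?p \<noteq> ?q" by (metis n_not_Suc_n)
      have ts: "?t \<in> sg N" using c by (intro sg_transpose)
      have tI: "?t \<in> In" using ts c by (auto simp: In_def transpose_def)
      have "mu ln (act ?t I) = mu ln I"
        unfolding mu_act[OF ts] unfolding mu_def using tI by (intro sum.cong refl) (simp add: In_def)
      moreover have "mu ps (act ?t I) > mu ps I"
      proof -
        have sp: "(\<Sum>p\<in>{1..N}. f p) = f ?p + (f ?q + (\<Sum>p\<in>{1..N} - {?p} - {?q}. f p))" for f :: "nat \<Rightarrow> nat"
        proof -
          have "?q \<in> {1..N} - {?p}" using c pq by auto
          then show ?thesis using sum.remove[of "{1..N}" ?p f] sum.remove[of "{1..N} - {?p}" ?q f] c(1) by simp
        qed
        have e: "(\<Sum>p\<in>{1..N} - {?p} - {?q}. ps (?t p) * rank (I p)) = (\<Sum>p\<in>{1..N} - {?p} - {?q}. ps p * rank (I p))"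
          by (intro sum.cong) auto
        have "rank (I ?q) < rank (I ?p)" using rank_strict desc(3) IR[OF c(2)] by blast
        then show ?thesis unfolding mu_act[OF ts] unfolding mu_def sp e using c by simp
      qed
      ultimately have "F (act ?t I) \<in> W" by (intro IH) (use actR[OF ts IRb] in blast)+
      then show ?thesis using F_In[OF tI, of I] Wscl by metis
    next
      case rep
      let ?p = "y b i" and ?q = "y b (Suc i)"
      let ?t = "transpose ?p ?q"
      have c: "?p \<in> {1..N}" "?q \<in> {1..N}" "ln ?p = b" "ln ?q = b" "ps ?p = i" "ps ?q = Suc i"
        using cell[of b i] cell[of b "Suc i"] rep by auto
      then have pq: "?p \<noteq> ?q" by (metis n_not_Suc_n)
      have ts: "?t \<in> sg N" using c by (intro sg_transpose)
      have tI: "?t \<in> In" using ts c by (auto simp: In_def transpose_def)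
      have "scl (- 1) (F I) = F I"
        using F_In[OF tI, of I] chi_transpose[OF c(1,2) pq, of I] rep(3,4) act_transpose_eq[of I ?p ?q] by simp
      then have "F I = 0" by (auto simp: fun_eq_iff)
      then show ?thesis using W0 by simp
    next
      case fine
      then show ?thesis using Wgood IR by blast
    next
      case viol
      then obtain b i where bi: "b < B" "i \<le> M"
        "\<not> (I (y b i) \<le> I (y (Suc b) i) \<and> (I (y b i) = I (y (Suc b) i) \<longrightarrow> neg (I (y b i))))"
        unfolding good_def by blast
      let ?a = "I (y b i)" and ?c = "I (y (Suc b) i)"
      have ac: "?c \<le> ?a" "?c = ?a \<Longrightarrow> \<not> neg ?a" using bi(3) by auto
      have line: "I (y b' k) \<le> I (y b' k')" if "b' \<le> B" "k \<le> k'" "k' \<le> M" for b' k k'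
        using that(2,3)
      proof (induction k' rule: dec_induct)
        case (step k')
        then show ?case using viol(1)[of b' k'] that(1) by (meson Suc_le_lessD Suc_leD order_trans)
      qed simp
      let ?X1 = "y b ` {i..M}" and ?X2 = "y (Suc b) ` {..i}"
      let ?X = "?X1 \<union> ?X2"
      have X: "?X \<subseteq> {1..N}" "card ?X = Suc (Suc M)" "finite ?X"
        using garnir_facts[OF bi(1,2)] by (auto simp: garnir_def)
      have l: "ln p = b" if "p \<in> ?X1" for p using that cell[of b] bi by auto
      have l2: "ln p = Suc b" if "p \<in> ?X2" for p using that cell[of "Suc b"] bi by auto
      have disj: "?X1 \<inter> ?X2 = {}" using l l2 by fastforce
      have ge: "?a \<le> I p" if "p \<in> ?X1" for p using that line[of b i] bi by auto
      have le: "I p \<le> ?c" if "p \<in> ?X2" for p using that line[of "Suc b" _ i] bi by auto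
      let ?G = "{r. r permutes ?X}"
      have fG: "finite ?G" using X(3) by (rule finite_permutations)
      have rs: "r \<in> sg N" if "r \<in> ?G" for r using permutes_subset[OF _ X(1)] that by (simp add: sg_def)
      \<comment> \<open>Equally many letters cross in both directions. Those moving to the later
        line are at least \<open>?a\<close>, those moving back at most \<open>?c\<close>, and
        \<open>?c \<le> ?a\<close>, so the weight cannot drop. If it stays equal, either nothing
        crosses, or \<open>?a = ?c\<close> and only this letter is exchanged; both cases return
        \<open>F I\<close>.\<close>
      have alt: "mu ln (act r I) > mu ln I \<or> scl (chi r I) (F (act r I)) = F I" if r: "r \<in> ?G" for r
      proof -
        let ?U = "{p\<in>?X1. r p \<in> ?X2}" and ?V = "{p\<in>?X2. r p \<in> ?X1}"
        have rp: "r permutes ?X" using r by simp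
        have rX: "r p \<in> ?X \<longleftrightarrow> p \<in> ?X" for p using permutes_in_image[OF rp] .
        have cardUV: "card ?U = card ?V" by (rule card_exchange[OF _ _ disj rp]) auto
        have fUV: "finite ?U" "finite ?V" by auto
        have "(\<Sum>p\<in>{1..N}. ln (r p) * rank (I p) + (if p \<in> ?V then rank (I p) else 0))
            = (\<Sum>p\<in>{1..N}. ln p * rank (I p) + (if p \<in> ?U then rank (I p) else 0))"
        proof (rule sum.cong[OF refl])
          fix p
          consider "p \<in> ?U" | "p \<in> ?V" | "p \<notin> ?U" "p \<notin> ?V" by blast
          then show "ln (r p) * rank (I p) + (if p \<in> ?V then rank (I p) else 0)
             = ln p * rank (I p) + (if p \<in> ?U then rank (I p) else 0)"
          proof cases
            case 1
            then have nV: "p \<notin> ?V" using disj by blast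
            have "ln p = b" "ln (r p) = Suc b" using 1 l l2 by blast+
            then show ?thesis unfolding if_P[OF 1] if_not_P[OF nV] by simp
          next
            case 2
            then have nU: "p \<notin> ?U" using disj by blast
            have "ln p = Suc b" "ln (r p) = b" using 2 l l2 by blast+
            then show ?thesis unfolding if_P[OF 2] if_not_P[OF nU] by simp
          next
            case 3
            have "ln (r p) = ln p"
            proof (cases "p \<in> ?X")
              case p: True
              then have "r p \<in> ?X" using rX by blast
              then have "p \<in> ?X1 \<and> r p \<in> ?X1 \<or> p \<in> ?X2 \<and> r p \<in> ?X2" using p 3 by blast
              then show ?thesis using l l2 by metis
            qed (simp add: permutes_not_in[OF rp])
            then show ?thesis unfolding if_not_P[OF 3(1)] if_not_P[OF 3(2)] by simp
          qed
        qed
        moreover have ind: "(\<Sum>p\<in>{1..N}. if p \<in> S then rank (I p) else 0) = (\<Sum>p\<in>S. rank (I p))" if "S \<subseteq> ?X" for S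
        proof -
          have "{1..N} \<inter> S = S" using that X(1) by blast
          then show ?thesis using sum.inter_restrict[of "{1..N}" "\<lambda>p. rank (I p)" S] by (simp only: finite_atLeastAtMost)
        qed
        ultimately have bal: "mu ln (act r I) + (\<Sum>p\<in>?V. rank (I p)) = mu ln I + (\<Sum>p\<in>?U. rank (I p))"
        proof -
          assume e: "(\<Sum>p\<in>{1..N}. ln (r p) * rank (I p) + (if p \<in> ?V then rank (I p) else 0))
            = (\<Sum>p\<in>{1..N}. ln p * rank (I p) + (if p \<in> ?U then rank (I p) else 0))"
          have "?U \<subseteq> ?X" "?V \<subseteq> ?X" by blast+
          note i = ind[OF this(1)] ind[OF this(2)]
          show ?thesis unfolding mu_act[OF rs[OF r]] unfolding mu_def using e[unfolded sum.distrib i] .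
        qed
        have VU: "(\<Sum>p\<in>?V. rank (I p)) \<le> card ?V * rank ?c" "card ?U * rank ?a \<le> (\<Sum>p\<in>?U. rank (I p))"
          using sum_bounded_above[of ?V "\<lambda>p. rank (I p)" "rank ?c"] sum_bounded_below[of ?U "rank ?a" "\<lambda>p. rank (I p)"]
            le ge rank_mono by auto
        have car: "card ?V * rank ?c \<le> card ?U * rank ?a" unfolding cardUV using rank_mono[OF ac(1)] by simp
        show ?thesis
        proof (cases "mu ln (act r I) > mu ln I")
          case False
          then have le0: "(\<Sum>p\<in>?U. rank (I p)) \<le> (\<Sum>p\<in>?V. rank (I p))" using bal by linarith
          have eqU: "(\<Sum>p\<in>?U. rank (I p)) = card ?U * rank ?a" and eqV: "(\<Sum>p\<in>?V. rank (I p)) = card ?V * rank ?c"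
            and eqc: "card ?V * rank ?c = card ?U * rank ?a"
            using le0 VU car by linarith+
          have R1: "I p \<in> R" if "p \<in> ?X" for p using that X(1) IR by blast
          have aU: "I p = ?a" if p: "p \<in> ?U" for p
          proof (rule ccontr)
            assume "I p \<noteq> ?a"
            then have "?a < I p" using ge[of p] p by auto
            then have "rank ?a < rank (I p)" using rank_strict R1[of "y b i"] bi by auto
            then have "(\<Sum>p\<in>?U. rank ?a) < (\<Sum>p\<in>?U. rank (I p))"
              using p ge rank_mono by (intro sum_strict_mono_ex1) auto
            then show False using eqU by simp
          qed
          have cV: "I p = ?c" if p: "p \<in> ?V" for p
          proof (rule ccontr)
            assume "I p \<noteq> ?c"
            then have "I p < ?c" using le[of p] p by auto
            then have "rank (I p) < rank ?c" using rank_strict R1[of p] p by auto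
            then have "(\<Sum>p\<in>?V. rank (I p)) < (\<Sum>p\<in>?V. rank ?c)"
              using p le rank_mono by (intro sum_strict_mono_ex1) auto
            then show False using eqV by simp
          qed
          have "scl (chi r I) (F (act r I)) = F I"
          proof (cases "?c = ?a")
            case True
            show ?thesis
              by (rule F_exchange_equal[OF X(1) disj l l2 ac(2)[OF True] rp]) (use aU cV True in auto)
          next
            case False
            then have "rank ?c < rank ?a" using ac(1) rank_strict R1[of "y (Suc b) i"] by auto
            moreover have "card ?U * rank ?c = card ?U * rank ?a" using eqc unfolding cardUV[symmetric] .
            moreover have "k = 0" if "x < z" "k * x = k * z" for k x z :: nat using that by simp
            ultimately have U0: "card ?U = 0" by blast
            then have "card ?V = 0" using cardUV by (rule subst[rotated])
            then have UV: "?U = {}" "?V = {}" using U0 card_0_eq fUV by blast+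
            have "ln (r p) = ln p" for p
            proof (cases "p \<in> ?X")
              case p: True
              then have "r p \<in> ?X" using rX by blast
              then have "p \<in> ?X1 \<and> r p \<in> ?X1 \<or> p \<in> ?X2 \<and> r p \<in> ?X2" using p UV by blast
              then show ?thesis using l l2 by metis
            qed (simp add: permutes_not_in[OF rp])
            then have "r \<in> In" using rs[OF r] by (simp add: In_def)
            then show ?thesis by (rule F_In)
          qed
          then show ?thesis ..
        qed simp
      qed
      let ?E = "{r\<in>?G. scl (chi r I) (F (act r I)) = F I}"
      \<comment> \<open>The terms returning \<open>F I\<close> all have coefficient 1 and include
        the one of \<open>id\<close>. They cannot cancel, so the Garnir relation can be solved for
        \<open>F I\<close>.\<close>
      have "(\<Sum>r\<in>?G. scl (chi r I) (F (act r I))) = (\<Sum>r\<in>?E. scl (chi r I) (F (act r I))) + (\<Sum>r\<in>?G - ?E. scl (chi r I) (F (act r I)))"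
        using fG by (metis (no_types, lifting) add.commute mem_Collect_eq subsetI sum.subset_diff)
      moreover have "(\<Sum>r\<in>?E. scl (chi r I) (F (act r I))) = scl (of_nat (card ?E)) (F I)"
        by (simp add: fun_eq_iff sum_fun_apply)
      ultimately have z: "scl (of_nat (card ?E)) (F I) + (\<Sum>r\<in>?G - ?E. scl (chi r I) (F (act r I))) = 0"
        using F_garnir[OF X(1), of I] X(2) by simp
      have WS: "(\<Sum>r\<in>?G - ?E. scl (chi r I) (F (act r I))) \<in> W"
      proof (intro Wsum Wscl IH)
        fix r assume r: "r \<in> ?G - ?E"
        then show "mu ln I < mu ln (act r I) \<or> mu ln (act r I) = mu ln I \<and> mu ps I < mu ps (act r I)" using alt by blast
        show "act r I p \<in> R" if "p \<in> {1..N}" for p using actR[OF rs IRb that] r by blast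
      qed
      have "id \<in> ?E"
      proof -
        have "id \<in> In" by (auto simp: In_def sg_id)
        then show ?thesis using F_In[of id I] by (auto simp: permutes_id simp del: id_apply)
      qed
      moreover have "finite ?E" using fG by simp
      ultimately have "card ?E \<noteq> 0" using card_0_eq by blast
      then have eq: "F I = scl (- (1 / of_nat (card ?E))) (\<Sum>r\<in>?G - ?E. scl (chi r I) (F (act r I)))"
      proof -
        assume c: "card ?E \<noteq> 0"
        show ?thesis
        proof
          fix x
          have h: "of_nat (card ?E) * F I x + (\<Sum>r\<in>?G - ?E. scl (chi r I) (F (act r I))) x = 0"
            using fun_cong[OF z, of x] by (simp only: plus_fun_apply scl_apply zero_fun_apply)
          have gen: "u = scl c S x" if "u = c * S x" for u c and S :: "'c \<Rightarrow> complex" using that by simp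
          have sol: "a = - (1 / k) * s" if "k * a + s = 0" "k \<noteq> 0" for k a s :: complex
            using that by (simp add: field_simps eq_neg_iff_add_eq_0)
          have k: "(of_nat (card ?E) :: complex) \<noteq> 0" using c by (simp only: of_nat_eq_0_iff not_False_eq_True)
          show "F I x = scl (- (1 / of_nat (card ?E))) (\<Sum>r\<in>?G - ?E. scl (chi r I) (F (act r I))) x"
            by (rule gen, rule sol[OF h k])
        qed
      qed
      show ?thesis by (rule ssubst[OF eq, of "\<lambda>u. u \<in> W"], rule Wscl[OF WS])
    qed
  qed
qed

end

subsection \<open>Signed words\<close>

abbreviation pr :: "(nat \<Rightarrow> ix) \<Rightarrow> nat \<Rightarrow> bool" where "pr I \<equiv> (\<lambda>x. par_ix (I x))"

definition word :: "('i \<Rightarrow> 'j \<Rightarrow> 'v) \<Rightarrow> nat \<Rightarrow> (nat \<Rightarrow> 'i) \<Rightarrow> (nat \<Rightarrow> 'j) \<Rightarrow> 'v list" where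
  "word phi N I J = map (\<lambda>x. phi (I x) (J x)) [1..<Suc N]"

text \<open>\<open>Zmon\<close> for an arbitrary family of generators, so that one exchange rule
  serves the generators of both algebras.\<close>

definition swd :: "('v::linorder \<Rightarrow> bool) \<Rightarrow> (ix \<Rightarrow> ix \<Rightarrow> 'v) \<Rightarrow> nat \<Rightarrow> (nat \<Rightarrow> ix) \<Rightarrow> (nat \<Rightarrow> ix) \<Rightarrow> 'v spoly" where
  "swd par phi N I J = scl (cross N (pr I) (pr J)) (wprod par (word phi N I J))"

lemma length_word [simp]: "length (word phi N I J) = N"
  by (simp add: word_def)

lemma nth_word: "k < N \<Longrightarrow> word phi N I J ! k = phi (I (Suc k)) (J (Suc k))"
  by (simp add: word_def del: upt_Suc)

lemma word_eqI:
  assumes "length w = N" "\<And>x. x \<in> {1..N} \<Longrightarrow> w ! (x - 1) = phi (I x) (J x)"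
  shows "w = word phi N I J"
proof (rule nth_equalityI)
  fix k assume "k < length w"
  then show "w ! k = word phi N I J ! k" using assms(2)[of "Suc k"] assms(1) by (simp add: nth_word)
qed (simp add: assms)

lemma Zmon_swd: "Zmon N I J = swd par_Z Pair N I J"
proof -
  have "{(x, y). x \<in> {1..N} \<and> y \<in> {1..N} \<and> y < x \<and> par_ix (I x) \<and> par_ix (J y)}
     = {p \<in> pairs N. case p of (x, y) \<Rightarrow> par_ix (I x) \<and> par_ix (J y)}"
    by (auto simp: pairs_def)
  then have "(-1 :: complex) ^ card {(x, y). x \<in> {1..N} \<and> y \<in> {1..N} \<and> y < x \<and> par_ix (I x) \<and> par_ix (J y)}
     = cross N (pr I) (pr J)"
    unfolding cross_def by (simp only: minus_one_power_card[OF finite_pairs]) (simp add: case_prod_unfold ss_def)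
  then show ?thesis
    unfolding Zmon_def swd_def scl_def iprod_def word_def by (simp add: foldr_map comp_def)
qed

lemma adjacent_sign:
  assumes i: "1 \<le> i" "i < N" and phi: "\<And>r s. par (phi r s) = (par_ix r \<noteq> par_ix s)"
  defines "t \<equiv> transpose i (Suc i)"
  shows "cross N (pr (act t I)) (pr (act t J)) * ssign par (phi (I i) (J i)) (phi (I (Suc i)) (J (Suc i)))
     = ks N t I * ks N t J * cross N (pr I) (pr J)"
proof -
  have "cross N (pr (act t I)) (pr (act t J)) = cross N (pr I \<circ> t) (pr J \<circ> t)"
    by (simp add: act_def t_def comp_def)
  also have "\<dots> = cross N (pr I) (pr J) * ss (pr I (Suc i)) (pr J i) * ss (pr I i) (pr J (Suc i))"
    unfolding t_def by (rule cross_adjacent[OF i])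
  finally show ?thesis
    unfolding t_def ks_adjacent[OF i] by (auto simp: ss_def ssign_def phi)
qed

lemma upt_adjacent: "1 \<le> i \<Longrightarrow> i < N \<Longrightarrow> [1..<Suc N] = [1..<i] @ i # Suc i # [Suc (Suc i)..<Suc N]"
  using upt_add_eq_append[of 1 i "Suc N - i"] by (simp add: upt_conv_Cons del: upt_Suc)

lemma word_adjacent:
  assumes i: "1 \<le> i" "i < N"
  shows "\<exists>u v. word phi N I J = u @ phi (I i) (J i) # phi (I (Suc i)) (J (Suc i)) # v \<and>
    word phi N (act (transpose i (Suc i)) I) (act (transpose i (Suc i)) J)
      = u @ phi (I (Suc i)) (J (Suc i)) # phi (I i) (J i) # v"
proof (intro exI conjI)
  let ?u = "map (\<lambda>x. phi (I x) (J x)) [1..<i]" and ?v = "map (\<lambda>x. phi (I x) (J x)) [Suc (Suc i)..<Suc N]"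
  show "word phi N I J = ?u @ phi (I i) (J i) # phi (I (Suc i)) (J (Suc i)) # ?v"
    unfolding word_def upt_adjacent[OF i] by simp
  have "map (\<lambda>x. phi (act (transpose i (Suc i)) I x) (act (transpose i (Suc i)) J x)) [1..<i] = ?u"
    "map (\<lambda>x. phi (act (transpose i (Suc i)) I x) (act (transpose i (Suc i)) J x)) [Suc (Suc i)..<Suc N] = ?v"
    by (auto simp: act_def)
  then show "word phi N (act (transpose i (Suc i)) I) (act (transpose i (Suc i)) J)
      = ?u @ phi (I (Suc i)) (J (Suc i)) # phi (I i) (J i) # ?v"
    unfolding word_def upt_adjacent[OF i] by (simp add: act_def)
qed

text \<open>The factor \<open>cross\<close> is exactly the correction that splits the sign of
  permuting the letters \<open>phi r s\<close> into separate Koszul signs for the two sequences. It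
  suffices to check adjacent transpositions, since \<open>ks\<close> is a cocycle.\<close>

lemma swd_act:
  assumes phi: "\<And>r s. par (phi r s) = (par_ix r \<noteq> par_ix s)" and "g \<in> sg N"
  shows "swd par phi N (act g I) (act g J) = scl (ks N g I * ks N g J) (swd par phi N I J)"
proof -
  have "g permutes {1..N}" using assms(2) by (simp add: sg_def)
  then have "\<forall>I J. swd par phi N (act g I) (act g J) = scl (ks N g I * ks N g J) (swd par phi N I J)"
  proof (induction rule: adjacent_induct)
    case id
    show ?case by (simp del: id_apply)
  next
    case (comp s t)
    show ?case
    proof (intro allI)
      fix I J
      show "swd par phi N (act (s \<circ> t) I) (act (s \<circ> t) J) = scl (ks N (s \<circ> t) I * ks N (s \<circ> t) J) (swd par phi N I J)"
        unfolding act_comp[OF comp(1,2)] ks_comp[OF comp(1,2)] comp(3)[rule_format] comp(4)[rule_format]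
        by (simp add: algebra_simps del: scl_apply)
    qed
  next
    case (adj i)
    show ?case
    proof (intro allI)
      fix I J
      let ?t = "transpose i (Suc i)"
      let ?a = "phi (I i) (J i)" and ?b = "phi (I (Suc i)) (J (Suc i))"
      obtain u v where w: "word phi N I J = u @ ?a # ?b # v" "word phi N (act ?t I) (act ?t J) = u @ ?b # ?a # v"
        using word_adjacent[OF adj] by metis
      have "wprod par (u @ ?b # ?a # v) = scl (ssign par ?b ?a) (wprod par (u @ ?a # ?b # v))"
        by (rule iprod_swap[OF svar_swap])
      moreover have "ssign par ?b ?a = ssign par ?a ?b" by (simp add: ssign_def conj_commute)
      ultimately show "swd par phi N (act ?t I) (act ?t J) = scl (ks N ?t I * ks N ?t J) (swd par phi N I J)"
        unfolding swd_def w using adjacent_sign[where phi = phi and par = par, OF adj phi, of I J]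
        by (simp del: scl_apply)
    qed
  qed
  then show ?thesis by blast
qed

lemma Zmon_act: "g \<in> sg N \<Longrightarrow> Zmon N (act g I) (act g J) = scl (ks N g I * ks N g J) (Zmon N I J)"
  unfolding Zmon_swd by (rule swd_act) (simp_all add: par_Z_def)

subsection \<open>The homomorphism in terms of signed words\<close>

lemma svar_sone: "smult par (svar v) sone = svar v"
proof -
  let ?e = "\<lambda>u. if u = v then 1 else (0::nat)"
  have "?e + (\<lambda>_. 0) = ?e" by (auto simp: fun_eq_iff)
  moreover have "valid_mono par ?e" by (auto simp: valid_mono_def)
  ultimately show ?thesis by (simp only: svar_mon sone_mon smult_mon mono_sign_zero scl_one if_True)
qed

lemma scal_wprod: "scal n m z = (\<Sum>i\<in>Rset n m. wprod par_A [(False, fst z, i), (True, i, snd z)])"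
  by (simp add: scal_def svar_sone)

lemma wprod_swap: "wprod par (u @ a # b # v) = scl (ssign par a b) (wprod par (u @ b # a # v))"
  by (rule iprod_swap[OF svar_swap])

lemma wprod_swap22:
  "wprod par [a, b, c, d] = scl (ssign par b c * ssign par a c * ssign par b d * ssign par a d) (wprod par [c, d, a, b])"
  using wprod_swap[of par "[a]" b c "[d]"] wprod_swap[of par "[]" a c "[b, d]"]
    wprod_swap[of par "[c, a]" b d "[]"] wprod_swap[of par "[c]" a d "[b]"]
  by (simp add: mult.assoc del: iprod_Cons scl_apply)

text \<open>The parity of each summation index occurs twice and cancels, so a scalar product
  commutes like a generator of parity \<open>par_Z\<close>. This is what makes \<open>Phi\<close>
  multiplicative.\<close>

lemma scal_swap:
  "smult par_A (scal n m a) (scal n m b) = scl (ssign par_Z a b) (smult par_A (scal n m b) (scal n m a))"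
proof -
  let ?w = "\<lambda>z i. [(False, fst z, i), (True, i, snd z)] :: avar list"
  have e: "smult par_A (scal n m a) (scal n m b) = (\<Sum>i\<in>Rset n m. \<Sum>j\<in>Rset n m. wprod par_A (?w a i @ ?w b j))" for a b
    unfolding scal_wprod smult_sum_left unfolding smult_sum_right by (simp only: iprod_append)
  have "wprod par_A (?w a i @ ?w b j) = scl (ssign par_Z a b) (wprod par_A (?w b j @ ?w a i))" for i j
    using wprod_swap22[of par_A "(False, fst a, i)" "(True, i, snd a)" "(False, fst b, j)" "(True, j, snd b)"]
    by (simp add: ssign_def par_A_def par_Z_def del: iprod_Cons scl_apply)
  then have "smult par_A (scal n m a) (scal n m b) = (\<Sum>i\<in>Rset n m. \<Sum>j\<in>Rset n m. scl (ssign par_Z a b) (wprod par_A (?w b j @ ?w a i)))"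
    unfolding e by (simp del: iprod_Cons scl_apply)
  also have "\<dots> = (\<Sum>j\<in>Rset n m. \<Sum>i\<in>Rset n m. scl (ssign par_Z a b) (wprod par_A (?w b j @ ?w a i)))" by (rule sum.swap)
  finally show ?thesis unfolding e by (simp add: scl_sum)
qed

lemma fsupp_scal: "fsupp (scal n m z)"
  unfolding scal_wprod by (intro fsupp_sum fsupp_wprod)

lemma finite_Rset [simp]: "finite (Rset a b)"
proof -
  have "Rset a b \<subseteq> {False, True} \<times> {..max a b}" by (auto simp: Rset_def)
  then show ?thesis using finite_subset by blast
qed

lemma wprod_move: "wprod par (w @ [v]) = scl (\<Prod>x\<leftarrow>w. ssign par x v) (wprod par (v # w))"
proof (induction w)
  case (Cons a w)
  have "wprod par ((a # w) @ [v]) = smult par (svar a) (wprod par (w @ [v]))" by simp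
  also have "\<dots> = scl (\<Prod>x\<leftarrow>w. ssign par x v) (wprod par (a # v # w))" unfolding Cons by simp
  also have "wprod par (a # v # w) = scl (ssign par a v) (wprod par (v # a # w))"
    using wprod_swap[of par "[]" a v w] by simp
  finally show ?case by (simp add: mult.commute del: iprod_Cons scl_apply)
qed simp

lemma cross_Suc: "cross (Suc N) a b = cross N a b * (\<Prod>y\<in>{1..N}. ss (a (Suc N)) (b y))"
proof -
  have "pairs (Suc N) = pairs N \<union> (\<lambda>y. (Suc N, y)) ` {1..N}" by (auto simp: pairs_def)
  moreover have "pairs N \<inter> (\<lambda>y. (Suc N, y)) ` {1..N} = {}" by (auto simp: pairs_def)
  ultimately have "cross (Suc N) a b = cross N a b * (\<Prod>p\<in>(\<lambda>y. (Suc N, y)) ` {1..N}. case p of (x, y) \<Rightarrow> ss (a x) (b y))"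
    unfolding cross_def by (simp add: prod.union_disjoint)
  then show ?thesis by (simp add: prod.reindex inj_on_def)
qed

definition ileave :: "nat \<Rightarrow> (nat \<Rightarrow> 'v) \<Rightarrow> (nat \<Rightarrow> 'v) \<Rightarrow> 'v list" where
  "ileave N a b = concat (map (\<lambda>x. [a x, b x]) [1..<Suc N])"

lemma wprod_ileave:
  "wprod par (ileave N a b) = scl (cross N (\<lambda>x. par (a x)) (\<lambda>x. par (b x)))
     (wprod par (map a [1..<Suc N] @ map b [1..<Suc N]))"
proof (induction N)
  case 0
  have "cross 0 f g = 1" for f g unfolding cross_def by (rule prod.neutral) (auto simp: pairs_def)
  then show ?case by (simp add: ileave_def del: scl_apply)
next
  case (Suc N)
  let ?A = "map a [1..<Suc N]" and ?B = "map b [1..<Suc N]" and ?x = "a (Suc N)" and ?y = "b (Suc N)"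
  have "ileave (Suc N) a b = ileave N a b @ [?x, ?y]" by (simp add: ileave_def)
  then have "wprod par (ileave (Suc N) a b) = scl (cross N (\<lambda>x. par (a x)) (\<lambda>x. par (b x))) (wprod par (?A @ (?B @ [?x]) @ [?y]))"
    using Suc by (simp add: iprod_append smult_assoc del: scl_apply upt_Suc iprod_Cons)
  also have "wprod par (?A @ (?B @ [?x]) @ [?y]) = scl (\<Prod>z\<leftarrow>?B. ssign par z ?x) (wprod par (?A @ (?x # ?B) @ [?y]))"
    unfolding iprod_append[of par svar ?A] iprod_append[of par svar "?B @ [?x]"] iprod_append[of par svar "?x # ?B"]
      wprod_move[of par ?B ?x] smult_scl_left smult_scl_right ..
  also have "(\<Prod>z\<leftarrow>?B. ssign par z ?x) = (\<Prod>y\<in>{1..N}. ss (par (a (Suc N))) (par (b y)))"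
    by (simp add: prod.distinct_set_conv_list[symmetric] comp_def atLeastLessThanSuc_atLeastAtMost ss_def ssign_def conj_commute del: upt_Suc)
  also have "?A @ (?x # ?B) @ [?y] = map a [1..<Suc (Suc N)] @ map b [1..<Suc (Suc N)]" by simp
  finally show ?case by (simp add: cross_Suc del: scl_apply upt_Suc)
qed

lemma iprod_scal_word:
  "iprod par_A (scal n m) (word Pair N I J)
    = (\<Sum>K\<in>Kset N n m. wprod par_A (ileave N (\<lambda>x. (False, I x, K x)) (\<lambda>x. (True, K x, J x))))"
proof (induction N)
  case 0
  then show ?case by (simp add: word_def Kset_def ileave_def)
next
  case (Suc N)
  let ?W = "\<lambda>N K. wprod par_A (ileave N (\<lambda>x. (False, I x, K x)) (\<lambda>x. (True, K x, J x)))"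
  let ?R = "Rset n m" and ?s = "Suc N"
  let ?w = "\<lambda>i. [(False, I ?s, i), (True, i, J ?s)] :: avar list"
  have "{1..Suc N} = insert (Suc N) {1..N}" by auto
  then have Ks: "Kset (Suc N) n m = (\<lambda>(i, K). K(?s := i)) ` (?R \<times> Kset N n m)"
    unfolding Kset_def by (simp only: PiE_insert_eq)
  have inj: "inj_on (\<lambda>(i, K). K(?s := i)) (?R \<times> Kset N n m)"
    unfolding Kset_def by (rule inj_combinator) auto
  have W: "?W (Suc N) (K(?s := i)) = smult par_A (?W N K) (wprod par_A (?w i))" for K i
  proof -
    have "ileave (Suc N) (\<lambda>x. (False, I x, (K(?s := i)) x)) (\<lambda>x. (True, (K(?s := i)) x, J x))
      = ileave N (\<lambda>x. (False, I x, (K(?s := i)) x)) (\<lambda>x. (True, (K(?s := i)) x, J x)) @ ?w i" by (simp add: ileave_def)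
    also have "ileave N (\<lambda>x. (False, I x, (K(?s := i)) x)) (\<lambda>x. (True, (K(?s := i)) x, J x))
      = ileave N (\<lambda>x. (False, I x, K x)) (\<lambda>x. (True, K x, J x))"
      unfolding ileave_def by (intro arg_cong[where f = concat] map_cong) auto
    finally show ?thesis by (simp only: iprod_append)
  qed
  have "word Pair (Suc N) I J = word Pair N I J @ [(I ?s, J ?s)]" by (simp add: word_def)
  then have "iprod par_A (scal n m) (word Pair (Suc N) I J)
      = smult par_A (\<Sum>K\<in>Kset N n m. ?W N K) (smult par_A (scal n m (I ?s, J ?s)) sone)"
    using Suc by (simp only: iprod_append iprod_Cons iprod_Nil)
  also have "smult par_A (scal n m (I ?s, J ?s)) sone = (\<Sum>i\<in>?R. wprod par_A (?w i))"
    by (simp add: scal_def smult_sum_left smult_assoc)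
  also have "smult par_A (\<Sum>K\<in>Kset N n m. ?W N K) (\<Sum>i\<in>?R. wprod par_A (?w i))
      = (\<Sum>i\<in>?R. \<Sum>K\<in>Kset N n m. ?W (Suc N) (K(?s := i)))"
    unfolding W smult_sum_right unfolding smult_sum_left ..
  also have "\<dots> = (\<Sum>K\<in>Kset (Suc N) n m. ?W (Suc N) K)"
    unfolding Ks sum.reindex[OF inj] by (simp add: sum.cartesian_product case_prod_unfold comp_def)
  finally show ?case .
qed

abbreviation "phiX \<equiv> (\<lambda>r i. (False, r, i) :: avar)"
abbreviation "phiY \<equiv> (\<lambda>i s. (True, i, s) :: avar)"

lemma Phi_add: "fsupp f \<Longrightarrow> fsupp g \<Longrightarrow> Phi n m (f + g) = Phi n m f + Phi n m g"
  unfolding Phi_def seval_lin by (rule lin_add) (auto simp: fsupp_def)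

lemma Phi_scl: "fsupp f \<Longrightarrow> Phi n m (scl c f) = scl c (Phi n m f)"
  unfolding Phi_def seval_lin by (rule lin_scl) (auto simp: fsupp_def)

lemma Phi_sum: "(\<And>i. i \<in> A \<Longrightarrow> fsupp (f i)) \<Longrightarrow> Phi n m (\<Sum>i\<in>A. f i) = (\<Sum>i\<in>A. Phi n m (f i))"
  unfolding Phi_def seval_lin by (rule lin_sum)

lemma fsupp_swd: "fsupp (swd par phi N I J)"
  unfolding swd_def by (intro fsupp_scl fsupp_wprod)

theorem Phi_Zmon:
  "Phi n m (Zmon N I J) = (\<Sum>K\<in>Kset N n m. scl (cross N (pr K) (pr K))
     (smult par_A (swd par_A phiX N I K) (swd par_A phiY N K J)))"
proof -
  have "Phi n m (wprod par_Z (word Pair N I J)) = iprod par_A (scal n m) (word Pair N I J)"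
    unfolding Phi_def by (rule seval_wprod[OF scal_swap])
  then have "Phi n m (Zmon N I J) = scl (cross N (pr I) (pr J)) (iprod par_A (scal n m) (word Pair N I J))"
    unfolding Zmon_swd swd_def by (simp add: Phi_scl fsupp_wprod del: scl_apply)
  also have "\<dots> = (\<Sum>K\<in>Kset N n m. scl (cross N (pr K) (pr K))
     (smult par_A (swd par_A phiX N I K) (swd par_A phiY N K J)))"
    unfolding iprod_scal_word scl_sum
  proof (rule sum.cong[OF refl])
    fix K
    \<comment> \<open>\<open>cross\<close> is bimultiplicative, so separating the interleaved word
      yields four factors. The one of \<open>I\<close> and \<open>J\<close> cancels the sign in
      \<open>Zmon\<close>, those of \<open>I, K\<close> and \<open>K, J\<close> are absorbed by
      \<open>swd\<close>, and the one of \<open>K\<close> with itself remains.\<close>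
    have x: "cross N (\<lambda>x. par_A (False, I x, K x)) (\<lambda>x. par_A (True, K x, J x))
      = cross N (pr I) (pr K) * cross N (pr I) (pr J) * (cross N (pr K) (pr K) * cross N (pr K) (pr J))"
      by (simp only: par_A_def fst_conv snd_conv cross_xor_left cross_xor_right mult.assoc mult.left_commute)
    have c: "cross N (pr I) (pr J) * (cross N (pr I) (pr K) * cross N (pr I) (pr J) * (cross N (pr K) (pr K) * cross N (pr K) (pr J)))
      = cross N (pr K) (pr K) * (cross N (pr I) (pr K) * cross N (pr K) (pr J))"
      using cross_sq[of N "pr I" "pr J"] by (simp add: algebra_simps)
    show "scl (cross N (pr I) (pr J)) (wprod par_A (ileave N (\<lambda>x. (False, I x, K x)) (\<lambda>x. (True, K x, J x))))
      = scl (cross N (pr K) (pr K)) (smult par_A (swd par_A phiX N I K) (swd par_A phiY N K J))"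
      unfolding wprod_ileave x swd_def word_def smult_scl_left smult_scl_right scl_scl iprod_append c
      by (simp only: mult.assoc mult.commute mult.left_commute)
  qed
  finally show ?thesis .
qed

subsection \<open>Matrix coefficients of the invariant pairing\<close>

definition sq :: "nat \<Rightarrow> ('v \<Rightarrow> ix) \<Rightarrow> 'v list \<Rightarrow> nat \<Rightarrow> ix" where
  "sq N f w = (\<lambda>x\<in>{1..N}. f (w ! (x - 1)))"

text \<open>The coefficient of \<open>e\<^sub>K\<^sub>0 \<otimes> e*\<^sub>L\<^sub>0\<close> in the symmetrization of \<open>X(I,K) X*(L,J)\<close>, with the letters of \<open>U\<close> and \<open>W\<close> reassembled
  into an element of \<open>S(U \<otimes> W)\<close>.\<close>

definition psiG :: "nat \<Rightarrow> (nat \<Rightarrow> ix) \<Rightarrow> (nat \<Rightarrow> ix) \<Rightarrow> (nat \<Rightarrow> ix) \<Rightarrow> (nat \<Rightarrow> ix) \<Rightarrow> (nat \<Rightarrow> ix) \<Rightarrow> (nat \<Rightarrow> ix) \<Rightarrow> zvar spoly" where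
  "psiG N K0 L0 I K L J = (\<Sum>g\<in>sg N. \<Sum>h\<in>sg N. if act g K = K0 \<and> act h L = L0
     then scl (ks N g I * ks N g K * (ks N h L * ks N h J)) (Zmon N (act g I) (act h J)) else 0)"

text \<open>\<open>psiG\<close> for words, with value 0 unless both kinds of letters occur exactly
  \<open>N\<close> times; its linear extension thus ignores all other bidegrees.\<close>

definition psiF :: "nat \<Rightarrow> (nat \<Rightarrow> ix) \<Rightarrow> (nat \<Rightarrow> ix) \<Rightarrow> avar list \<Rightarrow> zvar spoly" where
  "psiF N K0 L0 w = (let w1 = filter (\<lambda>x. \<not> fst x) w; w2 = filter fst w;
       I = sq N (\<lambda>x. fst (snd x)) w1; K = sq N (\<lambda>x. snd (snd x)) w1;
       L = sq N (\<lambda>x. fst (snd x)) w2; J = sq N (\<lambda>x. snd (snd x)) w2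
     in if length w1 = N \<and> length w2 = N
        then scl (cross N (pr I) (pr K) * cross N (pr L) (pr J)) (psiG N K0 L0 I K L J) else 0)"

lemma sg_permutes: "s \<in> sg N \<Longrightarrow> s permutes {1..N}" by (simp add: sg_def)

lemmas act_comp_sg = act_comp[OF sg_permutes sg_permutes]
lemmas ks_comp_sg = ks_comp[OF sg_permutes sg_permutes]

lemma act_inv_cancel: "s \<in> sg N \<Longrightarrow> act s (act (inv s) I) = I" "s \<in> sg N \<Longrightarrow> act (inv s) (act s I) = I"
  using act_comp_sg[of s N "inv s" I] act_comp_sg[of "inv s" N s I] sg_inv[of s N] sg_inv_o[of s N] by auto

lemma ks_act: "s \<in> sg N \<Longrightarrow> t \<in> sg N \<Longrightarrow> ks N s (act t I) = ks N (s \<circ> t) I * ks N t I"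
  by (simp add: ks_comp_sg mult.assoc del: o_apply)

lemma sum_sg_right: assumes "r \<in> sg N" shows "(\<Sum>g\<in>sg N. f (g \<circ> r)) = (\<Sum>g\<in>sg N. f g)"
  by (rule sum.reindex_bij_witness[where i = "\<lambda>g. g \<circ> inv r" and j = "\<lambda>g. g \<circ> r"])
    (use assms sg_comp sg_inv in \<open>auto simp: comp_assoc sg_inv_o simp del: o_apply\<close>)

text \<open>Reindexing by \<open>g \<circ> r\<close>. This equivariance lets \<open>psiF\<close>
  respect the commutation relations of the letters of \<open>U\<close>; \<open>psiG_right\<close>
  does the same for those of \<open>W\<close>.\<close>

lemma psiG_left:
  assumes r: "r \<in> sg N"
  shows "psiG N K0 L0 (act r I) (act r K) L J = scl (ks N r I * ks N r K) (psiG N K0 L0 I K L J)"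
proof -
  define f where "f g = (\<Sum>h\<in>sg N. if act g K = K0 \<and> act h L = L0
     then scl (ks N r I * ks N r K * (ks N g I * ks N g K * (ks N h L * ks N h J))) (Zmon N (act g I) (act h J)) else 0)" for g
  have "psiG N K0 L0 (act r I) (act r K) L J = (\<Sum>g\<in>sg N. f (g \<circ> r))"
    unfolding psiG_def f_def
    by (intro sum.cong refl if_cong) (use r in \<open>simp_all add: act_comp_sg ks_act algebra_simps del: o_apply scl_apply\<close>)
  also have "\<dots> = (\<Sum>g\<in>sg N. f g)" by (rule sum_sg_right[OF r])
  also have "\<dots> = scl (ks N r I * ks N r K) (psiG N K0 L0 I K L J)"
    unfolding psiG_def f_def scl_sum by (intro sum.cong refl) (simp del: scl_apply zero_fun_apply)
  finally show ?thesis .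
qed

lemma psiG_right:
  assumes r: "r \<in> sg N"
  shows "psiG N K0 L0 I K (act r L) (act r J) = scl (ks N r L * ks N r J) (psiG N K0 L0 I K L J)"
proof -
  define f where "f g h = (if act g K = K0 \<and> act h L = L0
     then scl (ks N r L * ks N r J * (ks N g I * ks N g K * (ks N h L * ks N h J))) (Zmon N (act g I) (act h J)) else 0)" for g h
  have "psiG N K0 L0 I K (act r L) (act r J) = (\<Sum>g\<in>sg N. \<Sum>h\<in>sg N. f g (h \<circ> r))"
    unfolding psiG_def f_def
    by (intro sum.cong refl if_cong) (use r in \<open>simp_all add: act_comp_sg ks_act algebra_simps del: o_apply scl_apply\<close>)
  also have "\<dots> = (\<Sum>g\<in>sg N. \<Sum>h\<in>sg N. f g h)" by (intro sum.cong refl sum_sg_right[OF r])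
  also have "\<dots> = scl (ks N r L * ks N r J) (psiG N K0 L0 I K L J)"
    unfolding psiG_def f_def scl_sum by (intro sum.cong refl) (simp del: scl_apply zero_fun_apply)
  finally show ?thesis .
qed

lemma sq_swap:
  assumes "length (u @ a # b # v) = N"
  shows "sq N f (u @ b # a # v) = act (transpose (Suc (length u)) (Suc (Suc (length u)))) (sq N f (u @ a # b # v))"
proof
  fix x
  let ?i = "Suc (length u)"
  show "sq N f (u @ b # a # v) x = act (transpose ?i (Suc ?i)) (sq N f (u @ a # b # v)) x"
  proof (cases "x = ?i \<or> x = Suc ?i")
    case True
    then show ?thesis using assms by (auto simp: sq_def act_def nth_append)
  next
    case False
    then have "(u @ b # a # v) ! (x - 1) = (u @ a # b # v) ! (x - 1)" if "x \<in> {1..N}"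
      using that by (auto simp: nth_append nth_Cons' )
    then show ?thesis using False by (auto simp: sq_def act_def)
  qed
qed

lemma sq_swap_sign:
  fixes u v :: "avar list"
  assumes N: "length (u @ a # b # v) = N"
  defines "I \<equiv> sq N (\<lambda>x. fst (snd x)) (u @ a # b # v)" and "K \<equiv> sq N (\<lambda>x. snd (snd x)) (u @ a # b # v)"
    and "I' \<equiv> sq N (\<lambda>x. fst (snd x)) (u @ b # a # v)" and "K' \<equiv> sq N (\<lambda>x. snd (snd x)) (u @ b # a # v)"
  shows "\<exists>t\<in>sg N. I' = act t I \<and> K' = act t K \<and>
    cross N (pr I) (pr K) = ssign par_A a b * (cross N (pr I') (pr K') * (ks N t I * ks N t K))"
proof
  let ?i = "Suc (length u)"
  let ?t = "transpose ?i (Suc ?i)"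
  have i: "1 \<le> ?i" "?i < N" using N by auto
  show "?t \<in> sg N" using i by (intro sg_transpose) auto
  have e: "I' = act ?t I" "K' = act ?t K"
    unfolding I_def K_def I'_def K'_def by (rule sq_swap[OF N])+
  \<comment> \<open>\<open>par_A\<close> does not look at the first component, so the computation
    serves both kinds of letters.\<close>
  have "ssign par_A (False, I ?i, K ?i) (False, I (Suc ?i), K (Suc ?i)) = ssign par_A a b"
    using i by (auto simp: I_def K_def sq_def ssign_def par_A_def nth_append)
  then have h: "cross N (pr I') (pr K') * ssign par_A a b = ks N ?t I * ks N ?t K * cross N (pr I) (pr K)"
    using adjacent_sign[OF i, of par_A "\<lambda>r s. (False, r, s)" I K] unfolding e by (simp add: par_A_def)
  have "ssign par_A a b * (cross N (pr I') (pr K') * (ks N ?t I * ks N ?t K))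
    = (cross N (pr I') (pr K') * ssign par_A a b) * (ks N ?t I * ks N ?t K)" by (simp only: mult_ac)
  also have "\<dots> = cross N (pr I) (pr K) * (ks N ?t I * ks N ?t I) * (ks N ?t K * ks N ?t K)"
    unfolding h by (simp only: mult_ac)
  also have "\<dots> = cross N (pr I) (pr K)" by (simp only: ks_sq mult_1_right)
  finally have c: "cross N (pr I) (pr K) = ssign par_A a b * (cross N (pr I') (pr K') * (ks N ?t I * ks N ?t K))" ..
  show "I' = act ?t I \<and> K' = act ?t K \<and>
    cross N (pr I) (pr K) = ssign par_A a b * (cross N (pr I') (pr K') * (ks N ?t I * ks N ?t K))"
    using e c by blast
qed

text \<open>If the letters of \<open>U\<close> come first and \<open>b \<le> a\<close>, then
  \<open>a\<close> and \<open>b\<close> are of the same kind, so only \<open>psiG_left\<close> or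
  only \<open>psiG_right\<close> is called for.\<close>

lemma psiF_swap:
  assumes W: "sorted (map fst (u @ a # b # v))" and ba: "b \<le> a"
  shows "sorted (map fst (u @ b # a # v)) \<and>
    psiF N K0 L0 (u @ a # b # v) = scl (ssign par_A a b) (psiF N K0 L0 (u @ b # a # v))"
proof
  have "sorted (fst a # fst b # map fst v)" using W by (simp only: map_append list.map sorted_append)
  then have "fst a \<le> fst b" by (simp only: sorted2)
  moreover have "fst b \<le> fst a" using ba by (cases a, cases b) (auto simp: less_eq_prod_def)
  ultimately have ab: "fst a = fst b" by (rule antisym)
  then show "sorted (map fst (u @ b # a # v))" using W by simp
  let ?f = "\<lambda>x::avar. fst (snd x)" and ?g = "\<lambda>x::avar. snd (snd x)"
  show "psiF N K0 L0 (u @ a # b # v) = scl (ssign par_A a b) (psiF N K0 L0 (u @ b # a # v))"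
  proof (cases "fst a")
    case False
    define u1 v1 w2 where "u1 = filter (\<lambda>x. \<not> fst x) u" and "v1 = filter (\<lambda>x. \<not> fst x) v" and "w2 = filter fst (u @ v)"
    have f: "filter (\<lambda>x. \<not> fst x) (u @ a # b # v) = u1 @ a # b # v1" "filter (\<lambda>x. \<not> fst x) (u @ b # a # v) = u1 @ b # a # v1"
      "filter fst (u @ a # b # v) = w2" "filter fst (u @ b # a # v) = w2"
      using False ab by (simp_all add: u1_def v1_def w2_def)
    show ?thesis
    proof (cases "length (u1 @ a # b # v1) = N \<and> length w2 = N")
      case True
      then have N: "length (u1 @ a # b # v1) = N" by blast
      obtain t where t: "t \<in> sg N" "sq N ?f (u1 @ b # a # v1) = act t (sq N ?f (u1 @ a # b # v1))"
        "sq N ?g (u1 @ b # a # v1) = act t (sq N ?g (u1 @ a # b # v1))"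
        "cross N (pr (sq N ?f (u1 @ a # b # v1))) (pr (sq N ?g (u1 @ a # b # v1)))
          = ssign par_A a b * (cross N (pr (sq N ?f (u1 @ b # a # v1))) (pr (sq N ?g (u1 @ b # a # v1))) *
            (ks N t (sq N ?f (u1 @ a # b # v1)) * ks N t (sq N ?g (u1 @ a # b # v1))))"
        using sq_swap_sign[OF N] by blast
      have "length (u1 @ b # a # v1) = N" using N by simp
      then show ?thesis unfolding psiF_def f Let_def t(4) using True
        by (simp only: t(2,3) psiG_left[OF t(1)] if_True simp_thms scl_scl) (simp only: mult_ac)
    next
      case False
      then have "\<not> (length (u1 @ b # a # v1) = N \<and> length w2 = N)" by auto
      then show ?thesis unfolding psiF_def f Let_def using False by (simp only: if_False scl_0_right)
    qed
  next
    case True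
    define u1 v1 w2 where "u1 = filter fst u" and "v1 = filter fst v" and "w2 = filter (\<lambda>x. \<not> fst x) (u @ v)"
    have f: "filter fst (u @ a # b # v) = u1 @ a # b # v1" "filter fst (u @ b # a # v) = u1 @ b # a # v1"
      "filter (\<lambda>x. \<not> fst x) (u @ a # b # v) = w2" "filter (\<lambda>x. \<not> fst x) (u @ b # a # v) = w2"
      using True ab by (simp_all add: u1_def v1_def w2_def)
    show ?thesis
    proof (cases "length w2 = N \<and> length (u1 @ a # b # v1) = N")
      case True
      then have N: "length (u1 @ a # b # v1) = N" by blast
      obtain t where t: "t \<in> sg N" "sq N ?f (u1 @ b # a # v1) = act t (sq N ?f (u1 @ a # b # v1))"
        "sq N ?g (u1 @ b # a # v1) = act t (sq N ?g (u1 @ a # b # v1))"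
        "cross N (pr (sq N ?f (u1 @ a # b # v1))) (pr (sq N ?g (u1 @ a # b # v1)))
          = ssign par_A a b * (cross N (pr (sq N ?f (u1 @ b # a # v1))) (pr (sq N ?g (u1 @ b # a # v1))) *
            (ks N t (sq N ?f (u1 @ a # b # v1)) * ks N t (sq N ?g (u1 @ a # b # v1))))"
        using sq_swap_sign[OF N] by blast
      have "length (u1 @ b # a # v1) = N" using N by simp
      then show ?thesis unfolding psiF_def f Let_def t(4) using True
        by (simp only: t(2,3) psiG_right[OF t(1)] if_True simp_thms scl_scl) (simp only: mult_ac)
    next
      case False
      then have "\<not> (length w2 = N \<and> length (u1 @ b # a # v1) = N)" by auto
      then show ?thesis unfolding psiF_def f Let_def using False by (simp only: if_False scl_0_right)
    qed
  qed
qed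

lemma lin_scl_wprod: "lin F (scl c (wprod par w)) = scl c (lin F (wprod par w))"
  using lin_scl fsupp_wprod unfolding fsupp_def by blast

text \<open>The assumption of extensionality matches \<open>sq\<close>, which reads off sequences
  that are \<open>undefined\<close> outside the positions.\<close>

lemma lin_psi:
  assumes "N' = N \<Longrightarrow> {I, K, L, J} \<subseteq> extensional {1..N}"
  shows "lin (psiF N K0 L0) (smult par_A (swd par_A phiX N' I K) (swd par_A phiY N' L J))
    = (if N' = N then psiG N K0 L0 I K L J else 0)"
proof -
  let ?w1 = "word phiX N' I K" and ?w2 = "word phiY N' L J"
  have f: "filter (\<lambda>x. \<not> fst x) (?w1 @ ?w2) = ?w1" "filter fst (?w1 @ ?w2) = ?w2"
    by (auto simp: word_def filter_map comp_def)
  have srt: "sorted (map fst (?w1 @ ?w2))"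
    by (auto simp: word_def sorted_append comp_def map_replicate_const simp del: upt_Suc)
  have P: "psiF N K0 L0 (?w1 @ ?w2) = (if N' = N then scl (cross N (pr I) (pr K) * cross N (pr L) (pr J)) (psiG N K0 L0 I K L J) else 0)"
  proof (cases "N' = N")
    case True
    have "sq N (\<lambda>x. fst (snd x)) (word phiX N I K) = I" "sq N (\<lambda>x. snd (snd x)) (word phiX N I K) = K"
      "sq N (\<lambda>x. fst (snd x)) (word phiY N L J) = L" "sq N (\<lambda>x. snd (snd x)) (word phiY N L J) = J"
      using assms[OF True] by (auto simp: sq_def fun_eq_iff nth_word extensional_def)
    then show ?thesis unfolding psiF_def f Let_def using True by simp
  next
    case False
    then show ?thesis unfolding psiF_def f Let_def by (simp only: length_word simp_thms if_False)
  qed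
  have "lin (psiF N K0 L0) (wprod par_A (?w1 @ ?w2)) = psiF N K0 L0 (?w1 @ ?w2)"
    by (rule lin_wprod[where W = "{w. sorted (map fst w)}"]) (use srt psiF_swap in auto)
  moreover have "smult par_A (swd par_A phiX N' I K) (swd par_A phiY N' L J)
     = scl (cross N' (pr I) (pr K) * cross N' (pr L) (pr J)) (wprod par_A (?w1 @ ?w2))"
    unfolding swd_def smult_scl_left smult_scl_right scl_scl iprod_append by (intro arg_cong2[of _ _ _ _ scl] mult.commute refl)
  ultimately have "lin (psiF N K0 L0) (smult par_A (swd par_A phiX N' I K) (swd par_A phiY N' L J))
     = scl (cross N' (pr I) (pr K) * cross N' (pr L) (pr J)) (psiF N K0 L0 (?w1 @ ?w2))"
    by (simp only: lin_scl_wprod)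
  moreover have "cross N (pr I) (pr K) * cross N (pr L) (pr J) * (cross N (pr I) (pr K) * cross N (pr L) (pr J)) = 1"
    using cross_sq[of N "pr I" "pr K"] cross_sq[of N "pr L" "pr J"] by (simp add: algebra_simps)
  ultimately show ?thesis unfolding P by (simp del: scl_apply zero_fun_apply)
qed

lemma cross_act: assumes "g \<in> sg N" shows "cross N (pr (act g K)) (pr (act g K)) = cross N (pr K) (pr K)"
  unfolding cross_def act_def comp_def
  by (rule pairs_reindex[OF sg_permutes[OF sg_inv[OF assms]], of "\<lambda>x y. ss (par_ix (K x)) (par_ix (K y))"])
    (simp add: ss_def conj_commute)

lemma Kset_act: assumes "g \<in> sg N" "K \<in> Kset N n m" shows "act g K \<in> Kset N n m"
proof -
  have p: "inv g permutes {1..N}" using sg_permutes[OF sg_inv[OF assms(1)]] .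
  show ?thesis using assms(2) permutes_in_image[OF p] permutes_not_in[OF p]
    unfolding Kset_def act_def by (auto simp: PiE_iff extensional_def)
qed

text \<open>The value at the group element \<open>x\<close> of the linear map from the group algebra
  to polynomials that, for \<open>N = Nbox n m\<close>, sends the Young symmetrizer to
  \<open>Pt n m t I J\<close>.\<close>

definition Tz :: "nat \<Rightarrow> (nat \<Rightarrow> ix) \<Rightarrow> (nat \<Rightarrow> ix) \<Rightarrow> (nat \<Rightarrow> nat) \<Rightarrow> zvar spoly" where
  "Tz N I J x = scl (ks N x I) (Zmon N (act x I) J)"

lemma fsupp_Zmon: "fsupp (Zmon N I J)"
  unfolding Zmon_swd by (rule fsupp_swd)

lemma lin_psi_Phi:
  assumes "I \<in> extensional {1..N'}" "J \<in> extensional {1..N'}"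
  shows "N' \<noteq> N \<Longrightarrow> lin (psiF N K0 L0) (Phi n m (Zmon N' I J)) = 0"
    and "N' = N \<Longrightarrow> lin (psiF N K0 L0) (Phi n m (Zmon N' I J)) = (\<Sum>K\<in>Kset N n m. scl (cross N (pr K) (pr K)) (psiG N K0 L0 I K K J))"
proof -
  have fs: "fsupp (scl c (smult par_A (swd par_A phiX N' I K) (swd par_A phiY N' K J)))" for c K
    by (intro fsupp_scl fsupp_smult fsupp_swd)
  have fs': "finite {m. smult par_A (swd par_A phiX N' I K) (swd par_A phiY N' K J) m \<noteq> 0}" for K
    using fsupp_smult[OF fsupp_swd fsupp_swd] by (simp add: fsupp_def)
  have e: "lin (psiF N K0 L0) (Phi n m (Zmon N' I J)) = (\<Sum>K\<in>Kset N' n m. scl (cross N' (pr K) (pr K))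
     (lin (psiF N K0 L0) (smult par_A (swd par_A phiX N' I K) (swd par_A phiY N' K J))))"
    unfolding Phi_Zmon by (subst lin_sum[OF fs]) (intro sum.cong refl lin_scl[OF fs'])
  show "lin (psiF N K0 L0) (Phi n m (Zmon N' I J)) = (\<Sum>K\<in>Kset N n m. scl (cross N (pr K) (pr K)) (psiG N K0 L0 I K K J))"
    if "N' = N"
    unfolding that e[unfolded that]
  proof (rule sum.cong[OF refl])
    fix K assume "K \<in> Kset N n m"
    then have "K \<in> extensional {1..N}" by (auto simp: Kset_def PiE_def)
    then show "scl (cross N (pr K) (pr K)) (lin (psiF N K0 L0) (smult par_A (swd par_A phiX N I K) (swd par_A phiY N K J)))
       = scl (cross N (pr K) (pr K)) (psiG N K0 L0 I K K J)"
      using lin_psi[of N N I K K J K0 L0] assms that by simp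
  qed
  show "lin (psiF N K0 L0) (Phi n m (Zmon N' I J)) = 0" if "N' \<noteq> N"
  proof -
    have "lin (psiF N K0 L0) (smult par_A (swd par_A phiX N' I K) (swd par_A phiY N' K J)) = 0" for K
      using lin_psi[of N' N I K K J K0 L0] that by (simp del: zero_fun_apply)
    then show ?thesis unfolding e by (simp only: scl_0_right sum.neutral_const)
  qed
qed

text \<open>The choice of \<open>L0\<close> makes the coefficient at \<open>(K0, L0)\<close> a
  signed conjugation sum of \<open>h\<^sub>K y\<close> with \<open>K = K0\<close>. The condition
  \<open>act h K = L0\<close> determines \<open>K\<close> from \<open>h\<close>, and transferring
  \<open>h\<close> from \<open>J\<close> to \<open>I\<close> leaves the group element
  \<open>inv h \<circ> g\<close>.\<close>

theorem psi_Phi: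
  assumes IJ: "I \<in> extensional {1..N}" "J \<in> extensional {1..N}" and K0: "K0 \<in> Kset N n m" and y: "y \<in> sg N"
  defines "L0 \<equiv> act (inv y) K0"
  shows "lin (psiF N K0 L0) (Phi n m (Zmon N I J)) = scl (cross N (pr K0) (pr K0) * ks N y L0)
    (\<Sum>h\<in>sg N. \<Sum>s\<in>stabK N K0. scl (ks N s K0) (Tz N I J (inv h \<circ> (s \<circ> y \<circ> h))))"
proof -
  have L0: "L0 \<in> Kset N n m" unfolding L0_def using Kset_act[OF sg_inv[OF y] K0] .
  have yL: "act y L0 = K0" unfolding L0_def by (rule act_inv_cancel[OF y])
  define Kh where "Kh h = act (inv h) L0" for h
  have Kh: "act h K = L0 \<longleftrightarrow> K = Kh h" if "h \<in> sg N" for h K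
    using act_inv_cancel[OF that] by (auto simp: Kh_def)
  define v where "v K g h = scl (cross N (pr K) (pr K) * (ks N g I * ks N g K * (ks N h K * ks N h J))) (Zmon N (act g I) (act h J))" for K g h
  have fK: "finite (Kset N n m)" unfolding Kset_def by (intro finite_PiE) auto
  have "lin (psiF N K0 L0) (Phi n m (Zmon N I J))
     = (\<Sum>K\<in>Kset N n m. \<Sum>g\<in>sg N. \<Sum>h\<in>sg N. if act g K = K0 \<and> act h K = L0 then v K g h else 0)"
    unfolding lin_psi_Phi(2)[OF IJ refl] psiG_def scl_sum v_def
    by (intro sum.cong refl) (simp del: scl_apply zero_fun_apply)
  also have "\<dots> = (\<Sum>g\<in>sg N. \<Sum>h\<in>sg N. \<Sum>K\<in>Kset N n m. if act g K = K0 \<and> act h K = L0 then v K g h else 0)"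
    by (rule trans[OF sum.swap], rule sum.cong[OF refl], rule sum.swap)
  also have "\<dots> = (\<Sum>g\<in>sg N. \<Sum>h\<in>sg N. if act g (Kh h) = K0 then v (Kh h) g h else 0)"
  proof (intro sum.cong refl)
    fix g h assume h: "h \<in> sg N"
    have "(\<Sum>K\<in>Kset N n m. if act g K = K0 \<and> act h K = L0 then v K g h else 0)
       = (\<Sum>K\<in>Kset N n m. if K = Kh h then (if act g (Kh h) = K0 then v (Kh h) g h else 0) else 0)"
      using Kh[OF h] by (intro sum.cong refl) auto
    also have "\<dots> = (if act g (Kh h) = K0 then v (Kh h) g h else 0)"
      using fK Kset_act[OF sg_inv[OF h] L0] by (simp only: sum.delta Kh_def if_True)
    finally show "(\<Sum>K\<in>Kset N n m. if act g K = K0 \<and> act h K = L0 then v K g h else 0)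
       = (if act g (Kh h) = K0 then v (Kh h) g h else 0)" .
  qed
  also have "\<dots> = (\<Sum>h\<in>sg N. \<Sum>g\<in>sg N. if act g (Kh h) = K0 then v (Kh h) g h else 0)" by (rule sum.swap)
  also have "\<dots> = (\<Sum>h\<in>sg N. \<Sum>s\<in>stabK N K0. scl (cross N (pr K0) (pr K0) * ks N y L0)
      (scl (ks N s K0) (Tz N I J (inv h \<circ> (s \<circ> y \<circ> h)))))"
  proof (rule sum.cong[OF refl])
    fix h assume h: "h \<in> sg N"
    have hK: "act h (Kh h) = L0" using Kh[OF h] by simp
    have "(\<Sum>g\<in>sg N. if act g (Kh h) = K0 then v (Kh h) g h else 0) = (\<Sum>g\<in>{g\<in>sg N. act g (Kh h) = K0}. v (Kh h) g h)"
      by (rule sum.inter_filter[symmetric]) simp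
    \<comment> \<open>Both \<open>g\<close> and \<open>y \<circ> h\<close> carry \<open>Kh h\<close>
      to \<open>K0\<close>, so they differ by an element \<open>s\<close> of the stabilizer.\<close>
    also have "\<dots> = (\<Sum>s\<in>stabK N K0. v (Kh h) (s \<circ> y \<circ> h) h)"
    proof (rule sum.reindex_bij_witness[where i = "\<lambda>s. s \<circ> y \<circ> h" and j = "\<lambda>g. g \<circ> inv h \<circ> inv y"])
      fix g assume g: "g \<in> {g\<in>sg N. act g (Kh h) = K0}"
      then have gs: "g \<in> sg N" by simp
      show e: "g \<circ> inv h \<circ> inv y \<circ> y \<circ> h = g"
        by (simp only: comp_assoc sg_inv_o[OF h] sg_inv_o[OF y] comp_id sg_cancel[OF y])
      have m: "g \<circ> inv h \<circ> inv y \<in> sg N" "g \<circ> inv h \<in> sg N" by (intro sg_comp sg_inv gs h y)+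
      have "act (g \<circ> inv h \<circ> inv y) K0 = act g (act (inv h) (act (inv y) K0))"
        unfolding act_comp_sg[OF m(2) sg_inv[OF y]] act_comp_sg[OF gs sg_inv[OF h]] ..
      also have "\<dots> = K0" using g by (simp add: Kh_def L0_def)
      finally show "g \<circ> inv h \<circ> inv y \<in> stabK N K0" using m by (simp add: stabK_def)
      show "v (Kh h) (g \<circ> inv h \<circ> inv y \<circ> y \<circ> h) h = v (Kh h) g h" unfolding e ..
    next
      fix s assume s: "s \<in> stabK N K0"
      then have ss: "s \<in> sg N" "act s K0 = K0" by (auto simp: stabK_def)
      show "s \<circ> y \<circ> h \<circ> inv h \<circ> inv y = s"
        by (simp only: comp_assoc sg_inv_o[OF h] sg_inv_o[OF y] comp_id sg_cancel[OF h])
      have m: "s \<circ> y \<circ> h \<in> sg N" "s \<circ> y \<in> sg N" by (intro sg_comp ss h y)+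
      have "act (s \<circ> y \<circ> h) (Kh h) = K0"
        unfolding act_comp_sg[OF m(2) h] act_comp_sg[OF ss(1) y] hK yL ss(2) ..
      then show "s \<circ> y \<circ> h \<in> {g\<in>sg N. act g (Kh h) = K0}" using m by simp
    qed
    also have "\<dots> = (\<Sum>s\<in>stabK N K0. scl (cross N (pr K0) (pr K0) * ks N y L0)
      (scl (ks N s K0) (Tz N I J (inv h \<circ> (s \<circ> y \<circ> h)))))"
    proof (rule sum.cong[OF refl])
      fix s assume s: "s \<in> stabK N K0"
      then have ss: "s \<in> sg N" "act s K0 = K0" by (auto simp: stabK_def)
      define g x where "g = s \<circ> y \<circ> h" and "x = inv h \<circ> g"
      have m: "g \<in> sg N" "s \<circ> y \<in> sg N" "x \<in> sg N" unfolding x_def g_def by (intro sg_comp sg_inv ss h y)+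
      have gx: "g = h \<circ> x" unfolding x_def using sg_cancel(2)[OF h] by metis
      have ag: "act g I = act h (act x I)" unfolding gx by (rule act_comp_sg[OF h m(3)])
      have k1: "ks N g I = ks N h (act x I) * ks N x I" unfolding gx by (rule ks_comp_sg[OF h m(3)])
      have k2: "ks N g (Kh h) = ks N s K0 * ks N y L0 * ks N h (Kh h)"
        unfolding g_def ks_comp_sg[OF m(2) h] ks_comp_sg[OF ss(1) y] hK yL ..
      have c: "cross N (pr (Kh h)) (pr (Kh h)) = cross N (pr K0) (pr K0)"
        unfolding Kh_def L0_def cross_act[OF sg_inv[OF h]] cross_act[OF sg_inv[OF y]] ..
      have "v (Kh h) g h = scl (cross N (pr K0) (pr K0) * ((ks N h (act x I) * ks N x I) *
         (ks N s K0 * ks N y L0 * ks N h (Kh h)) * (ks N h (Kh h) * ks N h J)) * (ks N h (act x I) * ks N h J)) (Zmon N (act x I) J)"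
        unfolding v_def c k1 k2 ag Zmon_act[OF h] by (simp del: scl_apply)
      also have "cross N (pr K0) (pr K0) * ((ks N h (act x I) * ks N x I) *
         (ks N s K0 * ks N y L0 * ks N h (Kh h)) * (ks N h (Kh h) * ks N h J)) * (ks N h (act x I) * ks N h J)
        = cross N (pr K0) (pr K0) * ks N y L0 * (ks N s K0 * ks N x I)
          * (ks N h (act x I) * ks N h (act x I)) * (ks N h (Kh h) * ks N h (Kh h)) * (ks N h J * ks N h J)"
        by (simp only: mult_ac)
      also have "\<dots> = cross N (pr K0) (pr K0) * ks N y L0 * (ks N s K0 * ks N x I)" by (simp only: ks_sq mult_1_right)
      finally show "v (Kh h) (s \<circ> y \<circ> h) h = scl (cross N (pr K0) (pr K0) * ks N y L0)
        (scl (ks N s K0) (Tz N I J (inv h \<circ> (s \<circ> y \<circ> h))))"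
        unfolding Tz_def g_def[symmetric] x_def[symmetric] scl_scl .
    qed
    finally show "(\<Sum>g\<in>sg N. if act g (Kh h) = K0 then v (Kh h) g h else 0) = (\<Sum>s\<in>stabK N K0. scl (cross N (pr K0) (pr K0) * ks N y L0)
      (scl (ks N s K0) (Tz N I J (inv h \<circ> (s \<circ> y \<circ> h)))))" .
  qed
  finally show ?thesis unfolding scl_sum .
qed

subsection \<open>The polynomials of the rectangular tableau\<close>

locale rect_tableau =
  fixes n m :: nat and t :: "nat \<times> nat \<Rightarrow> nat"
  assumes tab: "standard_tableau n m t"
begin

abbreviation "NB \<equiv> Nbox n m"

definition rw :: "nat \<Rightarrow> nat" where "rw p = fst (inv_into (cells n m) t p)"
definition cl :: "nat \<Rightarrow> nat" where "cl p = snd (inv_into (cells n m) t p)"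

lemma t_bij: "bij_betw t (cells n m) {1..NB}"
  using tab by (simp add: standard_tableau_def)

lemma t_cell: "a \<le> n \<Longrightarrow> b \<le> m \<Longrightarrow> t (a, b) \<in> {1..NB} \<and> rw (t (a, b)) = a \<and> cl (t (a, b)) = b"
proof -
  assume "a \<le> n" "b \<le> m"
  then have c: "(a, b) \<in> cells n m" by (simp add: cells_def)
  then show ?thesis using bij_betwE[OF t_bij] bij_betw_inv_into_left[OF t_bij c] by (auto simp: rw_def cl_def)
qed

lemma t_pos: "p \<in> {1..NB} \<Longrightarrow> rw p \<le> n \<and> cl p \<le> m \<and> t (rw p, cl p) = p"
proof -
  assume p: "p \<in> {1..NB}"
  have "inv_into (cells n m) t p \<in> cells n m" using bij_betwE[OF bij_betw_inv_into[OF t_bij]] p by blast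
  moreover have "t (inv_into (cells n m) t p) = p" using bij_betw_inv_into_right[OF t_bij p] .
  ultimately show ?thesis by (auto simp: rw_def cl_def cells_def)
qed

lemma row_stab_eq: "row_stab n m t = {s \<in> sg NB. \<forall>p\<in>{1..NB}. rw (s p) = rw p}"
proof (intro set_eqI iffI)
  fix s assume s: "s \<in> row_stab n m t"
  have "rw (s p) = rw p" if p: "p \<in> {1..NB}" for p
  proof -
    have "(rw p, cl p) \<in> cells n m" using t_pos[OF p] by (simp add: cells_def)
    then obtain b where b: "b \<le> m" "s (t (rw p, cl p)) = t (rw p, b)" using s unfolding row_stab_def by auto
    then have "s p = t (rw p, b)" using t_pos[OF p] by simp
    then show ?thesis using t_cell[of "rw p" b] b t_pos[OF p] by simp
  qed
  then show "s \<in> {s \<in> sg NB. \<forall>p\<in>{1..NB}. rw (s p) = rw p}" using s by (simp add: row_stab_def sg_def)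
next
  fix s assume s: "s \<in> {s \<in> sg NB. \<forall>p\<in>{1..NB}. rw (s p) = rw p}"
  have "\<exists>b\<le>m. s (t c) = t (fst c, b)" if c: "c \<in> cells n m" for c
  proof -
    have tc: "t c \<in> {1..NB}" "rw (t c) = fst c" using t_cell[of "fst c" "snd c"] c by (auto simp: cells_def)
    have "s (t c) \<in> {1..NB}" using tc s permutes_in_image[of s "{1..NB}"] by (simp add: sg_def)
    moreover have "rw (s (t c)) = fst c" using s tc by simp
    ultimately show ?thesis using t_pos[of "s (t c)"] by (intro exI[of _ "cl (s (t c))"]) auto
  qed
  then show "s \<in> row_stab n m t" using s by (simp add: row_stab_def sg_def)
qed

lemma col_stab_eq: "col_stab n m t = {s \<in> sg NB. \<forall>p\<in>{1..NB}. cl (s p) = cl p}"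
proof (intro set_eqI iffI)
  fix s assume s: "s \<in> col_stab n m t"
  have "cl (s p) = cl p" if p: "p \<in> {1..NB}" for p
  proof -
    have "(rw p, cl p) \<in> cells n m" using t_pos[OF p] by (simp add: cells_def)
    then obtain a where a: "a \<le> n" "s (t (rw p, cl p)) = t (a, cl p)" using s unfolding col_stab_def by auto
    then have "s p = t (a, cl p)" using t_pos[OF p] by simp
    then show ?thesis using t_cell[of a "cl p"] a t_pos[OF p] by simp
  qed
  then show "s \<in> {s \<in> sg NB. \<forall>p\<in>{1..NB}. cl (s p) = cl p}" using s by (simp add: col_stab_def sg_def)
next
  fix s assume s: "s \<in> {s \<in> sg NB. \<forall>p\<in>{1..NB}. cl (s p) = cl p}"
  have "\<exists>a\<le>n. s (t c) = t (a, snd c)" if c: "c \<in> cells n m" for c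
  proof -
    have tc: "t c \<in> {1..NB}" "cl (t c) = snd c" using t_cell[of "fst c" "snd c"] c by (auto simp: cells_def)
    have "s (t c) \<in> {1..NB}" using tc s permutes_in_image[of s "{1..NB}"] by (simp add: sg_def)
    moreover have "cl (s (t c)) = snd c" using s tc by simp
    ultimately show ?thesis using t_pos[of "s (t c)"] by (intro exI[of _ "rw (s (t c))"]) auto
  qed
  then show "s \<in> col_stab n m t" using s by (simp add: col_stab_def sg_def)
qed

lemma stabs_sg: "s \<in> row_stab n m t \<Longrightarrow> s \<in> sg NB" "s \<in> col_stab n m t \<Longrightarrow> s \<in> sg NB"
  by (auto simp: row_stab_eq col_stab_eq)

lemma sg_perm: "s \<in> sg N \<Longrightarrow> permutation s"
  using permutes_imp_permutation by (auto simp: sg_def)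

text \<open>Twisting by the sign character exchanges the parities: now transposing equal even
  letters gives \<open>- 1\<close>, so the letters that may not repeat in a column are the even
  ones.\<close>

lemma column_straightening:
  "straightening NB m n (\<lambda>b i. t (i, b)) cl rw (\<lambda>s I. of_int (sign s) * ks NB s I) (\<lambda>z. \<not> par_ix z)"
proof
  show "of_int (sign (s \<circ> u)) * ks NB (s \<circ> u) I = of_int (sign s) * ks NB s (act u I) * (of_int (sign u) * ks NB u I)"
    if "s \<in> sg NB" "u \<in> sg NB" for s u I
    using that by (simp add: sign_compose sg_perm ks_comp_sg del: o_apply)
  show "of_int (sign s) * ks NB s I * (of_int (sign s) * ks NB s I) = 1" for s I
  proof -
    have "(of_int (sign s) * of_int (sign s) :: complex) = 1" by (simp flip: of_int_mult)
    then show ?thesis using ks_sq[of NB s I] by (simp add: mult.assoc mult.left_commute[of "ks NB s I"])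
  qed
  show "of_int (sign (transpose a b)) * ks NB (transpose a b) I = (if \<not> par_ix (I a) then - 1 else 1)"
    if "a \<in> {1..NB}" "b \<in> {1..NB}" "a \<noteq> b" "I a = I b" for a b I
    using ks_transpose_eq[OF that(1,2,3), of I] that by (simp add: sign_swap_id)
qed (use t_cell t_pos in blast)+

lemma row_straightening:
  "straightening NB n m (\<lambda>b i. t (b, i)) rw cl (ks NB) par_ix"
proof
  show "ks NB (s \<circ> u) I = ks NB s (act u I) * ks NB u I" if "s \<in> sg NB" "u \<in> sg NB" for s u I
    using that by (rule ks_comp_sg)
  show "ks NB (transpose a b) I = (if par_ix (I a) then - 1 else 1)"
    if "a \<in> {1..NB}" "b \<in> {1..NB}" "a \<noteq> b" "I a = I b" for a b I
    using ks_transpose_eq[OF that(1,2,3), of I] that by simp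
qed (use t_cell t_pos ks_sq in blast)+

lemma Pt_sum: "Pt n m t I J = (\<Sum>r\<in>row_stab n m t. \<Sum>s\<in>col_stab n m t.
    scl (of_int (sign s) * ks NB (r \<circ> s) I) (Zmon NB (act (r \<circ> s) I) J))"
  by (auto simp: Pt_def fun_eq_iff sum_fun_apply ks_def)

lemma Pt_column:
  "Pt n m t I J = straightening.F NB cl rw (\<lambda>s I. of_int (sign s) * ks NB s I) (\<lambda>I. Zmon NB I J) I"
proof -
  interpret S: straightening NB m n "\<lambda>b i. t (i, b)" cl rw "\<lambda>s I. of_int (sign s) * ks NB s I" "\<lambda>z. \<not> par_ix z" "\<lambda>I. Zmon NB I J"
    by (rule column_straightening)
  show ?thesis
    unfolding Pt_sum S.F_def S.In_def S.Out_def row_stab_eq[symmetric] col_stab_eq[symmetric]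
  proof (intro sum.cong refl)
    fix r s assume rs: "r \<in> row_stab n m t" "s \<in> col_stab n m t"
    have "sign r * sign (r \<circ> s) = sign s"
      using sign_compose[OF sg_perm[OF stabs_sg(1)[OF rs(1)]] sg_perm[OF stabs_sg(2)[OF rs(2)]]]
      by (simp add: mult.assoc[symmetric])
    then have "(of_int (sign s) :: complex) = of_int (sign r) * of_int (sign (r \<circ> s))" by (simp flip: of_int_mult)
    then show "scl (of_int (sign s) * ks NB (r \<circ> s) I) (Zmon NB (act (r \<circ> s) I) J)
      = scl (of_int (sign r) * (of_int (sign (r \<circ> s)) * ks NB (r \<circ> s) I)) (Zmon NB (act (r \<circ> s) I) J)"
      by (simp only: mult.assoc)
  qed
qed

lemma stab_inv: "s \<in> row_stab n m t \<Longrightarrow> inv s \<in> row_stab n m t" "s \<in> col_stab n m t \<Longrightarrow> inv s \<in> col_stab n m t"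
proof -
  interpret S: straightening NB n m "\<lambda>b i. t (b, i)" rw cl "ks NB" par_ix "\<lambda>I. 0"
    by (rule row_straightening)
  show "s \<in> row_stab n m t \<Longrightarrow> inv s \<in> row_stab n m t"
    using S.In_inv unfolding S.In_def row_stab_eq .
  interpret S': straightening NB m n "\<lambda>b i. t (i, b)" cl rw "\<lambda>s I. of_int (sign s) * ks NB s I" "\<lambda>z. \<not> par_ix z" "\<lambda>I. 0"
    by (rule column_straightening)
  show "s \<in> col_stab n m t \<Longrightarrow> inv s \<in> col_stab n m t"
    using S'.In_inv unfolding S'.In_def col_stab_eq .
qed

text \<open>By invariance under simultaneous permutations, the symmetrizer may be moved from the first argument to the second.\<close>

lemma swd_row:
  assumes phi: "\<And>r s. par (phi r s) = (par_ix r \<noteq> par_ix s)"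
  shows "(\<Sum>r\<in>row_stab n m t. \<Sum>s\<in>col_stab n m t.
      scl (of_int (sign s) * ks NB (r \<circ> s) I) (swd par phi NB (act (r \<circ> s) I) J))
    = straightening.F NB rw cl (ks NB) (\<lambda>J. swd par phi NB I J) J"
proof -
  interpret S: straightening NB n m "\<lambda>b i. t (b, i)" rw cl "ks NB" par_ix "\<lambda>J. swd par phi NB I J"
    by (rule row_straightening)
  let ?R = "row_stab n m t" and ?C = "col_stab n m t"
  have "scl (of_int (sign s) * ks NB (r \<circ> s) I) (swd par phi NB (act (r \<circ> s) I) J)
     = scl (of_int (sign (inv s)) * ks NB (inv s \<circ> inv r) J) (swd par phi NB I (act (inv s \<circ> inv r) J))"
    if "r \<in> ?R" "s \<in> ?C" for r s
  proof -
    define x where "x = r \<circ> s"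
    have rs: "r \<in> sg NB" "s \<in> sg NB" using stabs_sg that by auto
    have x: "x \<in> sg NB" unfolding x_def using rs by (rule sg_comp)
    have ix: "inv s \<circ> inv r = inv x" unfolding x_def using sg_bij[OF rs(1)] sg_bij[OF rs(2)] by (simp add: o_inv_distrib)
    have sgn: "sign (inv s) = sign s" using sign_inverse sg_perm rs by blast
    have "swd par phi NB (act x I) J = swd par phi NB (act x I) (act x (act (inv x) J))"
      unfolding act_inv_cancel(1)[OF x] ..
    also have "\<dots> = scl (ks NB x I * ks NB x (act (inv x) J)) (swd par phi NB I (act (inv x) J))"
      by (rule swd_act[where phi = phi and par = par, OF phi x])
    also have "ks NB x (act (inv x) J) = ks NB (inv x) J"
      using ks_inv[OF sg_permutes[OF sg_inv[OF x]], of J] sg_bij[OF x] by (simp add: inv_inv_eq)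
    finally show ?thesis unfolding ix x_def[symmetric] sgn scl_scl by (simp add: mult.assoc del: scl_apply)
  qed
  then have "(\<Sum>r\<in>?R. \<Sum>s\<in>?C. scl (of_int (sign s) * ks NB (r \<circ> s) I) (swd par phi NB (act (r \<circ> s) I) J))
    = (\<Sum>r\<in>?R. \<Sum>s\<in>?C. scl (of_int (sign (inv s)) * ks NB (inv s \<circ> inv r) J) (swd par phi NB I (act (inv s \<circ> inv r) J)))"
    by (intro sum.cong refl)
  also have "\<dots> = (\<Sum>h\<in>?R. \<Sum>g\<in>?C. scl (of_int (sign g) * ks NB (g \<circ> h) J) (swd par phi NB I (act (g \<circ> h) J)))"
  proof -
    define u where "u g h = scl (of_int (sign g) * ks NB (g \<circ> h) J) (swd par phi NB I (act (g \<circ> h) J))" for g h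
    have ii: "inv (inv s) = s" if "s \<in> ?R \<or> s \<in> ?C" for s
      using that stabs_sg sg_bij by (metis inv_inv_eq)
    have "(\<Sum>r\<in>?R. \<Sum>s\<in>?C. u (inv s) (inv r)) = (\<Sum>r\<in>?R. \<Sum>s\<in>?C. u s (inv r))"
    proof (rule sum.cong[OF refl])
      fix r
      show "(\<Sum>s\<in>?C. u (inv s) (inv r)) = (\<Sum>s\<in>?C. u s (inv r))"
        by (rule sum.reindex_bij_witness[where i = inv and j = inv]) (use stab_inv ii in auto)
    qed
    also have "\<dots> = (\<Sum>r\<in>?R. \<Sum>s\<in>?C. u s r)"
      by (rule sum.reindex_bij_witness[where i = inv and j = inv]) (use stab_inv ii in auto)
    finally show ?thesis unfolding u_def .
  qed
  also have "\<dots> = (\<Sum>g\<in>?C. \<Sum>h\<in>?R. scl (of_int (sign g) * ks NB (g \<circ> h) J) (swd par phi NB I (act (g \<circ> h) J)))"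
    by (rule sum.swap)
  finally show ?thesis
    unfolding S.F_def S.In_def S.Out_def row_stab_eq[symmetric] col_stab_eq[symmetric] .
qed

text \<open>Above an even entry all entries are even and strictly increase, so an even entry in row
  \<open>a\<close>, counted from 0, has index above \<open>a\<close>. The last row therefore has
  only odd entries; they increase strictly, and \<open>m + 1\<close> of them do not fit into
  \<open>m\<close> indices.\<close>

lemma no_semistandard:
  assumes K: "\<And>p. p \<in> {1..NB} \<Longrightarrow> K p \<in> Rset n m"
    and row: "\<And>a b. a \<le> n \<Longrightarrow> b < m \<Longrightarrow> K (t (a, b)) \<le> K (t (a, Suc b)) \<and> (K (t (a, b)) = K (t (a, Suc b)) \<longrightarrow> \<not> par_ix (K (t (a, b))))"
    and col: "\<And>a b. a < n \<Longrightarrow> b \<le> m \<Longrightarrow> K (t (a, b)) \<le> K (t (Suc a, b)) \<and> (K (t (a, b)) = K (t (Suc a, b)) \<longrightarrow> par_ix (K (t (a, b))))"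
  shows False
proof -
  have R: "K (t (a, b)) \<in> Rset n m" if "a \<le> n" "b \<le> m" for a b using K t_cell[OF that] by blast
  have ev: "a < snd (K (t (a, b)))" if "a \<le> n" "b \<le> m" "\<not> par_ix (K (t (a, b)))" for a b
    using that
  proof (induction a)
    case 0
    then show ?case using R[of 0 b] by (auto simp: Rset_def)
  next
    case (Suc a)
    have c: "K (t (a, b)) \<le> K (t (Suc a, b))" "K (t (a, b)) = K (t (Suc a, b)) \<longrightarrow> par_ix (K (t (a, b)))"
      using col[of a b] Suc.prems by auto
    have np: "\<not> par_ix (K (t (a, b)))" using c(1) Suc.prems(3) by (auto simp: par_ix_def less_eq_prod_def)
    then have "a < snd (K (t (a, b)))" using Suc by simp
    moreover have "snd (K (t (a, b))) < snd (K (t (Suc a, b)))"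
    proof -
      have "K (t (a, b)) < K (t (Suc a, b))" using c np by (auto simp: less_le)
      then show ?thesis using np Suc.prems(3) by (auto simp: par_ix_def less_prod_def)
    qed
    ultimately show ?case by simp
  qed
  have od: "par_ix (K (t (n, b)))" if "b \<le> m" for b
  proof (rule ccontr)
    assume np: "\<not> par_ix (K (t (n, b)))"
    then have "n < snd (K (t (n, b)))" using ev[of n b] that by simp
    then show False using R[of n b] np that by (auto simp: Rset_def par_ix_def)
  qed
  have "b < snd (K (t (n, b)))" if "b \<le> m" for b
    using that
  proof (induction b)
    case 0
    then show ?case using R[of n 0] by (auto simp: Rset_def)
  next
    case (Suc b)
    have "K (t (n, b)) < K (t (n, Suc b))" using row[of n b] od[of b] Suc.prems by (auto simp: less_le)
    then have "snd (K (t (n, b))) < snd (K (t (n, Suc b)))"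
      using od[of b] od[of "Suc b"] Suc.prems by (auto simp: par_ix_def less_prod_def)
    then show ?case using Suc by simp
  qed
  then have "m < snd (K (t (n, m)))" by simp
  then show False using R[of n m] od[of m] by (auto simp: Rset_def par_ix_def)
qed

text \<open>Straightening with the zero space as target: \<open>no_semistandard\<close> leaves no
  good sequence to check.\<close>

lemma row_symmetrizer_zero:
  assumes K: "K \<in> Kset NB n m"
  shows "straightening.F NB rw cl (ks NB) (Y :: (nat \<Rightarrow> ix) \<Rightarrow> 'c \<Rightarrow> complex) K = 0"
proof -
  interpret S: straightening NB n m "\<lambda>b i. t (b, i)" rw cl "ks NB" par_ix Y
    by (rule row_straightening)
  have "S.F K \<in> {0}"
  proof (rule S.straighten[where R = "Rset n m"])
    show "K p \<in> Rset n m" if "p \<in> {1..NB}" for p using K that by (auto simp: Kset_def)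
    fix J :: "nat \<Rightarrow> ix" assume J: "S.good J" "\<And>p. p \<in> {1..NB} \<Longrightarrow> J p \<in> Rset n m"
    have False by (rule no_semistandard[of J]) (use J in \<open>auto simp: S.good_def\<close>)
    then show "S.F J \<in> {0}" ..
  qed (simp_all del: zero_fun_apply plus_fun_apply)
  then show ?thesis by simp
qed

text \<open>In the expansion over \<open>K\<close> the symmetrizer acts on the first argument of
  \<open>X(I,K)\<close>; \<open>swd_row\<close> moves it to \<open>K\<close>, whose letters come
  from \<open>V\<close>, and there it vanishes.\<close>

theorem Phi_Pt: "Phi n m (Pt n m t I J) = 0"
proof -
  let ?R = "row_stab n m t" and ?C = "col_stab n m t"
  have fs: "fsupp (scl c (Zmon NB I' J))" for c I' by (intro fsupp_scl fsupp_Zmon)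
  let ?X = "\<lambda>I K. swd par_A phiX NB I K" and ?Y = "\<lambda>K. swd par_A phiY NB K J"
  have "Phi n m (Pt n m t I J) = (\<Sum>r\<in>?R. \<Sum>s\<in>?C. \<Sum>K\<in>Kset NB n m. scl (cross NB (pr K) (pr K))
     (smult par_A (scl (of_int (sign s) * ks NB (r \<circ> s) I) (?X (act (r \<circ> s) I) K)) (?Y K)))"
    unfolding Pt_sum
    by (simp only: Phi_sum fsupp_sum fs Phi_scl fsupp_Zmon Phi_Zmon scl_sum smult_scl_left scl_scl mult.commute[of "cross _ _ _"])
  also have "\<dots> = (\<Sum>r\<in>?R. \<Sum>K\<in>Kset NB n m. \<Sum>s\<in>?C. scl (cross NB (pr K) (pr K))
     (smult par_A (scl (of_int (sign s) * ks NB (r \<circ> s) I) (?X (act (r \<circ> s) I) K)) (?Y K)))"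
    by (rule sum.cong[OF refl], rule sum.swap)
  also have "\<dots> = (\<Sum>K\<in>Kset NB n m. \<Sum>r\<in>?R. \<Sum>s\<in>?C. scl (cross NB (pr K) (pr K))
     (smult par_A (scl (of_int (sign s) * ks NB (r \<circ> s) I) (?X (act (r \<circ> s) I) K)) (?Y K)))"
    by (rule sum.swap)
  also have "\<dots> = (\<Sum>K\<in>Kset NB n m. scl (cross NB (pr K) (pr K)) (smult par_A (\<Sum>r\<in>?R. \<Sum>s\<in>?C.
       scl (of_int (sign s) * ks NB (r \<circ> s) I) (?X (act (r \<circ> s) I) K)) (?Y K)))"
    by (simp only: smult_sum_left scl_sum)
  also have "\<dots> = 0"
  proof (rule sum.neutral, rule ballI)
    fix K assume K: "K \<in> Kset NB n m"
    have "(\<Sum>r\<in>?R. \<Sum>s\<in>?C. scl (of_int (sign s) * ks NB (r \<circ> s) I) (?X (act (r \<circ> s) I) K)) = 0"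
      by (rule trans[OF swd_row row_symmetrizer_zero[OF K]]) (simp add: par_A_def)
    then show "scl (cross NB (pr K) (pr K)) (smult par_A (\<Sum>r\<in>?R. \<Sum>s\<in>?C.
       scl (of_int (sign s) * ks NB (r \<circ> s) I) (?X (act (r \<circ> s) I) K)) (?Y K)) = 0"
      by (simp only: smult_zero_left scl_0_right)
  qed
  finally show ?thesis .
qed

lemma Pt_row: "Pt n m t I J = straightening.F NB rw cl (ks NB) (\<lambda>J. Zmon NB I J) J"
  unfolding Pt_sum Zmon_swd by (rule swd_row) (simp add: par_Z_def)

text \<open>As a function of \<open>I\<close> the symmetrizer applies the columns first, as a
  function of \<open>J\<close> the rows first. So \<open>I\<close> is straightened by columns for
  semistandard \<open>J\<close>, and then \<open>J\<close> by rows.\<close>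

theorem Pt_spanned:
  assumes fin: "finite RU" "finite RW" and IJ: "\<And>p. p \<in> {1..NB} \<Longrightarrow> I p \<in> RU" "\<And>p. p \<in> {1..NB} \<Longrightarrow> J p \<in> RW"
    and W: "0 \<in> W" "\<And>f g. f \<in> W \<Longrightarrow> g \<in> W \<Longrightarrow> f + g \<in> W" "\<And>c f. f \<in> W \<Longrightarrow> scl c f \<in> W"
    and gen: "\<And>I J. semistandard n m t RU I \<Longrightarrow> semistandard n m t RW J \<Longrightarrow> Pt n m t I J \<in> W"
  shows "Pt n m t I J \<in> W"
proof -
  have 1: "Pt n m t I J \<in> W" if J: "semistandard n m t RW J" and I: "\<And>p. p \<in> {1..NB} \<Longrightarrow> I p \<in> RU" for I J
  proof -
    interpret S: straightening NB m n "\<lambda>b i. t (i, b)" cl rw "\<lambda>s I. of_int (sign s) * ks NB s I" "\<lambda>z. \<not> par_ix z" "\<lambda>I. Zmon NB I J"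
      by (rule column_straightening)
    show ?thesis unfolding Pt_column
    proof (rule S.straighten[OF fin(1) I W])
      fix I' :: "nat \<Rightarrow> ix" assume "S.good I'" "\<And>p. p \<in> {1..NB} \<Longrightarrow> I' p \<in> RU"
      then have "semistandard n m t RU I'" by (auto simp: semistandard_def S.good_def)
      then show "S.F I' \<in> W" using gen[OF _ J] unfolding Pt_column by blast
    qed
  qed
  interpret S: straightening NB n m "\<lambda>b i. t (b, i)" rw cl "ks NB" par_ix "\<lambda>J. Zmon NB I J"
    by (rule row_straightening)
  show ?thesis unfolding Pt_row
  proof (rule S.straighten[OF fin(2) IJ(2) W])
    fix J' :: "nat \<Rightarrow> ix" assume "S.good J'" "\<And>p. p \<in> {1..NB} \<Longrightarrow> J' p \<in> RW"
    then have "semistandard n m t RW J'" by (auto simp: semistandard_def S.good_def)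
    then have "Pt n m t I J' \<in> W" by (rule 1) (rule IJ(1))
    then show "S.F J' \<in> W" unfolding Pt_row .
  qed
qed

end

subsection \<open>Ideals\<close>

lemma spolys_on_add: "f \<in> spolys_on par X \<Longrightarrow> g \<in> spolys_on par X \<Longrightarrow> f + g \<in> spolys_on par X"
proof -
  assume f: "f \<in> spolys_on par X" and g: "g \<in> spolys_on par X"
  have "{v. m v \<noteq> 0} \<subseteq> X" if "(f + g) m \<noteq> 0" for m
  proof -
    have "f m \<noteq> 0 \<or> g m \<noteq> 0" using that by auto
    then show ?thesis using f g unfolding spolys_on_def by blast
  qed
  moreover have "fsupp (f + g)" "reduced par (f + g)"
    using f g fsupp_add[of f g] by (auto simp: spolys_on_def spolys_iff reduced_def)
  ultimately show ?thesis by (simp add: spolys_on_def spolys_iff del: plus_fun_apply)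
qed

lemma spolys_on_scl: "f \<in> spolys_on par X \<Longrightarrow> scl c f \<in> spolys_on par X"
  unfolding spolys_on_def spolys_iff by (auto simp: reduced_def fsupp_scl)

lemma spolys_on_0: "0 \<in> spolys_on par X"
  by (auto simp: spolys_on_def spolys_def)

lemma spolys_on_sum: "(\<And>i. i \<in> A \<Longrightarrow> f i \<in> spolys_on par X) \<Longrightarrow> (\<Sum>i\<in>A. f i) \<in> spolys_on par X"
  by (induction A rule: infinite_finite_induct) (simp_all add: spolys_on_add spolys_on_0 del: plus_fun_apply zero_fun_apply)

lemma spolys_on_sone: "sone \<in> spolys_on par X"
  by (auto simp: spolys_on_def spolys_def sone_def valid_mono_def)

lemma spolys_on_svar: "v \<in> X \<Longrightarrow> svar v \<in> spolys_on par X"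
  by (auto simp: spolys_on_def spolys_def svar_def valid_mono_def)

lemma spolys_on_smult:
  assumes "f \<in> spolys_on par X" "g \<in> spolys_on par X" shows "smult par f g \<in> spolys_on par X"
proof -
  have "{v. m v \<noteq> 0} \<subseteq> X" if "smult par f g m \<noteq> 0" for m
  proof -
    have "\<exists>m1. m1 \<le> m \<and> f m1 \<noteq> 0 \<and> g (m - m1) \<noteq> 0"
    proof -
      have "(\<Sum>m1\<in>{m1. m1 \<le> m}. mono_sign par m1 (m - m1) * f m1 * g (m - m1)) \<noteq> 0"
        using that by (simp add: smult_def split: if_splits)
      from sum.not_neutral_contains_not_neutral[OF this] show ?thesis by auto
    qed
    then obtain m1 where m1: "m1 \<le> m" "f m1 \<noteq> 0" "g (m - m1) \<noteq> 0" by blast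
    then have "{v. m1 v \<noteq> 0} \<subseteq> X" "{v. (m - m1) v \<noteq> 0} \<subseteq> X" using assms unfolding spolys_on_def by blast+
    moreover have "{v. m v \<noteq> 0} \<subseteq> {v. m1 v \<noteq> 0} \<union> {v. (m - m1) v \<noteq> 0}" by auto
    ultimately show ?thesis by blast
  qed
  moreover have "smult par f g \<in> spolys par"
    using assms fsupp_smult reduced_smult unfolding spolys_on_def spolys_iff by blast
  ultimately show ?thesis by (simp add: spolys_on_def)
qed

lemma spolys_on_wprod: "set w \<subseteq> X \<Longrightarrow> wprod par w \<in> spolys_on par X"
  by (induction w) (auto simp: spolys_on_sone spolys_on_svar spolys_on_smult)

lemma word_set: "set (word phi N I J) = (\<lambda>x. phi (I x) (J x)) ` {1..N}"
  by (auto simp: word_def atLeastLessThanSuc_atLeastAtMost simp del: upt_Suc)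

lemma Zmon_spolys_on:
  "(\<And>p. p \<in> {1..N} \<Longrightarrow> I p \<in> RU) \<Longrightarrow> (\<And>p. p \<in> {1..N} \<Longrightarrow> J p \<in> RW) \<Longrightarrow> Zmon N I J \<in> spolys_on par_Z (RU \<times> RW)"
  unfolding Zmon_swd swd_def by (intro spolys_on_scl spolys_on_wprod) (auto simp: word_set)

lemma sideal_subset:
  assumes "G \<subseteq> spolys_on par X" "f \<in> sideal par (spolys_on par X) G"
  shows "f \<in> spolys_on par X"
  using assms(2) by induction (blast intro: subsetD[OF assms(1)] spolys_on_0 spolys_on_add spolys_on_smult)+

lemma sideal_scl:
  assumes "G \<subseteq> spolys_on par X" "f \<in> sideal par (spolys_on par X) G"
  shows "scl c f \<in> sideal par (spolys_on par X) G"
proof -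
  have "reduced par f" using sideal_subset[OF assms] by (simp add: spolys_on_def spolys_iff)
  then have "smult par (scl c sone) f = scl c f" by (simp add: smult_sone_left del: scl_apply)
  moreover have "smult par (scl c sone) f \<in> sideal par (spolys_on par X) G"
    by (intro sideal.mult_left assms(2) spolys_on_scl spolys_on_sone)
  ultimately show ?thesis by simp
qed

lemma sideal_sum:
  "(\<And>i. i \<in> A \<Longrightarrow> f i \<in> sideal par C G) \<Longrightarrow> (\<Sum>i\<in>A. f i) \<in> sideal par C G"
  by (induction A rule: infinite_finite_induct) (auto intro: sideal.zero sideal.add simp del: plus_fun_apply zero_fun_apply)

lemma fsupp_Phi: "fsupp (Phi n m f)"
  unfolding Phi_def seval_lin lin_def by (intro fsupp_sum fsupp_scl fsupp_iprod fsupp_scal)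

lemma lin_scl_Phi: "lin F (scl c (Phi n m f)) = scl c (lin F (Phi n m f))"
  by (rule lin_scl[OF fsupp_Phi[unfolded fsupp_def]])

lemma Phi_smult: "f \<in> spolys par_Z \<Longrightarrow> g \<in> spolys par_Z \<Longrightarrow> Phi n m (smult par_Z f g) = smult par_A (Phi n m f) (Phi n m g)"
  unfolding Phi_def by (rule seval_smult[OF scal_swap])

subsection \<open>Embedding the tableau into longer sequences\<close>

lemma pairs_diff: "(a, b) \<in> pairs N - pairs M \<Longrightarrow> b < a \<and> 1 \<le> b \<and> M < a"
  by (simp add: pairs_def) linarith

text \<open>Positions beyond \<open>M\<close> are fixed and stay larger than all others, so they
  take part in no inversion.\<close>

lemma ks_mono:
  assumes "M \<le> N" "x \<in> sg M" shows "ks N x I = ks M x I"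
proof -
  have p: "inv x permutes {1..M}" using sg_permutes[OF sg_inv[OF assms(2)]] .
  show ?thesis unfolding ks_def csign_prod
  proof (rule prod.mono_neutral_right)
    show "pairs M \<subseteq> pairs N" using assms(1) by (auto simp: pairs_def)
    show "\<forall>q\<in>pairs N - pairs M. (case q of (a, b) \<Rightarrow>
        if inv x a < inv x b \<and> par_ix (I (inv x a)) \<and> par_ix (I (inv x b)) then - 1 else (1 :: complex)) = 1"
    proof
      fix q assume "q \<in> pairs N - pairs M"
      then obtain a b where q: "q = (a, b)" "b < a" "a \<notin> {1..M}" "1 \<le> b" "a > M"
        using pairs_diff by (cases q) auto
      have "inv x a = a" using permutes_not_in[OF p q(3)] .
      moreover have "inv x b < a"
      proof (cases "b \<in> {1..M}")
        case True
        then have "inv x b \<in> {1..M}" using permutes_in_image[OF p] by blast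
        then show ?thesis using q by auto
      qed (use permutes_not_in[OF p] q in simp)
      ultimately show "(case q of (a, b) \<Rightarrow>
        if inv x a < inv x b \<and> par_ix (I (inv x a)) \<and> par_ix (I (inv x b)) then - 1 else (1 :: complex)) = 1" using q by simp
    qed
  qed simp
qed

text \<open>In the pairs outside \<open>pairs M\<close> the larger position lies beyond
  \<open>M\<close>, and that is the one at which the first sequence is read. So the extra sign is
  common to all terms of a symmetrizer acting on the first \<open>M\<close> positions.\<close>

lemma Zmon_split:
  assumes "M \<le> N" and I: "\<And>p. p > M \<Longrightarrow> I' p = I p"
  shows "Zmon N I' J = scl (\<Prod>(x, y)\<in>pairs N - pairs M. ss (par_ix (I x)) (par_ix (J y)))
     (smult par_Z (Zmon M I' J) (wprod par_Z (map (\<lambda>x. (I x, J x)) [Suc M..<Suc N])))"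
proof -
  have "[1..<Suc N] = [1..<Suc M] @ [Suc M..<Suc N]"
    using upt_add_eq_append[of 1 "Suc M" "N - M"] assms(1) by (simp del: upt_Suc)
  then have "word Pair N I' J = word Pair M I' J @ map (\<lambda>x. (I' x, J x)) [Suc M..<Suc N]"
    unfolding word_def by (simp only: map_append)
  also have "map (\<lambda>x. (I' x, J x)) [Suc M..<Suc N] = map (\<lambda>x. (I x, J x)) [Suc M..<Suc N]"
    using I by (intro map_cong) auto
  finally have w: "word Pair N I' J = word Pair M I' J @ map (\<lambda>x. (I x, J x)) [Suc M..<Suc N]" .
  have "cross N (pr I') (pr J) = (\<Prod>(x, y)\<in>pairs N - pairs M. ss (par_ix (I' x)) (par_ix (J y))) * cross M (pr I') (pr J)"
    unfolding cross_def using assms(1) by (intro prod.subset_diff finite_pairs) (auto simp: pairs_def)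
  also have "(\<Prod>(x, y)\<in>pairs N - pairs M. ss (par_ix (I' x)) (par_ix (J y)))
     = (\<Prod>(x, y)\<in>pairs N - pairs M. ss (par_ix (I x)) (par_ix (J y)))"
  proof (rule prod.cong[OF refl])
    fix q assume "q \<in> pairs N - pairs M"
    then obtain a b where "q = (a, b)" "M < a" using pairs_diff by (cases q) auto
    then show "(case q of (x, y) \<Rightarrow> ss (par_ix (I' x)) (par_ix (J y))) = (case q of (x, y) \<Rightarrow> ss (par_ix (I x)) (par_ix (J y)))"
      using I by simp
  qed
  finally show ?thesis unfolding Zmon_swd swd_def w iprod_append smult_scl_left scl_scl by (simp only:)
qed

text \<open>The factor \<open>y\<close> is absorbed by \<open>I\<close> and \<open>x\<close> by
  \<open>J\<close>, with a sign independent of \<open>z\<close>; translates of the symmetrizer thus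
  become the symmetrizer for other sequences.\<close>

lemma Tz_conj:
  assumes "x \<in> sg N" "y \<in> sg N" "z \<in> sg N"
  shows "Tz N I J (x \<circ> z \<circ> y) = scl (ks N y I * ks N (inv x) J) (Tz N (act y I) (act (inv x) J) z)"
proof -
  let ?I = "act y I" and ?J = "act (inv x) J"
  have a: "act (x \<circ> z \<circ> y) I = act x (act z ?I)"
    unfolding act_comp_sg[OF sg_comp[OF assms(1,3)] assms(2)] act_comp_sg[OF assms(1,3)] ..
  have k: "ks N (x \<circ> z \<circ> y) I = ks N x (act z ?I) * ks N z ?I * ks N y I"
    unfolding ks_comp_sg[OF sg_comp[OF assms(1,3)] assms(2)] ks_comp_sg[OF assms(1,3)] ..
  have kJ: "ks N x ?J = ks N (inv x) J"
    using ks_inv[OF sg_permutes[OF sg_inv[OF assms(1)]], of J] sg_bij[OF assms(1)] by (simp add: inv_inv_eq)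
  have "Zmon N (act x (act z ?I)) J = Zmon N (act x (act z ?I)) (act x ?J)"
    unfolding act_inv_cancel(1)[OF assms(1)] ..
  also have "\<dots> = scl (ks N x (act z ?I) * ks N (inv x) J) (Zmon N (act z ?I) ?J)"
    unfolding Zmon_act[OF assms(1)] kJ ..
  finally have Z: "Zmon N (act x (act z ?I)) J = scl (ks N x (act z ?I) * ks N (inv x) J) (Zmon N (act z ?I) ?J)" .
  have "ks N x (act z ?I) * ks N z ?I * ks N y I * (ks N x (act z ?I) * ks N (inv x) J)
     = (ks N x (act z ?I) * ks N x (act z ?I)) * (ks N y I * ks N (inv x) J * ks N z ?I)" by (simp only: mult_ac)
  then show ?thesis unfolding Tz_def a k Z scl_scl by (simp only: ks_sq mult_1_left)
qed

context rect_tableau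
begin

text \<open>After \<open>x\<close> and \<open>y\<close> are absorbed, the symmetrizer acts on the
  first \<open>NB\<close> positions only. The other positions contribute a common sign and a common
  monomial, so the sum is a multiple of \<open>Pt n m t I1 J1\<close>.\<close>

theorem tableau_in_ideal:
  assumes N: "NB \<le> N" and IJ: "\<And>p. p \<in> {1..N} \<Longrightarrow> I p \<in> Rset k l" "\<And>p. p \<in> {1..N} \<Longrightarrow> J p \<in> Rset p' q'"
    and xy: "x \<in> sg N" "y \<in> sg N"
    and Pt: "\<And>I J. (\<And>p. p \<in> {1..NB} \<Longrightarrow> I p \<in> Rset k l) \<Longrightarrow> (\<And>p. p \<in> {1..NB} \<Longrightarrow> J p \<in> Rset p' q') \<Longrightarrow>
       Pt n m t I J \<in> sideal par_Z (spolys_on par_Z (Rset k l \<times> Rset p' q')) G"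
    and G: "G \<subseteq> spolys_on par_Z (Rset k l \<times> Rset p' q')"
  shows "(\<Sum>r\<in>row_stab n m t. \<Sum>s\<in>col_stab n m t. scl (of_int (sign s)) (Tz N I J (x \<circ> (r \<circ> s) \<circ> y)))
    \<in> sideal par_Z (spolys_on par_Z (Rset k l \<times> Rset p' q')) G"
proof -
  let ?R = "row_stab n m t" and ?C = "col_stab n m t"
  define I1 J1 where "I1 = act y I" and "J1 = act (inv x) J"
  have in1: "I1 p \<in> Rset k l" "J1 p \<in> Rset p' q'" if "p \<in> {1..N}" for p
    using IJ that permutes_in_image[OF sg_permutes[OF sg_inv[OF xy(2)]], of p]
      permutes_in_image[OF sg_permutes[OF xy(1)], of p] sg_bij[OF xy(1)]
    by (auto simp: I1_def J1_def act_def inv_inv_eq)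
  define D where "D = (\<Prod>(a, b)\<in>pairs N - pairs NB. ss (par_ix (I1 a)) (par_ix (J1 b)))"
  define w where "w = map (\<lambda>x. (I1 x, J1 x)) [Suc NB..<Suc N]"
  have "scl (of_int (sign s)) (Tz N I J (x \<circ> (r \<circ> s) \<circ> y))
      = scl (ks N y I * ks N (inv x) J * D) (smult par_Z (scl (of_int (sign s) * ks NB (r \<circ> s) I1) (Zmon NB (act (r \<circ> s) I1) J1)) (wprod par_Z w))"
    if "r \<in> ?R" "s \<in> ?C" for r s
  proof -
    have rs: "r \<circ> s \<in> sg NB" using stabs_sg that sg_comp by blast
    have rsN: "r \<circ> s \<in> sg N" using stab_sg that N sg_comp by blast
    have "act (r \<circ> s) I1 p = I1 p" if "p > NB" for p
      using permutes_not_in[OF sg_permutes[OF sg_inv[OF rs]], of p] that by (simp add: act_def)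
    then have Z: "Zmon N (act (r \<circ> s) I1) J1 = scl D (smult par_Z (Zmon NB (act (r \<circ> s) I1) J1) (wprod par_Z w))"
      unfolding D_def w_def by (rule Zmon_split[OF N])
    show ?thesis
      unfolding Tz_conj[OF xy rsN] unfolding I1_def[symmetric] J1_def[symmetric] Tz_def Z ks_mono[OF N rs] scl_scl smult_scl_left
      by (simp only: mult_ac)
  qed
  then have "(\<Sum>r\<in>?R. \<Sum>s\<in>?C. scl (of_int (sign s)) (Tz N I J (x \<circ> (r \<circ> s) \<circ> y)))
     = (\<Sum>r\<in>?R. \<Sum>s\<in>?C. scl (ks N y I * ks N (inv x) J * D) (smult par_Z (scl (of_int (sign s) * ks NB (r \<circ> s) I1) (Zmon NB (act (r \<circ> s) I1) J1)) (wprod par_Z w)))"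
    by (intro sum.cong refl)
  also have "\<dots> = scl (ks N y I * ks N (inv x) J * D) (smult par_Z (Pt n m t I1 J1) (wprod par_Z w))"
    unfolding Pt_sum by (simp only: smult_sum_left scl_sum)
  also have "\<dots> \<in> sideal par_Z (spolys_on par_Z (Rset k l \<times> Rset p' q')) G"
  proof (intro sideal_scl[OF G] sideal.mult_right Pt spolys_on_wprod)
    show "I1 p \<in> Rset k l" "J1 p \<in> Rset p' q'" if "p \<in> {1..NB}" for p using in1[of p] that N by auto
    show "set w \<subseteq> Rset k l \<times> Rset p' q'" unfolding w_def using in1 by (auto simp del: upt_Suc)
  qed
  finally show ?thesis .
qed

end

section \<open>Kernel elements lie in the ideal\<close>

lemma wprod_sword_Zmon:
  fixes M :: "zvar mono"
  defines "w \<equiv> sword M"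
  defines "I \<equiv> sq (length w) fst w" and "J \<equiv> sq (length w) snd w"
  shows "wprod par_Z w = scl (cross (length w) (pr I) (pr J)) (Zmon (length w) I J)"
proof -
  have "w = word Pair (length w) I J"
    by (rule word_eqI) (auto simp: I_def J_def sq_def)
  then have "Zmon (length w) I J = scl (cross (length w) (pr I) (pr J)) (wprod par_Z w)"
    unfolding Zmon_swd swd_def by simp
  then show ?thesis using cross_sq[of "length w" "pr I" "pr J"] by (simp del: scl_apply)
qed

lemma set_sword: "valid_mono par M \<Longrightarrow> set (sword M) = {v. M v \<noteq> 0}"
  using count_list_sword[of M] by (auto simp: valid_mono_def) (metis count_list_0_iff not_gr_zero)+

theorem kernel_in_ideal:
  assumes t: "standard_tableau n m t" and f: "f \<in> ker_Phi k l p q n m"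
    and G: "G \<subseteq> spolys_on par_Z (Rset k l \<times> Rset p q)"
    and Pt: "\<And>I J. (\<And>i. i \<in> {1..Nbox n m} \<Longrightarrow> I i \<in> Rset k l) \<Longrightarrow> (\<And>i. i \<in> {1..Nbox n m} \<Longrightarrow> J i \<in> Rset p q) \<Longrightarrow>
       Pt n m t I J \<in> sideal par_Z (spolys_on par_Z (Rset k l \<times> Rset p q)) G"
  shows "f \<in> sideal par_Z (spolys_on par_Z (Rset k l \<times> Rset p q)) G"
proof -
  interpret rect_tableau n m t by standard (rule t)
  let ?Id = "sideal par_Z (spolys_on par_Z (Rset k l \<times> Rset p q)) G"
  let ?S = "{M. f M \<noteq> 0}"
  have fC: "f \<in> spolys_on par_Z (Rset k l \<times> Rset p q)" and f0: "Phi n m f = 0" using f by (auto simp: ker_Phi_def)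
  have fsp: "f \<in> spolys par_Z" using fC by (simp add: spolys_on_def)
  have finS: "finite ?S" using fsp by (simp add: spolys_def)
  define len where "len M = length (sword M)" for M :: "zvar mono"
  define I where "I M = sq (len M) fst (sword M)" for M :: "zvar mono"
  define J where "J M = sq (len M) snd (sword M)" for M :: "zvar mono"
  define c where "c M = f M * cross (len M) (pr (I M)) (pr (J M))" for M
  have fexp: "f = (\<Sum>M\<in>?S. scl (c M) (Zmon (len M) (I M) (J M)))"
  proof -
    have "f = (\<Sum>M\<in>?S. scl (f M) (wprod par_Z (sword M)))" by (rule spolys_expand[OF fsp])
    also have "\<dots> = (\<Sum>M\<in>?S. scl (c M) (Zmon (len M) (I M) (J M)))"
      unfolding wprod_sword_Zmon c_def len_def I_def J_def scl_scl ..
    finally show ?thesis .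
  qed
  have ext: "I M \<in> extensional {1..len M}" "J M \<in> extensional {1..len M}" for M
    by (auto simp: I_def J_def sq_def)
  have ent: "I M i \<in> Rset k l" "J M i \<in> Rset p q" if M: "M \<in> ?S" and i: "i \<in> {1..len M}" for M i
  proof -
    have "valid_mono par_Z M" using fsp M by (auto simp: spolys_def)
    then have "set (sword M) \<subseteq> Rset k l \<times> Rset p q" using fC M by (auto simp: set_sword spolys_on_def)
    moreover have "sword M ! (i - 1) \<in> set (sword M)" using i by (intro nth_mem) (auto simp: len_def)
    ultimately have "sword M ! (i - 1) \<in> Rset k l \<times> Rset p q" by blast
    then show "I M i \<in> Rset k l" "J M i \<in> Rset p q" using i by (auto simp: I_def J_def sq_def mem_Times_iff)
  qed
  have part: "(\<Sum>M\<in>{M\<in>?S. len M = N}. scl (c M) (Zmon N (I M) (J M))) \<in> ?Id" for N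
  proof -
    let ?T = "{M\<in>?S. len M = N}"
    \<comment> \<open>The sum over conjugates makes \<open>A\<close> constant on conjugacy classes,
      the form in which \<open>psi_Phi\<close> delivers its relations. \<open>E\<close> extends it
      linearly to the group algebra, and the aim is that \<open>E\<close> maps the whole span of
      \<open>bgen\<close> into the ideal.\<close>
    define A where "A s = (\<Sum>M\<in>?T. scl (c M) (\<Sum>h\<in>sg N. Tz N (I M) (J M) (inv h \<circ> s \<circ> h)))" for s
    define E where "E g = (\<Sum>s\<in>sg N. scl (of_real (g s)) (A s))" for g :: "(nat \<Rightarrow> nat) \<Rightarrow> real"
    have shift: "E (\<lambda>z. \<Sum>a\<in>Q. if z = e a then r a else 0) = (\<Sum>a\<in>Q. scl (of_real (r a)) (A (e a)))"
      if "\<And>a. a \<in> Q \<Longrightarrow> e a \<in> sg N" for Q :: "'z set" and e r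
    proof -
      have "E (\<lambda>z. \<Sum>a\<in>Q. if z = e a then r a else 0) = (\<Sum>s\<in>sg N. \<Sum>a\<in>Q. if s = e a then scl (of_real (r a)) (A s) else 0)"
        unfolding E_def
      proof (rule sum.cong[OF refl])
        fix s
        show "scl (of_real (\<Sum>a\<in>Q. if s = e a then r a else 0)) (A s) = (\<Sum>a\<in>Q. if s = e a then scl (of_real (r a)) (A s) else 0)"
          by (auto simp: fun_eq_iff sum_fun_apply sum_distrib_right intro!: sum.cong)
      qed
      also have "\<dots> = (\<Sum>a\<in>Q. \<Sum>s\<in>sg N. if s = e a then scl (of_real (r a)) (A s) else 0)" by (rule sum.swap)
      also have "\<dots> = (\<Sum>a\<in>Q. scl (of_real (r a)) (A (e a)))"
        using that by (intro sum.cong refl) (simp only: sum.delta finite_sg if_True)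
      finally show ?thesis .
    qed
    have "E g \<in> ?Id" if "g \<in> rfun.span (bgen N n m t)" for g
      using that
    proof (induction rule: rfun.span_induct)
      case base
      show ?case
      proof (rule rfun.subspaceI)
        have "E 0 = 0" by (auto simp: E_def fun_eq_iff sum_fun_apply)
        then show "0 \<in> {g. E g \<in> ?Id}" by (simp only: mem_Collect_eq sideal.zero)
        show "g + h \<in> {g. E g \<in> ?Id}" if "g \<in> {g. E g \<in> ?Id}" "h \<in> {g. E g \<in> ?Id}" for g h
        proof -
          have "E (g + h) = E g + E h" by (auto simp: E_def fun_eq_iff sum_fun_apply algebra_simps sum.distrib)
          then show ?thesis using that sideal.add by (simp only: mem_Collect_eq)
        qed
        show "rscl u g \<in> {g. E g \<in> ?Id}" if "g \<in> {g. E g \<in> ?Id}" for u g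
        proof -
          have "E (rscl u g) = scl (of_real u) (E g)" by (auto simp: E_def fun_eq_iff sum_fun_apply sum_distrib_left algebra_simps)
          then show ?thesis using that sideal_scl[OF G] by simp
        qed
      qed
    next
      case (step b)
      then consider (color) x y K where "b = (\<lambda>z. \<Sum>s\<in>stabK N K. if z = x \<circ> s \<circ> y then rks N s K else 0)"
          "x \<in> sg N" "y \<in> sg N" "K \<in> Kset N n m"
        | (tableau) x y where "b = (\<lambda>z. \<Sum>r\<in>row_stab n m t. \<Sum>s\<in>col_stab n m t. if z = x \<circ> (r \<circ> s) \<circ> y then of_int (sign s) else 0)"
          "x \<in> sg N" "y \<in> sg N" "Nbox n m \<le> N"
        unfolding bgen_def by blast
      then show ?case
      proof cases
        case color
        \<comment> \<open>Conjugation by \<open>x\<close> turns \<open>x \<circ> s \<circ> y\<close>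
          into \<open>s \<circ> u\<close>, which is the form treated by \<open>psi_Phi\<close>; the
          sum over \<open>h\<close> absorbs the conjugation.\<close>
        define u where "u = y \<circ> x"
        have us: "u \<in> sg N" unfolding u_def using color sg_comp by blast
        define L0 where "L0 = act (inv u) K"
        define e where "e = cross N (pr K) (pr K) * ks N u L0"
        have ee: "e * e = 1"
        proof -
          have "e * e = (cross N (pr K) (pr K) * cross N (pr K) (pr K)) * (ks N u L0 * ks N u L0)"
            unfolding e_def by (simp only: mult_ac)
          then show ?thesis by (simp only: cross_sq ks_sq mult_1_left)
        qed
        have ss: "s \<in> sg N" if "s \<in> stabK N K" for s using that by (simp add: stabK_def)
        have "E b = (\<Sum>s\<in>stabK N K. scl (ks N s K) (A (x \<circ> s \<circ> y)))"
          unfolding color(1) using color sg_comp ss by (subst shift) (auto simp: of_real_rks simp del: o_apply scl_apply)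
        also have "\<dots> = (\<Sum>s\<in>stabK N K. \<Sum>M\<in>?T. scl (c M) (\<Sum>h\<in>sg N. scl (ks N s K) (Tz N (I M) (J M) (inv h \<circ> (s \<circ> u \<circ> h)))))"
        proof (rule sum.cong[OF refl], unfold A_def, rule trans[OF scl_sum], rule sum.cong[OF refl])
          fix s M
          have "(\<Sum>h\<in>sg N. Tz N (I M) (J M) (inv h \<circ> (x \<circ> s \<circ> y) \<circ> h))
             = (\<Sum>h\<in>sg N. Tz N (I M) (J M) (inv h \<circ> (s \<circ> u \<circ> h)))"
          proof (rule sum.reindex_bij_witness[where i = "\<lambda>h. x \<circ> h" and j = "\<lambda>h. inv x \<circ> h"])
            fix h assume h: "h \<in> sg N"
            show "x \<circ> (inv x \<circ> h) = h" "inv x \<circ> (x \<circ> h) = h" using sg_cancel[OF color(2)] by auto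
            show "inv x \<circ> h \<in> sg N" "x \<circ> h \<in> sg N" using h color sg_comp sg_inv by blast+
            have "inv (inv x \<circ> h) = inv h \<circ> x"
              using sg_bij[OF h] sg_bij[OF color(2)] by (simp add: o_inv_distrib bij_imp_bij_inv inv_inv_eq)
            then have "inv (inv x \<circ> h) \<circ> (s \<circ> u \<circ> (inv x \<circ> h)) = inv h \<circ> x \<circ> (s \<circ> (y \<circ> x) \<circ> (inv x \<circ> h))"
              by (simp only: u_def)
            also have "\<dots> = inv h \<circ> (x \<circ> s \<circ> y) \<circ> h"
              by (simp only: comp_assoc sg_cancel(2)[OF color(2)])
            finally show "Tz N (I M) (J M) (inv (inv x \<circ> h) \<circ> (s \<circ> u \<circ> (inv x \<circ> h))) = Tz N (I M) (J M) (inv h \<circ> (x \<circ> s \<circ> y) \<circ> h)"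
              by (rule arg_cong)
          qed
          then show "scl (ks N s K) (scl (c M) (\<Sum>h\<in>sg N. Tz N (I M) (J M) (inv h \<circ> (x \<circ> s \<circ> y) \<circ> h)))
            = scl (c M) (\<Sum>h\<in>sg N. scl (ks N s K) (Tz N (I M) (J M) (inv h \<circ> (s \<circ> u \<circ> h))))"
            by (simp only: scl_sum[symmetric] scl_scl mult.commute)
        qed
        also have "\<dots> = (\<Sum>M\<in>?T. scl (c M) (\<Sum>h\<in>sg N. \<Sum>s\<in>stabK N K. scl (ks N s K) (Tz N (I M) (J M) (inv h \<circ> (s \<circ> u \<circ> h)))))"
          by (rule trans[OF sum.swap], rule sum.cong[OF refl], subst scl_sum[symmetric], rule arg_cong[where f = "scl _"], rule sum.swap)
        also have "\<dots> = (\<Sum>M\<in>?T. scl (c M) (scl e (lin (psiF N K L0) (Phi n m (Zmon N (I M) (J M))))))"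
        proof (intro sum.cong refl arg_cong[where f = "scl _"])
          fix M assume M: "M \<in> ?T"
          then have ext': "I M \<in> extensional {1..N}" "J M \<in> extensional {1..N}" using ext[of M] by auto
          have "lin (psiF N K L0) (Phi n m (Zmon N (I M) (J M))) = scl e
            (\<Sum>h\<in>sg N. \<Sum>s\<in>stabK N K. scl (ks N s K) (Tz N (I M) (J M) (inv h \<circ> (s \<circ> u \<circ> h))))"
            unfolding e_def L0_def by (rule psi_Phi[OF ext' color(4) us])
          then show "(\<Sum>h\<in>sg N. \<Sum>s\<in>stabK N K. scl (ks N s K) (Tz N (I M) (J M) (inv h \<circ> (s \<circ> u \<circ> h))))
            = scl e (lin (psiF N K L0) (Phi n m (Zmon N (I M) (J M))))" by (simp only: scl_scl ee scl_one)
        qed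
        also have "\<dots> = scl e (\<Sum>M\<in>?T. scl (c M) (lin (psiF N K L0) (Phi n m (Zmon (len M) (I M) (J M)))))"
          unfolding scl_sum by (intro sum.cong refl) (auto simp: mult.commute simp del: scl_apply)
        \<comment> \<open>Monomials of degree other than \<open>N\<close> contribute 0, so the sum
          may run over all of \<open>f\<close>; only then does \<open>Phi n m f = 0\<close>
          apply.\<close>
        also have "(\<Sum>M\<in>?T. scl (c M) (lin (psiF N K L0) (Phi n m (Zmon (len M) (I M) (J M)))))
           = (\<Sum>M\<in>?S. scl (c M) (lin (psiF N K L0) (Phi n m (Zmon (len M) (I M) (J M)))))"
          using lin_psi_Phi(1)[OF ext] finS by (intro sum.mono_neutral_left) (auto simp del: zero_fun_apply scl_apply)
        also have "\<dots> = lin (psiF N K L0) (Phi n m f)"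
        proof -
          have "Phi n m f = (\<Sum>M\<in>?S. scl (c M) (Phi n m (Zmon (len M) (I M) (J M))))"
            by (subst fexp) (simp only: Phi_sum fsupp_scl fsupp_Zmon Phi_scl)
          then show ?thesis
            by (simp only: lin_sum fsupp_scl fsupp_Phi lin_scl_Phi)
        qed
        also have "\<dots> = 0" unfolding f0 by (rule lin_zero)
        finally have "E b = 0" by (simp only: scl_0_right)
        then show ?thesis by (simp only: sideal.zero)
      next
        case tableau
        have Qs: "x \<circ> (fst a \<circ> snd a) \<circ> y \<in> sg N" if "a \<in> row_stab n m t \<times> col_stab n m t" for a
          using that tableau stab_sg sg_comp by (auto simp: mem_Times_iff simp del: o_apply)
        have "b = (\<lambda>z. \<Sum>a\<in>row_stab n m t \<times> col_stab n m t. if z = x \<circ> (fst a \<circ> snd a) \<circ> y then of_int (sign (snd a)) else 0)"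
          unfolding tableau(1) by (simp add: sum.cartesian_product case_prod_unfold del: o_apply)
        then have "E b = (\<Sum>a\<in>row_stab n m t \<times> col_stab n m t. scl (of_int (sign (snd a))) (A (x \<circ> (fst a \<circ> snd a) \<circ> y)))"
          using shift[of "row_stab n m t \<times> col_stab n m t" "\<lambda>a. x \<circ> (fst a \<circ> snd a) \<circ> y" "\<lambda>a. of_int (sign (snd a))"] Qs
          by (simp only: of_real_of_int_eq)
        also have "\<dots> = (\<Sum>r\<in>row_stab n m t. \<Sum>s\<in>col_stab n m t. scl (of_int (sign s)) (A (x \<circ> (r \<circ> s) \<circ> y)))"
          by (subst sum.cartesian_product) (simp only: case_prod_unfold)
        also have "\<dots> = (\<Sum>r\<in>row_stab n m t. \<Sum>s\<in>col_stab n m t. \<Sum>M\<in>?T. \<Sum>h\<in>sg N.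
            scl (c M) (scl (of_int (sign s)) (Tz N (I M) (J M) (inv h \<circ> x \<circ> (r \<circ> s) \<circ> (y \<circ> h)))))"
          unfolding A_def scl_sum by (intro sum.cong refl) (simp only: scl_scl comp_assoc mult.commute)
        also have "\<dots> = (\<Sum>r\<in>row_stab n m t. \<Sum>M\<in>?T. \<Sum>h\<in>sg N. \<Sum>s\<in>col_stab n m t.
            scl (c M) (scl (of_int (sign s)) (Tz N (I M) (J M) (inv h \<circ> x \<circ> (r \<circ> s) \<circ> (y \<circ> h)))))"
          by (rule sum.cong[OF refl], rule trans[OF sum.swap], rule sum.cong[OF refl], rule sum.swap)
        also have "\<dots> = (\<Sum>M\<in>?T. \<Sum>h\<in>sg N. \<Sum>r\<in>row_stab n m t. \<Sum>s\<in>col_stab n m t.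
            scl (c M) (scl (of_int (sign s)) (Tz N (I M) (J M) (inv h \<circ> x \<circ> (r \<circ> s) \<circ> (y \<circ> h)))))"
          by (rule trans[OF sum.swap], rule sum.cong[OF refl], rule sum.swap)
        also have "\<dots> = (\<Sum>M\<in>?T. \<Sum>h\<in>sg N. scl (c M) (\<Sum>r\<in>row_stab n m t. \<Sum>s\<in>col_stab n m t.
            scl (of_int (sign s)) (Tz N (I M) (J M) (inv h \<circ> x \<circ> (r \<circ> s) \<circ> (y \<circ> h)))))"
          by (simp only: scl_sum)
        also have "\<dots> \<in> ?Id"
        proof (rule sideal_sum, rule sideal_sum, rule sideal_scl[OF G])
          fix M h assume M: "M \<in> ?T" and h: "h \<in> sg N"
          show "(\<Sum>r\<in>row_stab n m t. \<Sum>s\<in>col_stab n m t.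
            scl (of_int (sign s)) (Tz N (I M) (J M) (inv h \<circ> x \<circ> (r \<circ> s) \<circ> (y \<circ> h)))) \<in> ?Id"
          proof (rule tableau_in_ideal[OF tableau(4) _ _ _ _ _ G])
            show "I M i \<in> Rset k l" "J M i \<in> Rset p q" if "i \<in> {1..N}" for i using ent[of M i] M that by auto
            show "inv h \<circ> x \<in> sg N" "y \<circ> h \<in> sg N" using h tableau sg_comp sg_inv by blast+
            fix I' J' :: "nat \<Rightarrow> ix"
            assume "\<And>i. i \<in> {1..NB} \<Longrightarrow> I' i \<in> Rset k l" "\<And>i. i \<in> {1..NB} \<Longrightarrow> J' i \<in> Rset p q"
            then show "Pt n m t I' J' \<in> ?Id" by (rule Pt)
          qed
        qed
        finally show ?thesis .
      qed
    qed
    then have "E (\<lambda>z. if z = id then 1 else 0) \<in> ?Id" using identity_in_span[OF t] by blast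
    \<comment> \<open>All conjugates of \<open>id\<close> are \<open>id\<close>, so the average
      reproduces the degree \<open>N\<close> part up to the order of the group.\<close>
    moreover have "E (\<lambda>z. if z = id then 1 else 0) = scl (of_nat (card (sg N))) (\<Sum>M\<in>?T. scl (c M) (Zmon N (I M) (J M)))"
    proof -
      have "E (\<lambda>z. if z = id then 1 else 0) = A id"
        using shift[of "{()}" "\<lambda>_. id" "\<lambda>_. 1"] sg_id by (simp del: id_apply)
      also have "\<dots> = (\<Sum>M\<in>?T. scl (c M) (\<Sum>h\<in>sg N. Zmon N (I M) (J M)))"
        unfolding A_def
      proof (intro sum.cong refl arg_cong[where f = "scl _"])
        fix M h assume "h \<in> sg N"
        then have "inv h \<circ> id \<circ> h = id" by (simp only: comp_id sg_inv_o)
        then show "Tz N (I M) (J M) (inv h \<circ> id \<circ> h) = Zmon N (I M) (J M)"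
          by (simp add: Tz_def del: id_apply)
      qed
      also have "\<dots> = scl (of_nat (card (sg N))) (\<Sum>M\<in>?T. scl (c M) (Zmon N (I M) (J M)))"
        unfolding scl_sum by (intro sum.cong refl) (auto simp: fun_eq_iff sum_fun_apply)
      finally show ?thesis .
    qed
    ultimately have "scl (of_nat (card (sg N))) (\<Sum>M\<in>?T. scl (c M) (Zmon N (I M) (J M))) \<in> ?Id" by simp
    from sideal_scl[OF G this, of "1 / of_nat (card (sg N))"]
    have "scl (1 / of_nat (card (sg N)) * of_nat (card (sg N))) (\<Sum>M\<in>?T. scl (c M) (Zmon N (I M) (J M))) \<in> ?Id"
      by (simp only: scl_scl)
    moreover have "card (sg N) \<noteq> 0" using sg_id[of N] by auto
    then have "1 / of_nat (card (sg N)) * of_nat (card (sg N)) = (1 :: complex)" by simp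
    ultimately show ?thesis by (simp only: scl_one)
  qed
  have "f = (\<Sum>N\<in>len ` ?S. \<Sum>M\<in>{M\<in>?S. len M = N}. scl (c M) (Zmon (len M) (I M) (J M)))"
    unfolding sum.group[OF finS finite_imageI[OF finS] subset_refl] by (rule fexp)
  also have "\<dots> = (\<Sum>N\<in>len ` ?S. \<Sum>M\<in>{M\<in>?S. len M = N}. scl (c M) (Zmon N (I M) (J M)))"
    by (intro sum.cong refl) auto
  also have "\<dots> \<in> ?Id" by (intro sideal_sum part)
  finally show ?thesis .
qed

theorem theorem2p2:
  fixes k l p q n m :: nat and t :: "nat \<times> nat \<Rightarrow> nat"
  assumes "standard_tableau n m t"
  shows "ker_Phi k l p q n m =
    sideal par_Z (spolys_on par_Z (Rset k l \<times> Rset p q))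
      {Pt n m t I J | I J. semistandard n m t (Rset k l) I \<and> semistandard n m t (Rset p q) J}"
proof -
  interpret rect_tableau n m t by standard (rule assms)
  let ?C = "spolys_on par_Z (Rset k l \<times> Rset p q)"
  let ?G = "{Pt n m t I J | I J. semistandard n m t (Rset k l) I \<and> semistandard n m t (Rset p q) J}"
  have PtC: "Pt n m t I J \<in> ?C"
    if I: "\<And>i. i \<in> {1..NB} \<Longrightarrow> I i \<in> Rset k l" and J: "\<And>i. i \<in> {1..NB} \<Longrightarrow> J i \<in> Rset p q" for I J
    unfolding Pt_sum
  proof (intro spolys_on_sum spolys_on_scl Zmon_spolys_on J)
    fix r s i assume rs: "r \<in> row_stab n m t" "s \<in> col_stab n m t" and i: "i \<in> {1..NB}"
    have "r \<circ> s \<in> sg NB" using rs stabs_sg sg_comp by blast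
    then have "inv (r \<circ> s) i \<in> {1..NB}" using permutes_in_image[OF sg_permutes[OF sg_inv]] i by blast
    then show "act (r \<circ> s) I i \<in> Rset k l" using I by (simp add: act_def)
  qed
  have G: "?G \<subseteq> ?C" using PtC by (auto simp: semistandard_def)
  show ?thesis
  proof
    show "ker_Phi k l p q n m \<subseteq> sideal par_Z ?C ?G"
    proof
      fix f assume "f \<in> ker_Phi k l p q n m"
      then show "f \<in> sideal par_Z ?C ?G"
      proof (rule kernel_in_ideal[OF assms _ G])
        fix I J :: "nat \<Rightarrow> ix"
        assume I: "\<And>i. i \<in> {1..NB} \<Longrightarrow> I i \<in> Rset k l" and J: "\<And>i. i \<in> {1..NB} \<Longrightarrow> J i \<in> Rset p q"
        show "Pt n m t I J \<in> sideal par_Z ?C ?G"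
        proof (rule Pt_spanned[OF finite_Rset finite_Rset I J sideal.zero sideal.add sideal_scl[OF G]])
          fix I' J' :: "nat \<Rightarrow> ix"
          assume "semistandard n m t (Rset k l) I'" "semistandard n m t (Rset p q) J'"
          then show "Pt n m t I' J' \<in> sideal par_Z ?C ?G" by (intro sideal.gen) blast
        qed
      qed
    qed
    show "sideal par_Z ?C ?G \<subseteq> ker_Phi k l p q n m"
    proof
      fix f assume f: "f \<in> sideal par_Z ?C ?G"
      have "Phi n m f = 0" using f
      proof induction
        case zero
        then show ?case by (simp only: Phi_def seval_lin lin_zero)
      next
        case (gen g)
        then show ?case using Phi_Pt by blast
      next
        case (add a b)
        have "a \<in> ?C" "b \<in> ?C" using sideal_subset[OF G add(1)] sideal_subset[OF G add(2)] by auto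
        then have "fsupp a" "fsupp b" unfolding spolys_on_def spolys_iff by blast+
        then show ?case using Phi_add[of a b n m] add(3,4) by (simp only: add_0)
      next
        case (mult_left a r)
        have "a \<in> spolys par_Z" "r \<in> spolys par_Z"
          using sideal_subset[OF G mult_left(1)] mult_left(2) unfolding spolys_on_def by blast+
        then show ?case using mult_left(3) by (simp only: Phi_smult smult_zero_left smult_zero_right)
      next
        case (mult_right a r)
        have "a \<in> spolys par_Z" "r \<in> spolys par_Z"
          using sideal_subset[OF G mult_right(1)] mult_right(2) unfolding spolys_on_def by blast+
        then show ?case using mult_right(3) by (simp only: Phi_smult smult_zero_left smult_zero_right)
      qed
      then show "f \<in> ker_Phi k l p q n m" using sideal_subset[OF G f] by (simp add: ker_Phi_def)
    qed
  qed
qed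

end
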